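(* There is a randomized Monte Carlo algorithm solving Vector Bin Packing with Few Small Items in time $2^k\cdot n^{O(1)}$, where $k$ is the number of small items and $n$ is the input size.
   Context: Vector Bin Packing with Few Small Items: the input is a set of $n$ items $V=\{v_1,\dots,v_n\}\subseteq\mathbb{Q}_{\geqslant 0}^d$, a subset $V_S\subseteq V$ of $k$ items (the small items) such that $V_L=V\setminus V_S$ is 3-incompatible, and an integer $\ell\in\mathbb{Z}_+$. A set $V'\subseteq V$ is 3-incompatible if for every three distinct $u,v,w\in V'$ there is a coordinate $i\in[d]$ with $u[i]+v[i]+w[i]>1$. The question is whether $V$ can be partitioned into $\ell$ bins $B_1\cup\dots\cup B_\ell=V$ with $\sum_{v\in B_i}v[j]\leqslant 1$ for every $i\in[\ell]$ and every $j\in[d]$. The parameter is $k$. *)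

theory Defs
  imports "HOL-Probability.Probability" "HOL-Library.Log_Nat"
begin

section \<open>Vector Bin Packing with Few Small Items\<close>

text \<open>
  Items are addressed by their position in the list, so two items may have the same vector.
  A vector of \<open>\<rat>\<^sup>d\<close> is a list of \<open>d\<close> rationals.
\<close>

record vbp_instance =
  vdim :: nat
  items :: "rat list list"
  small :: "nat set"
  nbins :: nat

definition three_incompatible :: "nat \<Rightarrow> rat list list \<Rightarrow> nat set \<Rightarrow> bool" where
  "three_incompatible d V I \<longleftrightarrow>
     (\<forall>u\<in>I. \<forall>v\<in>I. \<forall>w\<in>I. u \<noteq> v \<and> u \<noteq> w \<and> v \<noteq> w \<longrightarrow>
        (\<exists>j<d. V ! u ! j + V ! v ! j + V ! w ! j > 1))"

definition vbp_few_small :: "vbp_instance \<Rightarrow> bool" where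
  "vbp_few_small I \<longleftrightarrow>
     (\<forall>v \<in> set (items I). length v = vdim I \<and> (\<forall>x \<in> set v. 0 \<le> x)) \<and>
     small I \<subseteq> {..<length (items I)} \<and>
     three_incompatible (vdim I) (items I) ({..<length (items I)} - small I) \<and>
     0 < nbins I"

text \<open>Bins may be empty.\<close>

definition packable :: "vbp_instance \<Rightarrow> bool" where
  "packable I \<longleftrightarrow>
     (\<exists>B :: nat \<Rightarrow> nat set.
        disjoint_family_on B {..<nbins I} \<and>
        (\<Union>i<nbins I. B i) = {..<length (items I)} \<and>
        (\<forall>i<nbins I. \<forall>j<vdim I. (\<Sum>v\<in>B i. items I ! v ! j) \<le> 1))"

definition encode_rat :: "rat \<Rightarrow> nat list" where
  "encode_rat x = (case quotient_of x of (p, q) \<Rightarrow> [nat p, nat q])"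

definition encode_vbp :: "vbp_instance \<Rightarrow> nat list" where
  "encode_vbp I =
     [length (items I), vdim I, nbins I]
     @ map (\<lambda>i. if i \<in> small I then 1 else 0) [0..<length (items I)]
     @ concat (map (\<lambda>v. concat (map encode_rat v)) (items I))"


section \<open>Randomized random access machines with logarithmic cost\<close>

text \<open>
  Structured programs of a random access machine whose registers hold natural numbers.
  Costs are bit costs: accessing a register is charged the length of its address
  and of its contents; addition and subtraction are charged the sum of the lengths of
  the operands, and multiplication and division their product, as for the schoolbook algorithms.
\<close>

definition len :: "nat \<Rightarrow> nat" where
  "len n = max 1 (floorlog 2 n)"

datatype aop = Add | Sub | Mul | Div | Mod

datatype aexp =
    Const nat
  | Reg aexp  \<comment> \<open>contents of the register whose address is the value of the argument\<close>
  | Op aop aexp aexp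

datatype com =
    Skip
  | Assign aexp aexp  \<comment> \<open>target address, new contents\<close>
  | Toss aexp         \<comment> \<open>store a random bit at the given address\<close>
  | Seq com com
  | If aexp com com   \<comment> \<open>nonzero means true\<close>
  | While aexp com

type_synonym mem = "nat \<Rightarrow> nat"

text \<open>\<open>Sub\<close> is truncated subtraction; division by \<open>0\<close> follows the convention of \<^typ>\<open>nat\<close>.\<close>

fun op_val :: "aop \<Rightarrow> nat \<Rightarrow> nat \<Rightarrow> nat" where
  "op_val Add m n = m + n"
| "op_val Sub m n = m - n"
| "op_val Mul m n = m * n"
| "op_val Div m n = m div n"
| "op_val Mod m n = m mod n"

fun op_cost :: "aop \<Rightarrow> nat \<Rightarrow> nat \<Rightarrow> nat" where
  "op_cost Add m n = len m + len n"
| "op_cost Sub m n = len m + len n"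
| "op_cost Mul m n = len m * len n"
| "op_cost Div m n = len m * len n"
| "op_cost Mod m n = len m * len n"

fun aval :: "aexp \<Rightarrow> mem \<Rightarrow> nat" where
  "aval (Const n) s = n"
| "aval (Reg a) s = s (aval a s)"
| "aval (Op f a b) s = op_val f (aval a s) (aval b s)"

fun acost :: "aexp \<Rightarrow> mem \<Rightarrow> nat" where
  "acost (Const n) s = len n"
| "acost (Reg a) s = acost a s + len (aval a s) + len (s (aval a s))"
| "acost (Op f a b) s = acost a s + acost b s + op_cost f (aval a s) (aval b s)"

text \<open>
  \<open>exec c (s, \<omega>) t (s', \<omega>')\<close>: started with memory \<open>s\<close> and the coin sequence \<open>\<omega>\<close>, program \<open>c\<close>
  halts with memory \<open>s'\<close> after cost \<open>t\<close>, where \<open>\<omega>'\<close> is the unused rest of the coin sequence.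
\<close>

inductive exec :: "com \<Rightarrow> mem \<times> bool stream \<Rightarrow> nat \<Rightarrow> mem \<times> bool stream \<Rightarrow> bool" where
  Skip: "exec Skip (s, \<omega>) 1 (s, \<omega>)"
| Assign: "exec (Assign a b) (s, \<omega>)
     (acost a s + acost b s + len (aval a s) + len (aval b s))
     (s(aval a s := aval b s), \<omega>)"
| Toss: "exec (Toss a) (s, \<omega>) (acost a s + len (aval a s) + 1)
     (s(aval a s := of_bool (shd \<omega>)), stl \<omega>)"
| Seq: "exec c1 p t1 q \<Longrightarrow> exec c2 q t2 r \<Longrightarrow> exec (Seq c1 c2) p (t1 + t2) r"
| IfTrue: "aval b s \<noteq> 0 \<Longrightarrow> exec c1 (s, \<omega>) t q \<Longrightarrow>
     exec (If b c1 c2) (s, \<omega>) (acost b s + 1 + t) q"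
| IfFalse: "aval b s = 0 \<Longrightarrow> exec c2 (s, \<omega>) t q \<Longrightarrow>
     exec (If b c1 c2) (s, \<omega>) (acost b s + 1 + t) q"
| WhileFalse: "aval b s = 0 \<Longrightarrow> exec (While b c) (s, \<omega>) (acost b s + 1) (s, \<omega>)"
| WhileTrue: "aval b s \<noteq> 0 \<Longrightarrow> exec c (s, \<omega>) t1 q \<Longrightarrow> exec (While b c) q t2 r \<Longrightarrow>
     exec (While b c) (s, \<omega>) (acost b s + 1 + t1 + t2) r"

lemma exec_deterministic:
  "exec c p t q \<Longrightarrow> exec c p t' q' \<Longrightarrow> t' = t \<and> q' = q"
proof (induction arbitrary: t' q' rule: exec.induct)
  case (Seq c1 p t1 q c2 t2 r)
  from Seq.prems obtain u1 q1 u2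
    where u: "exec c1 p u1 q1" "exec c2 q1 u2 q'" "t' = u1 + u2"
    by cases
  with Seq.IH(1)[OF u(1)] Seq.IH(2)[of u2 q'] show ?case by simp
next
  case (IfTrue b s c1 \<omega> t q c2)
  from IfTrue.prems IfTrue.hyps obtain u
    where u: "exec c1 (s, \<omega>) u q'" "t' = acost b s + 1 + u"
    by cases simp_all
  with IfTrue.IH[OF u(1)] show ?case by simp
next
  case (IfFalse b s c2 \<omega> t q c1)
  from IfFalse.prems IfFalse.hyps obtain u
    where u: "exec c2 (s, \<omega>) u q'" "t' = acost b s + 1 + u"
    by cases simp_all
  with IfFalse.IH[OF u(1)] show ?case by simp
next
  case (WhileFalse b s c \<omega>)
  from WhileFalse.prems WhileFalse.hyps show ?case by cases simp_all
next
  case (WhileTrue b s c \<omega> t1 q t2 r)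
  from WhileTrue.prems WhileTrue.hyps(1) obtain u1 q1 u2
    where u: "exec c (s, \<omega>) u1 q1" "exec (While b c) q1 u2 q'" "t' = acost b s + 1 + u1 + u2"
    by cases simp_all
  with WhileTrue.IH(1)[OF u(1)] WhileTrue.IH(2)[of u2 q'] show ?case by simp
next
  case (Skip s \<omega>)
  then show ?case by cases simp
next
  case (Assign a s b \<omega>)
  then show ?case by cases simp
next
  case (Toss a s \<omega>)
  then show ?case by cases simp
qed

text \<open>The input is stored one number per register, preceded by its length.\<close>

definition init_mem :: "nat list \<Rightarrow> mem" where
  "init_mem xs a =
     (if a = 0 then length xs else if a \<le> length xs then xs ! (a - 1) else 0)"

definition input_size :: "nat list \<Rightarrow> nat" where
  "input_size xs = sum_list (map len xs)"

definition coin_space :: "bool stream measure" where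
  "coin_space = stream_space (measure_pmf (bernoulli_pmf (1/2)))"

definition halts_within :: "com \<Rightarrow> nat list \<Rightarrow> bool stream \<Rightarrow> nat \<Rightarrow> bool" where
  "halts_within c xs \<omega> T \<longleftrightarrow> (\<exists>t q. exec c (init_mem xs, \<omega>) t q \<and> t \<le> T)"

text \<open>The answer is read off register \<open>0\<close>; nonzero means yes.\<close>

definition answers :: "com \<Rightarrow> nat list \<Rightarrow> bool stream \<Rightarrow> bool \<Rightarrow> bool" where
  "answers c xs \<omega> b \<longleftrightarrow>
     (\<exists>t s \<omega>'. exec c (init_mem xs, \<omega>) t (s, \<omega>') \<and> (b \<longleftrightarrow> s 0 \<noteq> 0))"

text \<open>
  Program \<open>c\<close> solves a promise problem: on every instance \<open>I\<close> satisfying the promise, it halts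
  within time \<open>T I\<close> for every outcome of the coins, and its answer is correct with probability at
  least \<open>2/3\<close>.
\<close>

definition monte_carlo_solves ::
    "com \<Rightarrow> ('i \<Rightarrow> bool) \<Rightarrow> ('i \<Rightarrow> nat list) \<Rightarrow> ('i \<Rightarrow> bool) \<Rightarrow> ('i \<Rightarrow> nat) \<Rightarrow> bool" where
  "monte_carlo_solves c promise enc yes T \<longleftrightarrow>
     (\<forall>I. promise I \<longrightarrow>
        (\<forall>\<omega>. halts_within c (enc I) \<omega> (T I)) \<and>
        measure coin_space {\<omega> \<in> space coin_space. answers c (enc I) \<omega> (yes I)} \<ge> 2/3)"

end

theory Submission
  imports Defs "HOL-Library.Nat_Bijection"
begin

text \<open>
  A bin contains at most two large items. Pad the \<open>m\<close> large items to \<open>2 l\<close> vertices by dummies, where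
  \<open>l\<close> is the number of bins, capped by the number \<open>n\<close> of items. A packing is then a perfect
  matching of the vertices together with a set of small items for every edge, such that every
  edge with its set fits into a bin and the sets cover the small items. Give every pair of an edge
  and a feasible set a random weight in a field of characteristic two with more than \<open>3 n\<close>
  elements, and let \<open>A Z\<close> be the symmetric matrix whose entry at \<open>u v\<close> sums the weights of the
  feasible subsets of \<open>Z\<close> at that edge. In the sum of the hafnians of \<open>A Z\<close> over all sets \<open>Z\<close> of small
  items, every assignment that is not covering is counted an even number of times, and the
  covering ones contribute distinct monomials of degree \<open>l\<close>. By Schwartz--Zippel, the sum is nonzero
  with probability at least \<open>2 / 3\<close> if there is a packing, and it vanishes otherwise.

  All matrices are obtained at once by a subset sum transform in \<open>2 ^ k\<close> steps up to polynomial
  factors. In characteristic two the hafnian is a square root of the determinant of an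
  alternating matrix, so it is computed by symmetric elimination. The field is a tower of
  quadratic extensions of the field of two elements, coded by natural numbers with
  bitwise exclusive or as addition.
\<close>

text \<open>Covering the small items suffices where a partition is wanted: the vectors are
  nonnegative, so an item that occurs in several bins can be deleted from all but one. The obstacle
  outside the algebra is the cost model. Operations are charged by bit length, so polynomially many
  operations do not yet give polynomial time; every stored number also needs polynomially many bits.
  The program is therefore written in a small deterministic language of arrays and bounded loops, in
  which sums and products are reduced modulo a cap computed from the input before they are stored.
  Correctness shows that these reductions never change a value, size bounds follow from the syntax
  alone, and a generic theorem converts loop nesting into a time bound for the compiled code. The
  factor \<open>2 ^ k\<close> enters only once because no two loops of that length are nested. All
  coins are tossed in one loop before the main stage and kept in an array. The language thus stays
  free of randomness, and the answer depends on a coin prefix whose length is fixed by the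
  instance.\<close>

datatype ex = Cst nat | Inp ex | Arr nat ex | Bin aop ex ex

datatype prog =
    Nop
  | Store nat ex ex
  | Sq prog prog (infixr ";;" 60)
  | Cond ex prog prog
  | For nat nat prog

text \<open>
  A state consists of zero-initialised arrays, of which array 0 is the read-only input with its length at
  index 0; a variable is entry 0 of its array. The loop \<open>For a b p\<close> runs the variable \<open>a\<close> from 0
  up to, but not including, the variable \<open>b\<close>.
\<close>

type_synonym st = "nat \<Rightarrow> nat \<Rightarrow> nat"

section \<open>Semantics of the loop language and invariant rules for its loops\<close>

definition upd :: "st \<Rightarrow> nat \<Rightarrow> nat \<Rightarrow> nat \<Rightarrow> st" where
  "upd \<sigma> a i v = \<sigma>(a := (\<sigma> a)(i := v))"

lemma upd_same [simp]: "upd \<sigma> a i v a = (\<sigma> a)(i := v)"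
  by (simp add: upd_def)

lemma upd_other [simp]: "b \<noteq> a \<Longrightarrow> upd \<sigma> a i v b = \<sigma> b"
  by (simp add: upd_def)

lemma upd_apply: "upd \<sigma> a i v b j = (if b = a \<and> j = i then v else \<sigma> b j)"
  by (simp add: upd_def)

text \<open>\<open>Inp\<close> clamps its index to the input length because the registers behind the
  input hold the work arrays. A clamped read stays inside the input for every index, and the clamp
  compiles to \<open>x - (x - L)\<close>.\<close>

primrec eval :: "ex \<Rightarrow> st \<Rightarrow> nat" where
  "eval (Cst n) \<sigma> = n"
| "eval (Inp e) \<sigma> = \<sigma> 0 (min (eval e \<sigma>) (\<sigma> 0 0))"
| "eval (Arr a e) \<sigma> = \<sigma> a (eval e \<sigma>)"
| "eval (Bin f e e') \<sigma> = op_val f (eval e \<sigma>) (eval e' \<sigma>)"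

definition bump :: "nat \<Rightarrow> st \<Rightarrow> st" where
  "bump a \<sigma> = upd \<sigma> a 0 (Suc (\<sigma> a 0))"

primrec run :: "prog \<Rightarrow> st \<Rightarrow> st" where
  "run Nop \<sigma> = \<sigma>"
| "run (Store a i e) \<sigma> = upd \<sigma> a (eval i \<sigma>) (eval e \<sigma>)"
| "run (Sq p p') \<sigma> = run p' (run p \<sigma>)"
| "run (Cond e p p') \<sigma> = (if eval e \<sigma> \<noteq> 0 then run p \<sigma> else run p' \<sigma>)"
| "run (For a b p) \<sigma> = ((\<lambda>\<tau>. bump a (run p \<tau>)) ^^ \<sigma> b 0) (upd \<sigma> a 0 0)"

primrec writes :: "prog \<Rightarrow> nat set" where
  "writes Nop = {}"
| "writes (Store a i e) = {a}"
| "writes (Sq p p') = writes p \<union> writes p'"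
| "writes (Cond e p p') = writes p \<union> writes p'"
| "writes (For a b p) = insert a (writes p)"

text \<open>\<open>run\<close> reads the limit of a loop once, but the compiled loop reads it at
  every test, and the time bound refers to its value at the start. The simulation therefore asks
  that no variable in \<open>limits p\<close> is in \<open>writes p\<close>.\<close>

primrec limits :: "prog \<Rightarrow> nat set" where
  "limits Nop = {}"
| "limits (Store a i e) = {}"
| "limits (Sq p p') = limits p \<union> limits p'"
| "limits (Cond e p p') = limits p \<union> limits p'"
| "limits (For a b p) = insert b (limits p)"

primrec wfe :: "ex \<Rightarrow> bool" where
  "wfe (Cst n) = (n < 64)"
| "wfe (Inp e) = wfe e"
| "wfe (Arr a e) = (0 < a \<and> a < 64 \<and> wfe e)"
| "wfe (Bin f e e') = (wfe e \<and> wfe e')"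

primrec wf_prog :: "prog \<Rightarrow> bool" where
  "wf_prog Nop = True"
| "wf_prog (Store a i e) = (0 < a \<and> a < 64 \<and> wfe i \<and> wfe e)"
| "wf_prog (Sq p p') = (wf_prog p \<and> wf_prog p')"
| "wf_prog (Cond e p p') = (wfe e \<and> wf_prog p \<and> wf_prog p')"
| "wf_prog (For a b p) = (0 < a \<and> a < 64 \<and> 0 < b \<and> b < 64 \<and> a \<notin> writes p \<and> wf_prog p)"

text \<open>Only values written by \<open>Store\<close> are checked. Loop counters are bounded by
  their limits, which are stored values themselves, and intermediate results of expressions are
  bounded by powers of \<open>M\<close>.\<close>

primrec ok :: "nat \<Rightarrow> prog \<Rightarrow> st \<Rightarrow> bool" where
  "ok M Nop \<sigma> = True"
| "ok M (Store a i e) \<sigma> = (eval e \<sigma> < M)"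
| "ok M (Sq p p') \<sigma> = (ok M p \<sigma> \<and> ok M p' (run p \<sigma>))"
| "ok M (Cond e p p') \<sigma> = (if eval e \<sigma> \<noteq> 0 then ok M p \<sigma> else ok M p' \<sigma>)"
| "ok M (For a b p) \<sigma> = (\<forall>i<\<sigma> b 0. ok M p (((\<lambda>\<tau>. bump a (run p \<tau>)) ^^ i) (upd \<sigma> a 0 0)))"

lemma run_frame: "a \<notin> writes p \<Longrightarrow> run p \<sigma> a = \<sigma> a"
proof (induction p arbitrary: \<sigma>)
  case (For b c p)
  have "((\<lambda>\<tau>. bump b (run p \<tau>)) ^^ i) \<tau> a = \<tau> a" for i \<tau>
    using For by (induction i) (auto simp: bump_def upd_def)
  then show ?case using For.prems by (simp add: upd_def)
qed (auto simp: upd_def)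

lemma For_frame:
  "x \<notin> insert a (writes p) \<Longrightarrow> ((\<lambda>\<tau>. bump a (run p \<tau>)) ^^ i) (upd \<sigma> a 0 0) x = \<sigma> x"
  by (induction i) (auto simp: bump_def upd_def run_frame)

lemma For_counter:
  "a \<notin> writes p \<Longrightarrow> ((\<lambda>\<tau>. bump a (run p \<tau>)) ^^ i) (upd \<sigma> a 0 0) a 0 = i"
  by (induction i) (auto simp: bump_def run_frame)

text \<open>The step receives the counter value and agreement with the start state on all arrays
  outside \<open>writes p\<close>, so an invariant only has to mention what the loop changes. The
  version for a partial number of rounds serves where states inside the loop matter, as for value
  bounds.\<close>

lemma For_iter_rule:
  assumes "a \<notin> writes p" "I 0 (upd \<sigma> a 0 0)"
    and step: "\<And>i \<tau>. i < n \<Longrightarrow> \<tau> a 0 = i \<Longrightarrow> (\<And>x. x \<notin> insert a (writes p) \<Longrightarrow> \<tau> x = \<sigma> x) \<Longrightarrow>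
      I i \<tau> \<Longrightarrow> I (Suc i) (upd (run p \<tau>) a 0 (Suc i))"
    and "i \<le> n"
  shows "I i (((\<lambda>\<tau>. bump a (run p \<tau>)) ^^ i) (upd \<sigma> a 0 0))"
  using \<open>i \<le> n\<close>
proof (induction i)
  case 0
  then show ?case using assms(2) by simp
next
  case (Suc i)
  let ?\<tau> = "((\<lambda>\<tau>. bump a (run p \<tau>)) ^^ i) (upd \<sigma> a 0 0)"
  have "I (Suc i) (upd (run p ?\<tau>) a 0 (Suc i))"
    using Suc assms(1) by (intro step) (auto simp: For_counter For_frame)
  moreover have "run p ?\<tau> a 0 = i"
    using assms(1) by (simp add: For_counter run_frame)
  ultimately show ?case by (simp add: bump_def)
qed

lemma For_rule:
  assumes "a \<notin> writes p" "I 0 (upd \<sigma> a 0 0)"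
    and "\<And>i \<tau>. i < \<sigma> b 0 \<Longrightarrow> \<tau> a 0 = i \<Longrightarrow> (\<And>x. x \<notin> insert a (writes p) \<Longrightarrow> \<tau> x = \<sigma> x) \<Longrightarrow>
      I i \<tau> \<Longrightarrow> I (Suc i) (upd (run p \<tau>) a 0 (Suc i))"
  shows "I (\<sigma> b 0) (run (For a b p) \<sigma>)"
  using For_iter_rule[where i = "\<sigma> b 0" and n = "\<sigma> b 0" and I = I, OF assms(1,2)] assms(3) by simp

subsection \<open>Value bounds\<close>

text \<open>Array 1 holds the modulus by which arithmetic results are capped before being stored.\<close>

abbreviation (input) "vcap \<equiv> Suc 0"

text \<open>Truncated subtraction, division and remainder never exceed their first operand and
  inherit its bound; sums and products need a reduction modulo the cap.\<close>

primrec capped :: "ex \<Rightarrow> bool" where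
  "capped (Cst n) = True"
| "capped (Inp e) = True"
| "capped (Arr a e) = True"
| "capped (Bin f e e') = ((f = Sub \<or> f = Div \<or> f = Mod) \<and> capped e \<or> f = Mod \<and> e' = Arr vcap (Cst 0))"

primrec safe :: "prog \<Rightarrow> bool" where
  "safe Nop = True"
| "safe (Store a i e) = (a \<noteq> vcap \<and> capped e)"
| "safe (Sq p p') = (safe p \<and> safe p')"
| "safe (Cond e p p') = (safe p \<and> safe p')"
| "safe (For a b p) = (a \<noteq> vcap \<and> b \<notin> insert a (writes p) \<and> safe p)"

lemma capped_less:
  assumes "capped e" "wfe e" "\<And>a i. \<sigma> a i \<le> \<sigma> vcap 0" "64 \<le> \<sigma> vcap 0"
  shows "eval e \<sigma> \<le> \<sigma> vcap 0"
  using assms(1,2)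
proof (induction e)
  case (Bin f e e')
  have "eval (Bin f e e') \<sigma> \<le> eval e \<sigma>" if "f = Sub \<or> f = Div \<or> f = Mod"
    using that by auto
  moreover have "eval (Bin Mod e (Arr vcap (Cst 0))) \<sigma> \<le> \<sigma> vcap 0"
    using assms(4) by (simp add: less_imp_le)
  ultimately show ?case using Bin by (auto intro: order_trans)
qed (use assms in auto)

lemma writes_safe: "safe p \<Longrightarrow> vcap \<notin> writes p"
  by (induction p) auto

text \<open>The bound follows from syntax, without knowing what is computed, so sizes and
  correctness can be treated separately. A loop counter ends at the value of its limit, which is
  bounded as a stored value.\<close>

lemma safe_ok:
  assumes "safe p" "wf_prog p" "\<And>a i. \<sigma> a i \<le> \<sigma> vcap 0" "64 \<le> \<sigma> vcap 0"
  shows "ok (Suc (\<sigma> vcap 0)) p \<sigma> \<and> (\<forall>a i. run p \<sigma> a i \<le> \<sigma> vcap 0)"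
  using assms
proof (induction p arbitrary: \<sigma>)
  case (Store a i e)
  then show ?case using capped_less[of e \<sigma>] by (auto simp: less_Suc_eq_le upd_apply)
next
  case (Sq p p')
  have "run p \<sigma> vcap = \<sigma> vcap" using Sq.prems(1) by (intro run_frame) (auto dest: writes_safe)
  then show ?case using Sq.IH(1)[of \<sigma>] Sq.IH(2)[of "run p \<sigma>"] Sq.prems by auto
next
  case (For a b p)
  let ?f = "\<lambda>i. ((\<lambda>\<tau>. bump a (run p \<tau>)) ^^ i) (upd \<sigma> a 0 0)"
  have a: "a \<notin> writes p" "vcap \<notin> writes p" using For.prems writes_safe by auto
  have cap: "?f i vcap = \<sigma> vcap" for i using a For.prems by (intro For_frame) auto
  have bd: "\<forall>x j. ?f i x j \<le> \<sigma> vcap 0" if "i \<le> \<sigma> b 0" for i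
    using that
  proof (induction i)
    case 0
    then show ?case using For.prems by (simp add: upd_apply)
  next
    case (Suc i)
    have "\<forall>x j. run p (?f i) x j \<le> ?f i vcap 0"
      using For.IH[of "?f i"] For.prems Suc by (simp add: cap)
    moreover have "Suc (run p (?f i) a 0) \<le> \<sigma> vcap 0"
      using Suc.prems For.prems(3)[of b 0] a by (simp add: run_frame For_counter)
    moreover have "?f (Suc i) x j = (if x = a \<and> j = 0 then Suc (run p (?f i) a 0) else run p (?f i) x j)" for x j
      unfolding funpow.simps o_apply bump_def by (rule upd_apply)
    ultimately show ?case using cap[of i] by (metis (no_types, lifting))
  qed
  have "ok (Suc (\<sigma> vcap 0)) p (?f i)" if "i < \<sigma> b 0" for i
    using For.IH[of "?f i"] bd[of i] that For.prems by (simp add: cap)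
  then show ?case using bd by auto
qed auto

subsection \<open>Compilation\<close>

text \<open>
  Register 0 keeps the input length \<open>L\<close>, so \<open>L + 1\<close> is the first free register;
  entry \<open>i\<close> of array \<open>a\<close> lives at \<open>L + 1 + 64 * i + a\<close>.
\<close>

definition cadr :: "nat \<Rightarrow> aexp \<Rightarrow> aexp" where
  "cadr a e = Op Add (Op Mul (Const 64) e) (Op Add (Reg (Const 0)) (Const (Suc a)))"

primrec cexp :: "ex \<Rightarrow> aexp" where
  "cexp (Cst n) = Const n"
| "cexp (Inp e) = Reg (Op Sub (cexp e) (Op Sub (cexp e) (Reg (Const 0))))"
| "cexp (Arr a e) = Reg (cadr a (cexp e))"
| "cexp (Bin f e e') = Op f (cexp e) (cexp e')"

definition cvar :: "nat \<Rightarrow> aexp" where "cvar a = Reg (cadr a (Const 0))"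

definition cincr :: "nat \<Rightarrow> com" where
  "cincr a = Assign (cadr a (Const 0)) (Op Add (cvar a) (Const 1))"

definition cguard :: "nat \<Rightarrow> nat \<Rightarrow> aexp" where
  "cguard a b = Op Sub (cvar b) (cvar a)"

definition cfor :: "nat \<Rightarrow> nat \<Rightarrow> com \<Rightarrow> com" where
  "cfor a b c = Seq (Assign (cadr a (Const 0)) (Const 0)) (While (cguard a b) (Seq c (cincr a)))"

primrec cprog :: "prog \<Rightarrow> com" where
  "cprog Nop = Skip"
| "cprog (Store a i e) = Assign (cadr a (cexp i)) (cexp e)"
| "cprog (Sq p p') = Seq (cprog p) (cprog p')"
| "cprog (Cond e p p') = If (cexp e) (cprog p) (cprog p')"
| "cprog (For a b p) = cfor a b (cprog p)"

definition rel :: "nat \<Rightarrow> mem \<Rightarrow> st \<Rightarrow> bool" where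
  "rel L s \<sigma> \<longleftrightarrow> \<sigma> 0 0 = L \<and> (\<forall>i\<le>L. s i = \<sigma> 0 i) \<and>
     (\<forall>a i. 0 < a \<and> a < 64 \<longrightarrow> s (64 * i + (L + Suc a)) = \<sigma> a i)"

lemma aval_cexp:
  assumes "rel L s \<sigma>" "wfe e"
  shows "aval (cexp e) s = eval e \<sigma>"
  using assms(2)
proof (induction e)
  case (Inp e)
  have "x - (x - L) = min x L" for x :: nat by simp
  then show ?case using Inp assms(1) by (simp add: rel_def)
qed (use assms(1) in \<open>auto simp: rel_def cadr_def\<close>)

lemma aval_cadr: "rel L s \<sigma> \<Longrightarrow> aval (cadr a e) s = 64 * aval e s + (L + Suc a)"
  by (simp add: cadr_def rel_def)

text \<open>Distinct cells have distinct addresses: the remainder modulo 64 determines the array,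
  and then the quotient determines the index. Cells with \<open>0 < a\<close> lie behind the input,
  so the input registers survive.\<close>

lemma rel_upd:
  assumes "rel L s \<sigma>" "0 < a" "a < 64"
  shows "rel L (s(64 * i + (L + Suc a) := v)) (upd \<sigma> a i v)"
proof -
  let ?s = "s(64 * i + (L + Suc a) := v)"
  have *: "b = a \<and> j = i" if "b < 64" "64 * j + (L + Suc b) = 64 * i + (L + Suc a)" for b j
  proof -
    have e: "64 * j + b = 64 * i + a" using that by simp
    have "b = a" using arg_cong[OF e, of "\<lambda>x. x mod 64"] that assms(3) by simp
    with e show ?thesis by simp
  qed
  have "?s (64 * j + (L + Suc b)) = upd \<sigma> a i v b j" if "0 < b" "b < 64" for b j
  proof (cases "b = a \<and> j = i")
    case False
    then have "64 * j + (L + Suc b) \<noteq> 64 * i + (L + Suc a)" using * that by blast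
    then have "?s (64 * j + (L + Suc b)) = s (64 * j + (L + Suc b))" by (rule fun_upd_other)
    also have "\<dots> = \<sigma> b j" using that assms(1) unfolding rel_def by blast
    finally show ?thesis using False by (simp only: upd_apply if_False)
  qed simp
  then show ?thesis using assms by (simp add: rel_def)
qed

subsection \<open>Costs\<close>

text \<open>The exponent for which values stay below \<open>M ^ asize e\<close> when registers and
  constants stay below \<open>M\<close>. A register read counts as one factor, whatever its address
  expression; an operation adds the exponents of its operands.\<close>

primrec asize :: "aexp \<Rightarrow> nat" where
  "asize (Const n) = 1"
| "asize (Reg e) = 1"
| "asize (Op f e e') = asize e + asize e'"

primrec aconsts :: "aexp \<Rightarrow> nat set" where
  "aconsts (Const n) = {n}"
| "aconsts (Reg e) = aconsts e"
| "aconsts (Op f e e') = aconsts e \<union> aconsts e'"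

text \<open>Coefficient of \<open>(len M)\<^sup>2\<close> in the cost. The square comes from
  products and quotients, which are charged the product of two lengths; each length is at most
  \<open>asize\<close> times \<open>len M\<close>.\<close>

primrec acb :: "aexp \<Rightarrow> nat" where
  "acb (Const n) = 1"
| "acb (Reg e) = acb e + asize e + 1"
| "acb (Op f e e') = acb e + acb e' + asize e * asize e' + asize e + asize e'"

lemma asize_pos [simp]: "0 < asize e"
  by (induction e) auto

text \<open>Both powers are at least 2, and then a sum is at most a product. Addition thus obeys the
  same exponent rule as multiplication.\<close>

lemma power_add_bound:
  assumes "x < M ^ a" "y < M ^ b" "0 < a" "0 < b" "(2::nat) \<le> M"
  shows "x + y < M ^ (a + b)"
proof -
  have 2: "2 \<le> M ^ a" "2 \<le> M ^ b"
    using assms self_le_power[of M a] self_le_power[of M b] by linarith+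
  have "M ^ a + M ^ b \<le> M ^ a * M ^ b"
    using mult_le_mono2[OF 2(2), of "M ^ a"] mult_le_mono1[OF 2(1), of "M ^ b"] by linarith
  then show ?thesis using assms by (simp add: power_add)
qed

lemma aval_less:
  assumes "\<And>x. s x < M" "\<forall>n\<in>aconsts e. n < M" "2 \<le> M"
  shows "aval e s < M ^ asize e"
  using assms(2)
proof (induction e)
  case (Op f e e')
  have "x < M ^ a \<Longrightarrow> x < M ^ (a + b)" for x a b
    using assms(3) power_increasing[of a "a + b" M] by (meson le_add1 le_trans less_le_trans numeral_le_one_iff less_imp_le one_le_numeral)
  note up = this
  have IH: "aval e s < M ^ asize e" "aval e' s < M ^ asize e'" using Op by auto
  have "op_val f x y \<le> x \<or> op_val f x y = x + y \<or> op_val f x y = x * y" for x y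
    by (cases f) auto
  then consider "op_val f (aval e s) (aval e' s) \<le> aval e s"
    | "op_val f (aval e s) (aval e' s) = aval e s + aval e' s"
    | "op_val f (aval e s) (aval e' s) = aval e s * aval e' s" by blast
  then show ?case
  proof cases
    case 1
    then show ?thesis using up[OF IH(1), of "asize e'"] by simp
  next
    case 2
    then show ?thesis using power_add_bound[OF IH] assms(3) by simp
  next
    case 3
    then show ?thesis using IH by (simp add: power_add mult_strict_mono')
  qed
qed (use assms in auto)

lemma less_two_power_len: "n < 2 ^ len n"
proof (cases "n = 0")
  case False
  then have "n < 2 ^ floorlog 2 n" using floorlog_bounds[of n 2] by simp
  also have "\<dots> \<le> 2 ^ len n" by (simp add: len_def)
  finally show ?thesis .
qed (simp add: len_def)

lemma len_leI:
  assumes "n < 2 ^ k" "0 < k"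
  shows "len n \<le> k"
proof (cases "n = 0")
  case True
  then show ?thesis using assms by (simp add: len_def floorlog_def)
next
  case False
  then have "floorlog 2 n \<le> k" using floorlog_leD assms floorlog_leI by (metis less_eq_nat.simps(1) numeral_le_one_iff one_less_numeral_iff semiring_norm(76))
  then show ?thesis using assms by (simp add: len_def)
qed

lemma len_pos [simp]: "0 < len n" by (simp add: len_def)

lemma one_le_len_square: "1 \<le> (len M)\<^sup>2"
  using len_pos[of M] by (metis One_nat_def Suc_leI zero_less_power)

lemma len_less_power:
  assumes "x < M ^ a" "0 < a"
  shows "len x \<le> a * len M"
proof (rule len_leI)
  have "M ^ a \<le> (2 ^ len M) ^ a" by (rule power_mono[OF less_imp_le[OF less_two_power_len]]) simp
  then show "x < 2 ^ (a * len M)" using assms by (simp add: power_mult[symmetric] mult.commute)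
  show "0 < a * len M" using assms by simp
qed

lemma acost_le:
  assumes "\<And>x. s x < M" "\<forall>n\<in>aconsts e. n < M" "2 \<le> M"
  shows "acost e s \<le> acb e * (len M)\<^sup>2"
  using assms(2)
proof (induction e)
  case (Const n)
  have "len n \<le> 1 * len M" using Const by (intro len_less_power) auto
  also have "\<dots> \<le> (len M)\<^sup>2" using len_pos[of M] by (simp add: power2_eq_square Suc_le_eq del: len_pos)
  finally show ?case by simp
next
  case (Reg e)
  have u: "x * len M \<le> x * (len M)\<^sup>2" for x by (rule mult_le_mono2[OF self_le_power]) (simp_all add: Suc_le_eq)
  have "len (aval e s) \<le> asize e * len M" using aval_less[of s M e] assms Reg by (intro len_less_power) auto
  moreover have "len (s (aval e s)) \<le> 1 * len M" using assms(1) by (intro len_less_power) simp_all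
  moreover have "acost e s \<le> acb e * (len M)\<^sup>2" using Reg by simp
  ultimately show ?case using u[of "asize e"] u[of 1] unfolding acost.simps acb.simps distrib_right by linarith
next
  case (Op f e e')
  have u: "x * len M \<le> x * (len M)\<^sup>2" for x by (rule mult_le_mono2[OF self_le_power]) (simp_all add: Suc_le_eq)
  have l: "len (aval e s) \<le> asize e * len M" "len (aval e' s) \<le> asize e' * len M"
    using aval_less[of s M e] aval_less[of s M e'] assms Op.prems by (intro len_less_power; auto)+
  have "op_cost f (aval e s) (aval e' s) \<le> len (aval e s) * len (aval e' s) + len (aval e s) + len (aval e' s)"
    by (cases f) auto
  also have "\<dots> \<le> asize e * len M * (asize e' * len M) + asize e * len M + asize e' * len M"
    using l by (intro add_mono mult_mono) auto
  also have "\<dots> \<le> (asize e * asize e' + asize e + asize e') * (len M)\<^sup>2"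
    proof -
    have "asize e * len M * (asize e' * len M) = asize e * asize e' * (len M)\<^sup>2"
      by (simp add: power2_eq_square)
    then show ?thesis using u[of "asize e"] u[of "asize e'"] unfolding distrib_right by linarith
  qed
  finally show ?case using Op by (simp add: algebra_simps)
qed

lemma exec_Assign:
  assumes "\<And>x. s x < M" "\<forall>n\<in>aconsts a \<union> aconsts b. n < M" "2 \<le> M"
  obtains t where "exec (Assign a b) (s, \<omega>) t (s(aval a s := aval b s), \<omega>)"
    "t \<le> (acb a + acb b + asize a + asize b) * (len M)\<^sup>2"
proof
  show "exec (Assign a b) (s, \<omega>) (acost a s + acost b s + len (aval a s) + len (aval b s))
     (s(aval a s := aval b s), \<omega>)" by (rule exec.Assign)
  have u: "x * len M \<le> x * (len M)\<^sup>2" for x by (rule mult_le_mono2[OF self_le_power]) (simp_all add: Suc_le_eq)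
  have "len (aval a s) \<le> asize a * len M" "len (aval b s) \<le> asize b * len M"
    using aval_less[of s M a] aval_less[of s M b] assms by (intro len_less_power; auto)+
  moreover have "acost a s \<le> acb a * (len M)\<^sup>2" "acost b s \<le> acb b * (len M)\<^sup>2"
    using acost_le assms by auto
  ultimately show "acost a s + acost b s + len (aval a s) + len (aval b s)
      \<le> (acb a + acb b + asize a + asize b) * (len M)\<^sup>2"
    using u[of "asize a"] u[of "asize b"] unfolding distrib_right by linarith
qed

lemma aconsts_cexp: "wfe e \<Longrightarrow> n \<in> aconsts (cexp e) \<Longrightarrow> n \<le> 64"
  by (induction e) (auto simp: cadr_def)

lemma aconsts_cadr: "a < 64 \<Longrightarrow> n \<in> aconsts (cadr a e) \<Longrightarrow> n \<le> 64 \<or> n \<in> aconsts e"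
  by (auto simp: cadr_def)

definition acost2 :: "aexp \<Rightarrow> aexp \<Rightarrow> nat" where
  "acost2 a b = acb a + acb b + asize a + asize b"

text \<open>Initialisation, guard and increment are all charged to each of \<open>n + 1\<close>
  rounds. This pays for the last, failing guard test and makes the loop bound a single
  product.\<close>

definition forcost :: "nat \<Rightarrow> nat \<Rightarrow> nat" where
  "forcost a b = acost2 (cadr a (Const 0)) (Const 0) + acb (cguard a b) + 1
     + acost2 (cadr a (Const 0)) (Op Add (cvar a) (Const 1))"

primrec tb :: "(nat \<Rightarrow> nat) \<Rightarrow> prog \<Rightarrow> nat" where
  "tb N Nop = 1"
| "tb N (Store a i e) = acost2 (cadr a (cexp i)) (cexp e)"
| "tb N (Sq p p') = tb N p + tb N p'"
| "tb N (Cond e p p') = acb (cexp e) + 1 + tb N p + tb N p'"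
| "tb N (For a b p) = Suc (N b) * (tb N p + forcost a b)"

text \<open>The coin stream is threaded through the loop, so that the rule also covers the
  loop that tosses the coins.\<close>

lemma exec_for:
  assumes body: "\<And>i s \<omega>. i < n \<Longrightarrow> J i s \<omega> \<Longrightarrow>
      \<exists>t s' \<omega>'. exec c (s, \<omega>) t (s', \<omega>') \<and> t \<le> C * (len M)\<^sup>2 \<and> (\<forall>x. s' x < M) \<and>
        s' (L + Suc a) = i \<and> s' 0 = L \<and> J (Suc i) (s'(L + Suc a := Suc i)) \<omega>'"
    and J: "\<And>i s \<omega>. i \<le> n \<Longrightarrow> J i s \<omega> \<Longrightarrow>
        s 0 = L \<and> s (L + Suc a) = i \<and> s (L + Suc b) = n \<and> (\<forall>x. s x < M)"
    and init: "s 0 = L" "\<forall>x. s x < M" "J 0 (s(L + Suc a := 0)) \<omega>" "n < M"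
    and ab: "a < 64" "b < 64" "64 < M"
  shows "\<exists>t s' \<omega>'. exec (cfor a b c) (s, \<omega>) t (s', \<omega>') \<and> t \<le> Suc n * (C + forcost a b) * (len M)\<^sup>2 \<and>
     J n s' \<omega>'"
proof -
  let ?U = "(len M)\<^sup>2"
  let ?g = "acb (cguard a b) + 1"
  let ?i = "acost2 (cadr a (Const 0)) (Op Add (cvar a) (Const 1))"
  have cst: "\<forall>n\<in>aconsts (cguard a b). n < M"
    "\<forall>n\<in>aconsts (cadr a (Const 0)) \<union> aconsts (Op Add (cvar a) (Const 1)). n < M"
    "\<forall>n\<in>aconsts (cadr a (Const 0)) \<union> aconsts (Const 0). n < M"
    using ab by (auto simp: cguard_def cvar_def cadr_def)
  have M2: "2 \<le> M" using ab by simp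
  have guard: "acost (cguard a b) s + 1 \<le> ?g * ?U" if "\<forall>x. s x < M" for s
  proof -
    have "acost (cguard a b) s \<le> acb (cguard a b) * ?U" using that cst M2 by (intro acost_le) auto
    moreover have "1 \<le> ?U" by (rule one_le_len_square)
    ultimately show ?thesis by (simp only: distrib_right mult_1 add_mono)
  qed
  have loop: "\<exists>t s' \<omega>'. exec (While (cguard a b) (Seq c (cincr a))) (s, \<omega>) t (s', \<omega>') \<and>
      t \<le> (m * (C + ?i + ?g) + ?g) * ?U \<and> J n s' \<omega>'"
    if "J i s \<omega>" "i \<le> n" "m = n - i" for i m s \<omega>
    using that
  proof (induction m arbitrary: i s \<omega>)
    case 0
    then have [simp]: "i = n" by simp
    note j = J[OF _ 0(1)]
    have "aval (cguard a b) s = 0" using j by (simp add: cguard_def cvar_def cadr_def)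
    then have "exec (While (cguard a b) (Seq c (cincr a))) (s, \<omega>) (acost (cguard a b) s + 1) (s, \<omega>)"
      by (rule exec.WhileFalse)
    then show ?case using guard[of s] j 0 by (intro exI conjI) auto
  next
    case (Suc m)
    note j = J[OF _ Suc.prems(1)]
    have i: "i < n" using Suc.prems by simp
    have g: "aval (cguard a b) s \<noteq> 0" using j i by (simp add: cguard_def cvar_def cadr_def)
    obtain t1 s1 \<omega>1 where b1: "exec c (s, \<omega>) t1 (s1, \<omega>1)" "t1 \<le> C * ?U" "\<forall>x. s1 x < M"
        "s1 (L + Suc a) = i" "s1 0 = L" "J (Suc i) (s1(L + Suc a := Suc i)) \<omega>1"
      using body[OF i Suc.prems(1)] by (elim exE conjE) (rule that)
    obtain t2 where t2: "exec (cincr a) (s1, \<omega>1) t2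
          (s1(aval (cadr a (Const 0)) s1 := aval (Op Add (cvar a) (Const 1)) s1), \<omega>1)" "t2 \<le> ?i * ?U"
      unfolding cincr_def acost2_def by (rule exec_Assign[of s1 M, OF _ cst(2) M2]) (use b1(3) in auto)
    have e2: "exec (cincr a) (s1, \<omega>1) t2 (s1(L + Suc a := Suc i), \<omega>1)"
      using t2(1) b1(4,5) by (simp add: cadr_def cvar_def)
    obtain t3 s' \<omega>' where r: "exec (While (cguard a b) (Seq c (cincr a))) (s1(L + Suc a := Suc i), \<omega>1) t3 (s', \<omega>')"
      "t3 \<le> (m * (C + ?i + ?g) + ?g) * ?U" "J n s' \<omega>'"
    proof -
      have "Suc i \<le> n" "m = n - Suc i" using Suc.prems by auto
      from Suc.IH[OF b1(6) this] show ?thesis by (elim exE conjE) (rule that)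
    qed
    have "exec (While (cguard a b) (Seq c (cincr a))) (s, \<omega>)
        (acost (cguard a b) s + 1 + (t1 + t2) + t3) (s', \<omega>')"
      by (rule exec.WhileTrue[OF g exec.Seq[OF b1(1) e2] r(1)])
    moreover have "acost (cguard a b) s + 1 \<le> ?g * ?U" using j i by (intro guard) auto
    then have "acost (cguard a b) s + 1 + (t1 + t2) + t3 \<le> (Suc m * (C + ?i + ?g) + ?g) * ?U"
      using b1(2) t2(2) r(2) by (simp add: algebra_simps)
    ultimately show ?case using r(3) by (intro exI conjI)
  qed
  obtain t0 where t0: "exec (Assign (cadr a (Const 0)) (Const 0)) (s, \<omega>) t0
      (s(aval (cadr a (Const 0)) s := aval (Const 0) s), \<omega>)"
      "t0 \<le> acost2 (cadr a (Const 0)) (Const 0) * ?U"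
    unfolding acost2_def by (rule exec_Assign[of s M, OF _ cst(3) M2]) (use init(2) in auto)
  have e0: "exec (Assign (cadr a (Const 0)) (Const 0)) (s, \<omega>) t0 (s(L + Suc a := 0), \<omega>)"
    using t0(1) init(1) by (simp add: cadr_def)
  obtain t s' \<omega>' where t: "exec (While (cguard a b) (Seq c (cincr a))) (s(L + Suc a := 0), \<omega>) t (s', \<omega>')"
    "t \<le> (n * (C + ?i + ?g) + ?g) * ?U" "J n s' \<omega>'"
  proof -
    have "n = n - 0" by simp
    from loop[OF init(3) le0 this] show ?thesis by (elim exE conjE) (rule that)
  qed
  have "exec (cfor a b c) (s, \<omega>) (t0 + t) (s', \<omega>')"
    unfolding cfor_def by (rule exec.Seq[OF e0 t(1)])
  moreover have "t0 + t \<le> Suc n * (C + forcost a b) * ?U"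
  proof -
    let ?z = "acost2 (cadr a (Const 0)) (Const 0)"
    have "t0 + t \<le> (?z + (n * (C + ?i + ?g) + ?g)) * ?U"
      using t0(2) t(2) unfolding distrib_right by linarith
    moreover have "?z + (n * (C + ?i + ?g) + ?g) \<le> Suc n * (C + (?z + ?g + ?i))"
      unfolding mult_Suc distrib_left by linarith
    then have "(?z + (n * (C + ?i + ?g) + ?g)) * ?U \<le> Suc n * (C + (?z + ?g + ?i)) * ?U"
      by (rule mult_le_mono1)
    ultimately show ?thesis unfolding forcost_def by (simp only: ac_simps)
  qed
  ultimately show ?thesis using t(3) by (intro exI conjI)
qed

text \<open>The size of stored values enters the time only through the squared length of
  \<open>M\<close>, the control flow only through \<open>tb\<close>; both are estimated later. The
  coin sequence is returned untouched.\<close>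

theorem exec_cprog:
  assumes "wf_prog p" "rel L s \<sigma>" "\<forall>x. s x < M" "64 < M" "ok M p \<sigma>"
    "\<forall>b\<in>limits p. \<sigma> b 0 \<le> N b" "limits p \<inter> writes p = {}"
  shows "\<exists>t s'. exec (cprog p) (s, \<omega>) t (s', \<omega>) \<and> rel L s' (run p \<sigma>) \<and> (\<forall>x. s' x < M) \<and>
     t \<le> tb N p * (len M)\<^sup>2"
  using assms(1-3,5-)
proof (induction p arbitrary: s \<sigma>)
  case Nop
  have "exec Skip (s, \<omega>) 1 (s, \<omega>)" by (rule exec.Skip)
  moreover have "1 \<le> (len M)\<^sup>2" by (rule one_le_len_square)
  ultimately show ?case using Nop by (intro exI[of _ 1] exI[of _ s]) simp
next
  case (Store a i e)
  have "\<forall>n\<in>aconsts (cadr a (cexp i)) \<union> aconsts (cexp e). n < M"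
  proof
    fix n assume "n \<in> aconsts (cadr a (cexp i)) \<union> aconsts (cexp e)"
    then have "n \<le> 64"
      using Store.prems(1) aconsts_cexp[of i n] aconsts_cexp[of e n] aconsts_cadr[of a n "cexp i"] by auto
    then show "n < M" using assms(4) by simp
  qed
  moreover have "2 \<le> M" using assms(4) by simp
  ultimately obtain t where t: "exec (Assign (cadr a (cexp i)) (cexp e)) (s, \<omega>) t
      (s(aval (cadr a (cexp i)) s := aval (cexp e) s), \<omega>)"
      "t \<le> acost2 (cadr a (cexp i)) (cexp e) * (len M)\<^sup>2"
    unfolding acost2_def using exec_Assign[of s M "cadr a (cexp i)" "cexp e" \<omega>] Store.prems(3) by blast
  have v: "aval (cadr a (cexp i)) s = 64 * eval i \<sigma> + (L + Suc a)" "aval (cexp e) s = eval e \<sigma>"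
    using Store.prems by (simp_all add: aval_cadr aval_cexp)
  let ?s = "s(64 * eval i \<sigma> + (L + Suc a) := eval e \<sigma>)"
  have "exec (cprog (Store a i e)) (s, \<omega>) t (?s, \<omega>)" using t(1) unfolding v by (simp only: cprog.simps)
  moreover have "rel L ?s (run (Store a i e) \<sigma>)"
    using rel_upd[of L s \<sigma> a] Store.prems by (simp only: run.simps wf_prog.simps)
  moreover have "\<forall>x. ?s x < M" using Store.prems by simp
  ultimately show ?case using t(2) by (auto simp only: tb.simps)
next
  case (Sq p p')
  have dj: "limits p \<inter> writes p = {}" "limits p' \<inter> writes p' = {}" using Sq.prems by auto
  obtain t s' where t: "exec (cprog p) (s, \<omega>) t (s', \<omega>)" "rel L s' (run p \<sigma>)" "\<forall>x. s' x < M"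
     "t \<le> tb N p * (len M)\<^sup>2" using Sq.IH(1)[of s \<sigma>, OF _ _ _ _ _ dj(1)] Sq.prems by auto
  have "run p \<sigma> b = \<sigma> b" if "b \<in> limits p'" for b
    using that Sq.prems by (intro run_frame) auto
  then obtain t' s'' where t': "exec (cprog p') (s', \<omega>) t' (s'', \<omega>)" "rel L s'' (run p' (run p \<sigma>))" "\<forall>x. s'' x < M"
     "t' \<le> tb N p' * (len M)\<^sup>2" using Sq.IH(2)[of s' "run p \<sigma>", OF _ _ _ _ _ dj(2)] Sq.prems t by auto
  show ?case using exec.Seq[OF t(1) t'(1)] t t'
    by (intro exI[of _ "t + t'"] exI[of _ s'']) (simp add: algebra_simps)
next
  case (Cond e p p')
  have v: "aval (cexp e) s = eval e \<sigma>" using Cond.prems by (simp add: aval_cexp)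
  have "acost (cexp e) s \<le> acb (cexp e) * (len M)\<^sup>2"
  proof (rule acost_le)
    show "\<forall>n\<in>aconsts (cexp e). n < M"
      using Cond.prems(1) assms(4) aconsts_cexp[of e] by (auto intro: le_less_trans)
  qed (use Cond.prems assms(4) in auto)
  moreover have "1 \<le> (len M)\<^sup>2" by (rule one_le_len_square)
  ultimately have c: "acost (cexp e) s + 1 \<le> (acb (cexp e) + 1) * (len M)\<^sup>2" by simp
  show ?case
  proof (cases "eval e \<sigma> = 0")
    case True
    have dj: "limits p' \<inter> writes p' = {}" using Cond.prems by auto
    obtain t s' where t: "exec (cprog p') (s, \<omega>) t (s', \<omega>)" "rel L s' (run p' \<sigma>)" "\<forall>x. s' x < M"
     "t \<le> tb N p' * (len M)\<^sup>2" using Cond.IH(2)[of s \<sigma>, OF _ _ _ _ _ dj] Cond.prems True by auto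
    show ?thesis using exec.IfFalse[OF _ t(1), of "cexp e" "cprog p"] t v True c
      by (intro exI[of _ "acost (cexp e) s + 1 + t"] exI[of _ s']) (simp add: algebra_simps)
  next
    case False
    have dj: "limits p \<inter> writes p = {}" using Cond.prems by auto
    obtain t s' where t: "exec (cprog p) (s, \<omega>) t (s', \<omega>)" "rel L s' (run p \<sigma>)" "\<forall>x. s' x < M"
     "t \<le> tb N p * (len M)\<^sup>2" using Cond.IH(1)[of s \<sigma>, OF _ _ _ _ _ dj] Cond.prems False by auto
    show ?thesis using exec.IfTrue[OF _ t(1), of "cexp e" "cprog p'"] t v False c
      by (intro exI[of _ "acost (cexp e) s + 1 + t"] exI[of _ s']) (simp add: algebra_simps)
  qed
next
  case (For a b p)
  let ?f = "\<lambda>i. ((\<lambda>\<tau>. bump a (run p \<tau>)) ^^ i) (upd \<sigma> a 0 0)"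
  let ?n = "\<sigma> b 0"
  let ?J = "\<lambda>i s w. rel L s (?f i) \<and> (\<forall>x. s x < M) \<and> w = \<omega>"
  have a: "a \<notin> writes p" "a \<noteq> b" "b \<notin> writes p" "a < 64" "b < 64" "0 < a" "0 < b"
    using For.prems by auto
  have bn: "s (L + Suc b) = ?n" using For.prems(2) a unfolding rel_def
    by (metis add_0 mult_0_right)
  have "?n < M" using For.prems(3) bn by metis
  have cnt: "?f i a 0 = i" for i using a by (intro For_counter)
  have lim: "?f i x = \<sigma> x" if "x \<in> insert b (limits p)" for i x
    using that For.prems by (intro For_frame) auto
  have rel0: "rel L s \<tau> \<Longrightarrow> x < 64 \<Longrightarrow> 0 < x \<Longrightarrow> s (L + Suc x) = \<tau> x 0" for s \<tau> x
    unfolding rel_def by (metis add_0 mult_0_right)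
  have "\<exists>t s' \<omega>'. exec (cfor a b (cprog p)) (s, \<omega>) t (s', \<omega>') \<and>
      t \<le> Suc ?n * (tb N p + forcost a b) * (len M)\<^sup>2 \<and> ?J ?n s' \<omega>'"
  proof (rule exec_for[where J = ?J and L = L])
    fix i s w assume i: "i < ?n" and J: "?J i s w"
    have dj: "limits p \<inter> writes p = {}" using For.prems by auto
    obtain t s' where t: "exec (cprog p) (s, \<omega>) t (s', \<omega>)" "rel L s' (run p (?f i))" "\<forall>x. s' x < M"
      "t \<le> tb N p * (len M)\<^sup>2"
      using For.IH[of s "?f i", OF _ _ _ _ _ dj] For.prems J lim i by auto
    have "rel L (s'(64 * 0 + (L + Suc a) := Suc i)) (upd (run p (?f i)) a 0 (Suc i))"
      using t(2) a by (intro rel_upd)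
    moreover have c: "run p (?f i) a 0 = i" using a cnt by (simp add: run_frame)
    ultimately have "rel L (s'(L + Suc a := Suc i)) (?f (Suc i))" by (simp add: bump_def)
    moreover have "s' (L + Suc a) = i" using rel0[OF t(2)] a c by simp
    moreover have "s' 0 = L" using t(2) by (simp add: rel_def)
    ultimately show "\<exists>t s' w'. exec (cprog p) (s, w) t (s', w') \<and> t \<le> tb N p * (len M)\<^sup>2 \<and>
        (\<forall>x. s' x < M) \<and> s' (L + Suc a) = i \<and> s' 0 = L \<and> ?J (Suc i) (s'(L + Suc a := Suc i)) w'"
      using t J i \<open>?n < M\<close> assms(4) by (intro exI[of _ t] exI[of _ s'] exI[of _ \<omega>] conjI allI) (simp_all add: le_less_trans)
  next
    fix i s w assume "i \<le> ?n" and J: "?J i s w"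
    then show "s 0 = L \<and> s (L + Suc a) = i \<and> s (L + Suc b) = ?n \<and> (\<forall>x. s x < M)"
      using rel0[of s "?f i" a] rel0[of s "?f i" b] a cnt lim by (auto simp: rel_def)
  next
    show "?J 0 (s(L + Suc a := 0)) \<omega>"
      using rel_upd[OF For.prems(2), of a 0 0] a For.prems(3) assms(4) by simp
  qed (use For.prems a \<open>?n < M\<close> assms(4) in \<open>auto simp: rel_def\<close>)
  then obtain t s' where t: "exec (cfor a b (cprog p)) (s, \<omega>) t (s', \<omega>)"
      "t \<le> Suc ?n * (tb N p + forcost a b) * (len M)\<^sup>2" "?J ?n s' \<omega>"
    by blast
  have "Suc ?n * (tb N p + forcost a b) * (len M)\<^sup>2 \<le> Suc (N b) * (tb N p + forcost a b) * (len M)\<^sup>2"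
    using For.prems by (intro mult_le_mono1) auto
  then have "t \<le> tb N (For a b p) * (len M)\<^sup>2" using t(2) unfolding tb.simps by linarith
  then show ?case using t by auto
qed

subsection \<open>A field of characteristic two on the natural numbers\<close>

definition fsz :: "nat \<Rightarrow> nat" where "fsz j = 2 ^ (2 ^ j)"

lemma fsz_0: "fsz 0 = 2" by (simp add: fsz_def)
lemma fsz_Suc: "fsz (Suc j) = fsz j * fsz j"
  by (simp add: fsz_def power_add[symmetric] mult_2[symmetric])
lemma fsz_pos [simp]: "0 < fsz j" by (simp add: fsz_def)
lemma fsz_ge: "2 \<le> fsz j"
  using self_le_power[of 2 "2 ^ j"] by (simp add: fsz_def)

lemma fsz_gt: "n < fsz n"
proof -
  have "n < 2 ^ n" by simp
  also have "\<dots> < 2 ^ 2 ^ n" by simp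
  finally show ?thesis by (simp add: fsz_def)
qed

lemma fsz_mono: "i \<le> j \<Longrightarrow> fsz i \<le> fsz j"
  by (simp add: fsz_def)

text \<open>
  Field of size \<open>q\<^sup>2\<close> as quadratic extension of a field on \<open>{..<q}\<close>: the number \<open>a * q + b\<close> codes
  \<open>a X + b\<close>, where \<open>X\<^sup>2 = X + c\<close>.
\<close>

definition qmul :: "nat \<Rightarrow> (nat \<Rightarrow> nat \<Rightarrow> nat) \<Rightarrow> nat \<Rightarrow> nat \<Rightarrow> nat \<Rightarrow> nat" where
  "qmul q m c a b = (let t = m (a div q) (b div q) in
     xor t (xor (m (a div q) (b mod q)) (m (a mod q) (b div q))) * q +
     xor (m (a mod q) (b mod q)) (m c t))"

text \<open>In characteristic two the role of a nonsquare is played by an element outside the image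
  of \<open>x^2 + x\<close>: then \<open>X^2 + X + c\<close> has no root. Taking the largest one
  fixes the choice and is what a scan in increasing order leaves in its variable.\<close>

definition nonsq :: "nat \<Rightarrow> (nat \<Rightarrow> nat \<Rightarrow> nat) \<Rightarrow> nat" where
  "nonsq q m = Max {c. c < q \<and> (\<forall>x<q. xor (m x x) x \<noteq> c)}"

primrec fmul :: "nat \<Rightarrow> nat \<Rightarrow> nat \<Rightarrow> nat" where
  "fmul 0 a b = a * b"
| "fmul (Suc j) a b = qmul (fsz j) (fmul j) (nonsq (fsz j) (fmul j)) a b"

lemma xor_less: "a < fsz j \<Longrightarrow> b < fsz j \<Longrightarrow> xor a b < fsz j" for a b :: nat
  unfolding fsz_def by (metis take_bit_nat_eq_self_iff take_bit_xor)

text \<open>\<open>fsz j\<close> is a power of two, so \<open>a * fsz j + b\<close> concatenates bit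
  strings and exclusive or acts on the two parts separately. Addition of coordinates in the
  extension is therefore the same operation on codes at every level.\<close>

lemma xor_cat:
  fixes a b a' b' :: nat
  assumes "b < fsz j" "b' < fsz j"
  shows "xor (a * fsz j + b) (a' * fsz j + b') = xor a a' * fsz j + xor b b'"
proof -
  have *: "x * fsz j + y = push_bit (2 ^ j) x + take_bit (2 ^ j) y" if "y < fsz j" for x y :: nat
    using that by (simp add: fsz_def push_bit_eq_mult take_bit_nat_eq_self)
  have d: "push_bit n x + take_bit n y = Bit_Operations.or (push_bit n x) (take_bit n y)" for n and x y :: nat
    by (rule disjunctive_add_eq_or) (auto simp: bit_eq_iff bit_simps)
  show ?thesis
    unfolding *[OF assms(1)] *[OF assms(2)] *[OF xor_less[OF assms]] d
    by (rule bit_eqI) (auto simp: bit_simps)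
qed

text \<open>A field on an initial segment of the natural numbers, as the carrier grows along the
  tower. Addition is \<open>xor\<close> throughout, so beyond closure its group laws need no
  axioms.\<close>

locale field2 =
  fixes q :: nat and m :: "nat \<Rightarrow> nat \<Rightarrow> nat"
  assumes q2: "2 \<le> q"
    and xcl: "\<And>a b. a < q \<Longrightarrow> b < q \<Longrightarrow> xor a b < q"
    and mcl: "\<And>a b. a < q \<Longrightarrow> b < q \<Longrightarrow> m a b < q"
    and comm: "\<And>a b. a < q \<Longrightarrow> b < q \<Longrightarrow> m a b = m b a"
    and assoc: "\<And>a b c. a < q \<Longrightarrow> b < q \<Longrightarrow> c < q \<Longrightarrow> m (m a b) c = m a (m b c)"
    and dist: "\<And>a b c. a < q \<Longrightarrow> b < q \<Longrightarrow> c < q \<Longrightarrow> m a (xor b c) = xor (m a b) (m a c)"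
    and one: "\<And>a. a < q \<Longrightarrow> m 1 a = a"
    and inv: "\<And>a. a < q \<Longrightarrow> a \<noteq> 0 \<Longrightarrow> \<exists>b<q. m a b = 1"
begin

lemma zero: "a < q \<Longrightarrow> m a 0 = 0" "a < q \<Longrightarrow> m 0 a = 0"
  using dist[of a 0 0] comm[of a 0] q2 by auto

lemma dist': "a < q \<Longrightarrow> b < q \<Longrightarrow> c < q \<Longrightarrow> m (xor b c) a = xor (m b a) (m c a)"
  using dist[of a b c] comm[of "xor b c" a] comm[of b a] comm[of c a] xcl by simp

lemma one': "a < q \<Longrightarrow> m a 1 = a"
  using one[of a] comm[of a 1] q2 by simp

lemma assoc_left: "a < q \<Longrightarrow> b < q \<Longrightarrow> c < q \<Longrightarrow> m b (m a c) = m a (m b c)"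
  using assoc[of a b c] assoc[of b a c] comm[of a b] by simp

text \<open>The map \<open>x^2 + x\<close> sends both 0 and 1 to 0. It is not injective on a finite
  set, hence not surjective.\<close>

lemma nonsq_ex: "\<exists>c<q. \<forall>x<q. xor (m x x) x \<noteq> c"
proof (rule ccontr)
  let ?f = "\<lambda>x. xor (m x x) x"
  assume "\<not> ?thesis"
  then have sub: "{..<q} \<subseteq> ?f ` {..<q}" by force
  then have "?f ` {..<q} = {..<q}" using xcl mcl by auto
  then have inj: "inj_on ?f {..<q}" by (intro eq_card_imp_inj_on) auto
  have "?f 0 = ?f 1" using q2 zero(1)[of 0] one[of 1] by simp
  with inj have "(0::nat) = 1" by (rule inj_onD) (use q2 in auto)
  then show False by simp
qed

lemma nonsq: "nonsq q m < q" "x < q \<Longrightarrow> xor (m x x) x \<noteq> nonsq q m"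
proof -
  have "nonsq q m \<in> {c. c < q \<and> (\<forall>x<q. xor (m x x) x \<noteq> c)}"
    unfolding nonsq_def using nonsq_ex by (intro Max_in) auto
  then show "nonsq q m < q" "x < q \<Longrightarrow> xor (m x x) x \<noteq> nonsq q m" by auto
qed

end

lemma split_div_mod: "a < q * q \<Longrightarrow> a div q < q \<and> a mod q < q" for q a :: nat
  by (metis less_mult_imp_div_less mod_less_divisor mult_0_right not_gr_zero not_less_zero)

lemma comb_less: "x < q \<Longrightarrow> y < q \<Longrightarrow> x * q + y < q * q" for q x y :: nat
proof -
  assume "x < q" "y < q"
  then have "x * q + y < Suc x * q" by simp
  also have "\<dots> \<le> q * q" using \<open>x < q\<close> by (intro mult_le_mono1) simp
  finally show ?thesis .
qed

text \<open>The ring laws are polynomial identities in the coordinates modulo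
  \<open>X^2 = X + c\<close>. Only inverses use that \<open>c\<close> is outside the image of
  \<open>x^2 + x\<close>: this keeps the norm of a nonzero element from vanishing.\<close>

lemma field2_ext:
  assumes "field2 q m" and q: "q = fsz j" and c: "c < q" "\<And>x. x < q \<Longrightarrow> xor (m x x) x \<noteq> c"
  shows "field2 (q * q) (qmul q m c)"
proof -
  interpret field2 q m by fact
  have q0: "0 < q" using q2 by simp
  have cat: "xor (x * q + y) (x' * q + y') = xor x x' * q + xor y y'" if "y < q" "y' < q" for x x' y y'
    using xor_cat that unfolding q by blast
  have rep: "\<exists>x y. x < q \<and> y < q \<and> a = x * q + y" if "a < q * q" for a
    using split_div_mod[OF that] by (metis div_mult_mod_eq)
  have mul: "qmul q m c (x * q + y) (x' * q + y') =
      xor (m x x') (xor (m x y') (m y x')) * q + xor (m y y') (m c (m x x'))"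
    if "y < q" "y' < q" for x y x' y'
    using that by (simp add: qmul_def Let_def)
  note [simp] = xcl mcl c(1)
  note ring = dist dist' assoc assoc_left xor.assoc xor.commute xor.left_commute
  have xx: "xor a (xor a b) = b" for a b :: nat by (simp flip: xor.assoc)
  show ?thesis
  proof
    show "2 \<le> q * q" using q2 by (metis le_trans mult_le_mono2 nat_mult_1_right one_le_numeral le_square)
  next
    fix a b assume "a < q * q" "b < q * q"
    then obtain x y x' y' where *: "a = x * q + y" "b = x' * q + y'" "x < q" "y < q" "x' < q" "y' < q"
      using rep by metis
    show "xor a b < q * q" unfolding *(1,2) using * by (simp add: cat comb_less)
    show "qmul q m c a b < q * q" unfolding *(1,2) using * by (simp add: mul comb_less)
    show "qmul q m c a b = qmul q m c b a" unfolding *(1,2) using *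
      by (simp add: mul comm[of y'] comm[of x'] xor.commute xor.left_commute)
  next
    fix a b d assume "a < q * q" "b < q * q" "d < q * q"
    then obtain x y x' y' u v where *: "a = x * q + y" "b = x' * q + y'" "d = u * q + v"
        "x < q" "y < q" "x' < q" "y' < q" "u < q" "v < q"
      using rep by metis
    show "qmul q m c a (xor b d) = xor (qmul q m c a b) (qmul q m c a d)"
      unfolding *(1-3) using * by (simp add: mul cat ring)
    show "qmul q m c (qmul q m c a b) d = qmul q m c a (qmul q m c b d)"
      unfolding *(1-3) using * by (simp add: mul ring xx)
  next
    fix a assume "a < q * q"
    then obtain x y where *: "a = x * q + y" "x < q" "y < q" using rep by metis
    have "qmul q m c (0 * q + 1) (x * q + y) = x * q + y"
      using * q2 by (subst mul) (simp_all add: zero one[unfolded One_nat_def])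
    then show "qmul q m c 1 a = a" using * by simp
  next
    fix a assume "a < q * q" "a \<noteq> 0"
    then obtain x y where *: "a = x * q + y" "x < q" "y < q" using rep by metis
    \<comment> \<open>the norm \<open>y\<^sup>2 + x y + c x\<^sup>2\<close> is nonzero, and \<open>x X + (x + y)\<close> is the conjugate\<close>
    define N where "N = xor (m y y) (xor (m x y) (m c (m x x)))"
    have Nq: "N < q" using * by (simp add: N_def)
    have "N \<noteq> 0"
    proof
      assume N0: "N = 0"
      show False
      proof (cases "x = 0")
        case True
        then have "y \<noteq> 0" using * \<open>a \<noteq> 0\<close> by auto
        then obtain z where z: "z < q" "m y z = 1" using inv[of y] * by blast
        have "m y y = 0" using N0 True * by (simp add: N_def zero)
        then have "m (m y y) z = 0" using z by (simp add: zero)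
        then have "y = 0" using z * by (simp add: assoc one'[unfolded One_nat_def])
        then show False using \<open>y \<noteq> 0\<close> by simp
      next
        case False
        then obtain z where z: "z < q" "m x z = 1" using inv[of x] * by blast
        \<comment> \<open>With \<open>w = y / x\<close>, dividing the norm by the square of
          \<open>x\<close> turns its vanishing into \<open>w^2 + w = c\<close>, which the choice of
          \<open>c\<close> excludes.\<close>
        define w where "w = m y z"
        have w: "w < q" using w_def z * by simp
        have y: "y = m x w" using assoc_left[of y x z] one'[of y] z * by (simp add: w_def)
        have "N = m (m x x) (xor (m w w) (xor w c))"
          unfolding N_def y using w * by (simp add: ring comm)
        then have "m (m z z) (m (m x x) (xor (m w w) (xor w c))) = 0"
          using N0 z by (simp add: zero)
        moreover have "m (m z z) (m (m x x) d) = d" if "d < q" for d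
        proof -
          have "m (m z z) (m (m x x) d) = m (m x z) (m (m x z) d)"
            using that z(1) * by (simp add: comm assoc assoc_left)
          then show ?thesis using one that by (simp add: z(2))
        qed
        ultimately have "xor (xor (m w w) w) c = 0" using w by (simp add: xor.assoc)
        then have "xor (m w w) w = c" by (metis xx xor.commute xor.right_neutral)
        then show False using c(2)[OF w] by simp
      qed
    qed
    then obtain n where n: "n < q" "m N n = 1" using inv Nq by blast
    have "qmul q m c (x * q + y) (m x n * q + m (xor x y) n) = 0 * q + m N n"
      unfolding N_def using * n by (subst mul) (simp_all add: ring xx comm)
    then have "qmul q m c a (m x n * q + m (xor x y) n) = 1"
      using n * by simp
    moreover have "m x n * q + m (xor x y) n < q * q" using n * by (simp add: comb_less)
    ultimately show "\<exists>b<q * q. qmul q m c a b = 1" by blast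
  qed
qed

lemma field2_fmul: "field2 (fsz j) (fmul j)"
proof (induction j)
  case 0
  have lt2: "a < 2 \<longleftrightarrow> a = 0 \<or> a = 1" for a :: nat by auto
  show ?case
    unfolding fsz_0 by unfold_locales (auto simp: lt2)
next
  case (Suc j)
  then interpret field2 "fsz j" "fmul j" .
  have "field2 (fsz j * fsz j) (qmul (fsz j) (fmul j) (nonsq (fsz j) (fmul j)))"
    using Suc nonsq by (intro field2_ext) auto
  moreover have "qmul (fsz j) (fmul j) (nonsq (fsz j) (fmul j)) = fmul (Suc j)" by (intro ext) simp
  ultimately show ?case by (simp only: fsz_Suc)
qed

text \<open>Elements of the smaller field have high part 0, so only the product of the low parts
  survives. The levels are thus nested subfields on the same codes.\<close>

lemma fmul_Suc_eq: "a < fsz j \<Longrightarrow> b < fsz j \<Longrightarrow> fmul (Suc j) a b = fmul j a b"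
proof -
  assume *: "a < fsz j" "b < fsz j"
  interpret field2 "fsz j" "fmul j" by (rule field2_fmul)
  show ?thesis using * by (simp add: qmul_def Let_def zero nonsq)
qed

lemma fmul_stable: "a < fsz i \<Longrightarrow> b < fsz i \<Longrightarrow> i \<le> j \<Longrightarrow> fmul j a b = fmul i a b"
proof (induction j)
  case (Suc j)
  then show ?case
    using fmul_Suc_eq[of a j b] fsz_mono[of i j] by (cases "i = Suc j") (auto simp del: fmul.simps)
qed simp

text \<open>The product in the union of the tower. The level \<open>a + b\<close> merely is large
  enough to contain both factors; every other sufficient level gives the same result.\<close>

definition nmul :: "nat \<Rightarrow> nat \<Rightarrow> nat" where "nmul a b = fmul (a + b) a b"

lemma nmul_eq: "a < fsz j \<Longrightarrow> b < fsz j \<Longrightarrow> nmul a b = fmul j a b"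
proof -
  assume *: "a < fsz j" "b < fsz j"
  have **: "a < fsz (a + b)" "b < fsz (a + b)"
    using fsz_gt[of a] fsz_gt[of b] fsz_mono[of a "a + b"] fsz_mono[of b "a + b"] by simp_all
  show ?thesis unfolding nmul_def
    using fmul_stable[OF *, of "max j (a + b)"] fmul_stable[OF **, of "max j (a + b)"] by simp
qed

lemma field2_nmul: "field2 (fsz j) nmul"
proof -
  interpret f: field2 "fsz j" "fmul j" by (rule field2_fmul)
  show ?thesis
  proof
    fix a assume "a < fsz j" "a \<noteq> 0"
    then show "\<exists>b<fsz j. nmul a b = 1" using f.inv[of a] nmul_eq[of a j] by metis
  qed (use f.q2 f.xcl f.mcl f.comm f.assoc f.dist f.one in \<open>auto simp: nmul_eq[of _ j]\<close>)
qed

text \<open>The union of the tower is one infinite field on all natural numbers. As a type it admits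
  ordinary algebra, and the finite subfields reappear as bounds
  \<open>code a < fsz j\<close>.\<close>

typedef gf = "UNIV :: nat set" morphisms code Gf ..

setup_lifting type_definition_gf

lemma ex_fsz3: "\<exists>j. a < fsz j \<and> b < fsz j \<and> c < fsz j"
  using fsz_gt[of a] fsz_gt[of b] fsz_gt[of c] fsz_mono
  by (meson less_le_trans max.cobounded1 max.cobounded2 order_trans)

instantiation gf :: comm_ring_1
begin
lift_definition zero_gf :: gf is 0 .
lift_definition one_gf :: gf is 1 .
lift_definition plus_gf :: "gf \<Rightarrow> gf \<Rightarrow> gf" is xor .
lift_definition minus_gf :: "gf \<Rightarrow> gf \<Rightarrow> gf" is xor .
lift_definition uminus_gf :: "gf \<Rightarrow> gf" is "\<lambda>x. x" .
lift_definition times_gf :: "gf \<Rightarrow> gf \<Rightarrow> gf" is nmul .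
instance
proof
  fix a b c :: gf
  show "a + b + c = a + (b + c)" by transfer (rule xor.assoc)
  show "a + b = b + a" by transfer (rule xor.commute)
  show "0 + a = a" by transfer simp
  show "- a + a = 0" by transfer simp
  show "a - b = a + - b" by transfer simp
  show "(0::gf) \<noteq> 1" by transfer simp
  show "1 * a = a"
  proof transfer
    fix a
    obtain j where j: "a < fsz j" using fsz_gt by blast
    interpret field2 "fsz j" nmul by (rule field2_nmul)
    show "nmul 1 a = a" using j one by simp
  qed
  show "a * b = b * a"
  proof transfer
    fix a b
    obtain j where j: "a < fsz j" "b < fsz j" using ex_fsz3 by blast
    interpret field2 "fsz j" nmul by (rule field2_nmul)
    show "nmul a b = nmul b a" using j comm by simp
  qed
  show "a * b * c = a * (b * c)"
  proof transfer
    fix a b c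
    obtain j where j: "a < fsz j" "b < fsz j" "c < fsz j" using ex_fsz3 by blast
    interpret field2 "fsz j" nmul by (rule field2_nmul)
    show "nmul (nmul a b) c = nmul a (nmul b c)" using j assoc by simp
  qed
  show "(a + b) * c = a * c + b * c"
  proof transfer
    fix a b c
    obtain j where j: "a < fsz j" "b < fsz j" "c < fsz j" using ex_fsz3 by blast
    interpret field2 "fsz j" nmul by (rule field2_nmul)
    show "nmul (xor a b) c = xor (nmul a c) (nmul b c)" using j dist' by simp
  qed
qed
end

lemma gf_inverse_ex: "a \<noteq> 0 \<Longrightarrow> \<exists>b::gf. a * b = 1"
proof transfer
  fix a :: nat assume "a \<noteq> 0"
  obtain j where j: "a < fsz j" using fsz_gt by blast
  interpret field2 "fsz j" nmul by (rule field2_nmul)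
  show "\<exists>b. nmul a b = 1" using inv[OF j \<open>a \<noteq> 0\<close>] by blast
qed

instantiation gf :: field
begin
definition inverse_gf :: "gf \<Rightarrow> gf" where "inverse_gf a = (if a = 0 then 0 else SOME b. a * b = 1)"
definition divide_gf :: "gf \<Rightarrow> gf \<Rightarrow> gf" where "divide_gf a b = a * inverse b"
instance
proof
  fix a b :: gf
  show "a \<noteq> 0 \<Longrightarrow> inverse a * a = 1"
    using someI_ex[OF gf_inverse_ex[of a]] by (simp add: inverse_gf_def mult.commute)
qed (simp_all add: inverse_gf_def divide_gf_def)
end

lemma gf_double [simp]: "x + x = (0::gf)"
  by transfer simp

lemma code_add: "code (a + b) = xor (code a) (code b)" by transfer simp
lemma code_mult: "code (a * b) = nmul (code a) (code b)" by transfer simp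
lemma code_0 [simp]: "code 0 = 0" by transfer simp
lemma code_1 [simp]: "code 1 = 1" by transfer simp
lemma code_eq_0 [simp]: "code a = 0 \<longleftrightarrow> a = 0" by transfer simp

lemma code_mult_less: "code a < fsz j \<Longrightarrow> code b < fsz j \<Longrightarrow> code (a * b) < fsz j"
  using field2.mcl[OF field2_nmul] by (simp add: code_mult)

lemma code_add_less: "code a < fsz j \<Longrightarrow> code b < fsz j \<Longrightarrow> code (a + b) < fsz j"
  by (simp add: code_add xor_less)

lemma code_inverse_less: "code a < fsz j \<Longrightarrow> code (inverse a) < fsz j"
proof (cases "a = 0")
  case False
  assume "code a < fsz j"
  then obtain b where b: "b < fsz j" "nmul (code a) b = 1"
    using field2.inv[OF field2_nmul, of "code a" j] False by auto
  then have "a * Gf b = 1" by (metis code_1 code_inject code_mult Gf_inverse UNIV_I)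
  then have "inverse a = Gf b" by (rule inverse_unique)
  then show ?thesis using b by (simp add: Gf_inverse)
qed simp

subsection \<open>Hafnians in characteristic two\<close>

definition ed :: "nat \<Rightarrow> nat \<Rightarrow> nat \<times> nat" where
  "ed u v = (if u < v then (u, v) else (v, u))"

definition pms :: "nat set \<Rightarrow> (nat \<times> nat) set set" where
  "pms V = {M. M \<subseteq> {e. fst e \<in> V \<and> snd e \<in> V \<and> fst e < snd e} \<and>
     (\<forall>x\<in>V. \<exists>!e. e \<in> M \<and> (x = fst e \<or> x = snd e))}"

definition haf :: "(nat \<Rightarrow> nat \<Rightarrow> gf) \<Rightarrow> nat set \<Rightarrow> gf" where
  "haf a V = (\<Sum>M\<in>pms V. \<Prod>e\<in>M. a (fst e) (snd e))"

lemma ed_sym: "ed u v = ed v u" by (auto simp: ed_def)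

lemma ed_fst_snd: "fst e < snd e \<Longrightarrow> ed (fst e) (snd e) = e" by (simp add: ed_def)

lemma in_pmsD: "M \<in> pms V \<Longrightarrow> e \<in> M \<Longrightarrow> fst e \<in> V \<and> snd e \<in> V \<and> fst e < snd e"
  by (auto simp: pms_def)

lemma pms_subset: "M \<in> pms V \<Longrightarrow> M \<subseteq> V \<times> V"
  by (force simp: pms_def)

lemma finite_pms: "finite V \<Longrightarrow> finite (pms V)"
  using pms_subset by (intro finite_subset[of "pms V" "Pow (V \<times> V)"]) auto

lemma finite_in_pms: "finite V \<Longrightarrow> M \<in> pms V \<Longrightarrow> finite M"
  using pms_subset by (meson finite_SigmaI finite_subset)

lemma pms_empty: "pms {} = {{}}"
  by (auto simp: pms_def)

lemma haf_empty: "haf a {} = 1"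
  by (simp add: haf_def pms_empty)

lemma haf_cong:
  assumes "\<And>x y. x \<in> V \<Longrightarrow> y \<in> V \<Longrightarrow> x < y \<Longrightarrow> a x y = b x y"
  shows "haf a V = haf b V"
  unfolding haf_def by (intro sum.cong prod.cong refl assms) (auto dest: in_pmsD)

lemma pms_insert:
  assumes "M \<in> pms (V - {u, v})" "u \<in> V" "v \<in> V" "u \<noteq> v"
  shows "insert (ed u v) M \<in> pms V" "ed u v \<notin> M"
proof -
  have e: "\<And>x. x = fst (ed u v) \<or> x = snd (ed u v) \<longleftrightarrow> x = u \<or> x = v" "fst (ed u v) < snd (ed u v)"
    using assms(4) by (auto simp: ed_def)
  have n: "fst f \<noteq> u \<and> fst f \<noteq> v \<and> snd f \<noteq> u \<and> snd f \<noteq> v" if "f \<in> M" for f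
    using in_pmsD[OF assms(1) that] by auto
  then show "ed u v \<notin> M" using e(1) by metis
  have "\<exists>!f. f \<in> insert (ed u v) M \<and> (x = fst f \<or> x = snd f)" if x: "x \<in> V" for x
  proof (cases "x = u \<or> x = v")
    case True
    then show ?thesis using e(1) n by (intro ex1I[of _ "ed u v"]) blast+
  next
    case False
    then have "\<exists>!f. f \<in> M \<and> (x = fst f \<or> x = snd f)" using assms(1) x by (auto simp: pms_def)
    then show ?thesis using False e(1) by (metis insert_iff)
  qed
  moreover have "fst f \<in> V \<and> snd f \<in> V \<and> fst f < snd f" if "f \<in> insert (ed u v) M" for f
    using that in_pmsD[OF assms(1), of f] e assms(2,3) by (auto simp: ed_def split: if_splits)
  ultimately show "insert (ed u v) M \<in> pms V" unfolding pms_def by blast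
qed

lemma pms_remove:
  assumes "M \<in> pms V" "v \<in> V"
  shows "\<exists>u\<in>V - {v}. ed v u \<in> M \<and> M - {ed v u} \<in> pms (V - {v, u})"
proof -
  have ex1: "\<exists>!e. e \<in> M \<and> (x = fst e \<or> x = snd e)" if "x \<in> V" for x
    using assms that by (auto simp: pms_def)
  obtain e where e: "e \<in> M" "v = fst e \<or> v = snd e" using ex1[OF assms(2)] by blast
  have eV: "fst e \<in> V" "snd e \<in> V" "fst e < snd e" using in_pmsD[OF assms(1) e(1)] by auto
  define u where "u = (if v = fst e then snd e else fst e)"
  have ee: "e = ed v u" using e(2) eV by (cases e) (auto simp: ed_def u_def)
  have u: "u \<in> V" "u \<noteq> v" using e(2) eV by (auto simp: u_def)
  have uv: "x = fst e \<or> x = snd e \<longleftrightarrow> x = u \<or> x = v" for x using e(2) by (auto simp: u_def)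
  have n: "fst f \<noteq> u \<and> fst f \<noteq> v \<and> snd f \<noteq> u \<and> snd f \<noteq> v" if "f \<in> M - {e}" for f
    using ex1[OF assms(2)] ex1[OF u(1)] that e(1) uv by (metis DiffD1 DiffD2 singletonI)
  have "\<exists>!f. f \<in> M - {e} \<and> (x = fst f \<or> x = snd f)" if x: "x \<in> V - {v, u}" for x
  proof -
    have "x \<in> V" "\<not> (x = fst e \<or> x = snd e)" using x uv by auto
    then show ?thesis using ex1[of x] by (metis DiffE DiffI empty_iff insert_iff)
  qed
  moreover have "fst f \<in> V - {v, u} \<and> snd f \<in> V - {v, u} \<and> fst f < snd f" if "f \<in> M - {e}" for f
    using n[OF that] in_pmsD[OF assms(1)] that by auto
  ultimately have "M - {e} \<in> pms (V - {v, u})" unfolding pms_def by blast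
  then show ?thesis using u e(1) unfolding ee by blast
qed

text \<open>The matchings are classified by the partner \<open>u\<close> of \<open>v\<close>, and
  deleting that edge is a bijection onto the matchings of the rest. \<open>haf\<close> reads entries
  above the diagonal only; by symmetry the whole row of \<open>v\<close> may be used.\<close>

lemma haf_expand:
  assumes "finite V" "v \<in> V" "\<And>x y. a x y = a y x"
  shows "haf a V = (\<Sum>u\<in>V - {v}. a v u * haf a (V - {v, u}))"
proof -
  let ?S = "SIGMA u:V - {v}. pms (V - {v, u})"
  let ?f = "\<lambda>(u, M). insert (ed v u) M"
  have inj: "inj_on ?f ?S"
  proof (rule inj_onI)
    fix X Y assume XY: "X \<in> ?S" "Y \<in> ?S" "?f X = ?f Y"
    obtain u M u' M' where XY': "X = (u, M)" "Y = (u', M')" by fastforce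
    have *: "u \<in> V" "u \<noteq> v" "M \<in> pms (V - {v, u})" "u' \<in> V" "u' \<noteq> v"
      "M' \<in> pms (V - {v, u'})" "insert (ed v u) M = insert (ed v u') M'"
      using XY unfolding XY' by auto
    have "ed v u \<notin> M'"
    proof
      assume "ed v u \<in> M'"
      from in_pmsD[OF *(6) this] show False by (auto simp: ed_def split: if_splits)
    qed
    then have "ed v u = ed v u'" using *(7) by blast
    then have "u = u'" by (auto simp: ed_def split: if_splits)
    moreover have "ed v u \<notin> M" "ed v u' \<notin> M'" using pms_insert(2)[of _ V v] * assms(2) by auto
    ultimately show "X = Y" unfolding XY' using *(7) by (metis insert_ident)
  qed
  have img: "?f ` ?S = pms V"
  proof
    show "?f ` ?S \<subseteq> pms V" using pms_insert(1)[of _ V v] assms(2) by auto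
    show "pms V \<subseteq> ?f ` ?S"
    proof
      fix M assume "M \<in> pms V"
      then obtain u where u: "u \<in> V - {v}" "ed v u \<in> M" "M - {ed v u} \<in> pms (V - {v, u})"
        using pms_remove assms(2) by blast
      then have "M = ?f (u, M - {ed v u})" by auto
      then show "M \<in> ?f ` ?S" using u by blast
    qed
  qed
  let ?w = "\<lambda>M. \<Prod>e\<in>M. a (fst e) (snd e)"
  have "haf a V = (\<Sum>uM\<in>?S. ?w (?f uM))"
    unfolding haf_def img[symmetric] by (subst sum.reindex[OF inj]) simp
  also have "\<dots> = (\<Sum>(u, M)\<in>?S. a v u * ?w M)"
  proof (rule sum.cong[OF refl])
    fix z assume z: "z \<in> ?S"
    obtain u M where uM: "z = (u, M)" by fastforce
    then have *: "u \<in> V" "u \<noteq> v" "M \<in> pms (V - {v, u})" using z by auto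
    have "ed v u \<notin> M" "finite M"
      using pms_insert(2)[of M V v u] * assms finite_in_pms[of "V - {v, u}"] by auto
    moreover have "a (fst (ed v u)) (snd (ed v u)) = a v u" using assms(3) by (auto simp: ed_def)
    ultimately show "?w (?f z) = (case z of (u, M) \<Rightarrow> a v u * ?w M)" by (simp add: uM)
  qed
  also have "\<dots> = (\<Sum>u\<in>V - {v}. \<Sum>M\<in>pms (V - {v, u}). a v u * ?w M)"
    using assms(1) by (subst sum.Sigma) (auto intro: finite_pms)
  finally show ?thesis by (simp add: haf_def sum_distrib_left)
qed

text \<open>Each unordered pair contributes the same value twice, which is zero in characteristic
  two.\<close>

lemma sum_symmetric_pairs:
  fixes F :: "nat \<Rightarrow> nat \<Rightarrow> gf"
  assumes "finite R" "\<And>x y. F x y = F y x"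
  shows "(\<Sum>x\<in>R. \<Sum>y\<in>R - {x}. F x y) = 0"
  using assms(1)
proof (induction R rule: finite_induct)
  case (insert z R)
  have 1: "(\<Sum>y\<in>insert z R - {z}. F z y) = (\<Sum>y\<in>R. F z y)"
    using insert by (intro sum.cong) auto
  have 2: "(\<Sum>y\<in>insert z R - {x}. F x y) = F z x + (\<Sum>y\<in>R - {x}. F x y)" if "x \<in> R" for x
  proof -
    have "insert z R - {x} = insert z (R - {x})" using that insert by auto
    then show ?thesis using insert assms(2) by simp
  qed
  have "(\<Sum>x\<in>insert z R. \<Sum>y\<in>insert z R - {x}. F x y) =
      (\<Sum>y\<in>R. F z y) + (\<Sum>x\<in>R. F z x + (\<Sum>y\<in>R - {x}. F x y))"
  proof -
    have "(\<Sum>x\<in>R. \<Sum>y\<in>insert z R - {x}. F x y) = (\<Sum>x\<in>R. F z x + (\<Sum>y\<in>R - {x}. F x y))"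
      by (intro sum.cong refl 2)
    then show ?thesis using 1 by (simp only: sum.insert[OF insert.hyps])
  qed
  also have "\<dots> = 0" using insert.IH by (simp add: sum.distrib add.assoc[symmetric])
  finally show ?case .
qed simp

text \<open>This is the expansion at \<open>j\<close> after replacing row \<open>j\<close> by row
  \<open>i\<close>. Expanding every term once more at \<open>i\<close> gives a double sum over
  \<open>x\<close> and \<open>y\<close> with a symmetric summand.\<close>

lemma haf_repeated_row:
  assumes "finite V" "i \<in> V" "j \<in> V" "i \<noteq> j" and sym: "\<And>x y. a x y = a y x"
  shows "(\<Sum>x\<in>V - {i, j}. a i x * haf a (V - {j, x})) = 0"
proof -
  have "(\<Sum>x\<in>V - {i, j}. a i x * haf a (V - {j, x})) =
      (\<Sum>x\<in>V - {i, j}. \<Sum>y\<in>V - {i, j} - {x}. a i x * a i y * haf a (V - {i, j} - {x, y}))"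
  proof (rule sum.cong[OF refl])
    fix x assume x: "x \<in> V - {i, j}"
    have "haf a (V - {j, x}) = (\<Sum>y\<in>V - {j, x} - {i}. a i y * haf a (V - {j, x} - {i, y}))"
      using assms x by (intro haf_expand) auto
    moreover have "V - {j, x} - {i} = V - {i, j} - {x}"
      "V - {j, x} - {i, y} = V - {i, j} - {x, y}" for y by auto
    ultimately show "a i x * haf a (V - {j, x}) =
        (\<Sum>y\<in>V - {i, j} - {x}. a i x * a i y * haf a (V - {i, j} - {x, y}))"
      by (simp add: sum_distrib_left mult.assoc)
  qed
  also have "\<dots> = 0" using assms(1)
    by (intro sum_symmetric_pairs) (auto simp: ac_simps insert_commute)
  finally show ?thesis .
qed

text \<open>As for Pfaffians, a multiple of row and column \<open>i\<close> may be added to row and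
  column \<open>j\<close>: by linearity of the expansion at \<open>j\<close>, the change is a
  multiple of a hafnian with a repeated row.\<close>

lemma haf_row_operation:
  assumes V: "finite V" "i \<in> V" "j \<in> V" "i \<noteq> j" and sym: "\<And>x y. a x y = a y x" "\<And>x y. b x y = b y x"
    and "a i i = 0" and rest: "\<And>x y. x \<noteq> j \<Longrightarrow> y \<noteq> j \<Longrightarrow> b x y = a x y"
    and row: "\<And>y. y \<noteq> j \<Longrightarrow> b j y = a j y + c * a i y"
  shows "haf b V = haf a V"
proof -
  have "haf b V = (\<Sum>y\<in>V - {j}. b j y * haf b (V - {j, y}))"
    using V sym by (intro haf_expand) auto
  also have "\<dots> = (\<Sum>y\<in>V - {j}. (a j y + c * a i y) * haf a (V - {j, y}))"
    by (intro sum.cong refl arg_cong2[of _ _ _ _ "(*)"] haf_cong) (auto simp: row rest)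
  also have "\<dots> = haf a V + c * (\<Sum>y\<in>V - {j}. a i y * haf a (V - {j, y}))"
    unfolding haf_expand[OF V(1,3) sym(1)] by (simp add: algebra_simps sum.distrib sum_distrib_left)
  \<comment> \<open>The term \<open>y = i\<close> drops out because the diagonal entry at
    \<open>i\<close> is zero.\<close>
  also have "(\<Sum>y\<in>V - {j}. a i y * haf a (V - {j, y})) = (\<Sum>y\<in>V - {i, j}. a i y * haf a (V - {j, y}))"
    using V \<open>a i i = 0\<close> by (intro sum.mono_neutral_right) auto
  also have "\<dots> = 0" using assms by (intro haf_repeated_row) auto
  finally show ?thesis by simp
qed

text \<open>Adding suitable multiples of row \<open>r\<close> to all rows other than
  \<open>p\<close> and \<open>r\<close> clears row \<open>p\<close> except at \<open>r\<close>. The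
  expansion at \<open>p\<close> then has one term, and what is left is the analogue of a Schur
  complement.\<close>

lemma haf_eliminate:
  assumes V: "finite V" "p \<in> V" "r \<in> V" "p \<noteq> r" and sym: "\<And>x y. a x y = a y x"
    and diag: "\<And>x. a x x = 0" and nz: "a p r \<noteq> 0"
  shows "haf a V = a p r *
    haf (\<lambda>x y. a x y + inverse (a p r) * (a p x * a r y + a p y * a r x)) (V - {p, r})"
proof -
  define c where "c x = inverse (a p r) * a p x" for x
  \<comment> \<open>The matrix after the rows and columns in \<open>D\<close> have been treated. Row
    \<open>r\<close> is unaffected, since its corrections are multiples of the zero entry
    \<open>a r r\<close>; hence no terms quadratic in \<open>c\<close> arise.\<close>
  define b where "b D x y = a x y + (if x \<in> D then c x * a r y else 0) + (if y \<in> D then c y * a r x else 0)"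
    for D x y
  have bsym: "b D x y = b D y x" for D x y using sym by (simp add: b_def ac_simps)
  have "haf (b D) V = haf a V" if "finite D" "D \<subseteq> V - {p, r}" for D
    using that
  proof (induction D rule: finite_induct)
    case empty
    then show ?case by (intro haf_cong) (simp add: b_def)
  next
    case (insert j D)
    have "haf (b (insert j D)) V = haf (b D) V"
      using insert V diag
      by (intro haf_row_operation[where i = r and j = j and c = "c j"] bsym) (auto simp: b_def ac_simps)
    then show ?case using insert by simp
  qed
  then have "haf a V = haf (b (V - {p, r})) V" using V by simp
  also have "\<dots> = (\<Sum>u\<in>V - {p}. b (V - {p, r}) p u * haf (b (V - {p, r})) (V - {p, u}))"
    using V bsym by (intro haf_expand) auto
  also have "\<dots> = (\<Sum>u\<in>V - {p}. if u = r then a p r * haf (b (V - {p, r})) (V - {p, r}) else 0)"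
  proof (rule sum.cong[OF refl])
    fix u assume u: "u \<in> V - {p}"
    have "b (V - {p, r}) p u = (if u = r then a p r else 0)"
    proof -
      have "inverse (a p r) * a p u * a p r = a p u * (inverse (a p r) * a p r)" by (simp only: ac_simps)
      then have "inverse (a p r) * a p u * a p r = a p u" by (simp only: left_inverse[OF nz] mult_1_right)
      then have "u \<noteq> r \<Longrightarrow> u \<in> V - {p, r} \<Longrightarrow> b (V - {p, r}) p u = a p u + a p u"
        using sym[of p r] by (simp only: b_def c_def if_True if_False Diff_iff insert_iff simp_thms add_0_right)
      moreover have "b (V - {p, r}) p r = a p r" by (simp only: b_def Diff_iff insert_iff simp_thms if_False add_0_right)
      ultimately show ?thesis using u by auto
    qed
    then show "b (V - {p, r}) p u * haf (b (V - {p, r})) (V - {p, u}) =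
        (if u = r then a p r * haf (b (V - {p, r})) (V - {p, r}) else 0)" by simp
  qed
  also have "\<dots> = a p r * haf (b (V - {p, r})) (V - {p, r})"
    using V by (subst sum.delta) auto
  also have "haf (b (V - {p, r})) (V - {p, r}) =
      haf (\<lambda>x y. a x y + inverse (a p r) * (a p x * a r y + a p y * a r x)) (V - {p, r})"
    by (intro haf_cong) (auto simp: b_def c_def algebra_simps)
  finally show ?thesis .
qed

lemma haf_zero_row:
  assumes "finite V" "v \<in> V" "\<And>x y. a x y = a y x" "\<And>u. u \<in> V \<Longrightarrow> a v u = 0"
  shows "haf a V = 0"
proof -
  have "haf a V = (\<Sum>u\<in>V - {v}. a v u * haf a (V - {v, u}))"
    using assms(1-3) by (rule haf_expand)
  also have "\<dots> = (\<Sum>u\<in>V - {v}. 0)"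
    by (rule sum.cong) (use assms(4) in auto)
  finally show ?thesis by simp
qed

subsection \<open>Sieving for covering assignments\<close>

text \<open>There are \<open>2 ^ card (U - W)\<close> sets between \<open>W\<close> and
  \<open>U\<close>, an even number unless \<open>W = U\<close>.\<close>

lemma sum_supersets:
  fixes w :: gf
  assumes "finite U" "W \<subseteq> U"
  shows "(\<Sum>Z | W \<subseteq> Z \<and> Z \<subseteq> U. w) = (if W = U then w else 0)"
proof -
  have "bij_betw (\<lambda>X. X \<union> W) (Pow (U - W)) {Z. W \<subseteq> Z \<and> Z \<subseteq> U}"
    using assms by (intro bij_betw_byWitness[where f' = "\<lambda>Z. Z - W"]) auto
  then have "card {Z. W \<subseteq> Z \<and> Z \<subseteq> U} = 2 ^ card (U - W)"
    using assms by (metis bij_betw_same_card card_Pow finite_Diff)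
  moreover have "W \<noteq> U \<Longrightarrow> 0 < card (U - W)" using assms by (auto simp: card_gt_0_iff)
  moreover have "(2::gf) = 0" by (metis gf_double one_add_one)
  ultimately show ?thesis by auto
qed

definition covering :: "nat set \<Rightarrow> 'e set \<Rightarrow> ('e \<Rightarrow> nat set) set" where
  "covering U M = {h \<in> M \<rightarrow>\<^sub>E Pow U. \<Union> (h ` M) = U}"

text \<open>Multiplying out the product over the edges yields every assignment whose sets lie in
  \<open>Z\<close>. After exchanging the sums, an assignment is counted once for every
  \<open>Z\<close> that contains the union of its sets.\<close>

lemma sieve:
  assumes "finite U" "finite V"
  shows "(\<Sum>Z\<in>Pow U. haf (\<lambda>u v. \<Sum>S\<in>Pow Z. g (ed u v) S) V) =
    (\<Sum>M\<in>pms V. \<Sum>h\<in>covering U M. \<Prod>e\<in>M. g e (h e))"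
proof -
  have "(\<Sum>Z\<in>Pow U. haf (\<lambda>u v. \<Sum>S\<in>Pow Z. g (ed u v) S) V) =
    (\<Sum>Z\<in>Pow U. \<Sum>M\<in>pms V. \<Prod>e\<in>M. \<Sum>S\<in>Pow Z. g e S)"
    unfolding haf_def by (intro sum.cong prod.cong refl) (simp add: in_pmsD ed_fst_snd)
  also have "\<dots> = (\<Sum>M\<in>pms V. \<Sum>Z\<in>Pow U. \<Prod>e\<in>M. \<Sum>S\<in>Pow Z. g e S)"
    by (rule sum.swap)
  also have "\<dots> = (\<Sum>M\<in>pms V. \<Sum>h\<in>covering U M. \<Prod>e\<in>M. g e (h e))"
  proof (rule sum.cong[OF refl])
    fix M assume M: "M \<in> pms V"
    have fM: "finite M" using M assms(2) finite_in_pms by blast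
    have fin: "finite (M \<rightarrow>\<^sub>E Pow U)" using fM assms(1) by (intro finite_PiE) auto
    let ?w = "\<lambda>h. \<Prod>e\<in>M. g e (h e)"
    have "(\<Sum>Z\<in>Pow U. \<Prod>e\<in>M. \<Sum>S\<in>Pow Z. g e S) = (\<Sum>Z\<in>Pow U. \<Sum>h\<in>M \<rightarrow>\<^sub>E Pow Z. ?w h)"
    proof (rule sum.cong[OF refl])
      fix Z assume "Z \<in> Pow U"
      then have "finite (Pow Z)" using assms(1) by (auto intro: finite_subset)
      then show "(\<Prod>e\<in>M. \<Sum>S\<in>Pow Z. g e S) = (\<Sum>h\<in>M \<rightarrow>\<^sub>E Pow Z. ?w h)"
        by (intro prod_sum_PiE[OF fM])
    qed
    also have "\<dots> = (\<Sum>Z\<in>Pow U. \<Sum>h\<in>{h \<in> M \<rightarrow>\<^sub>E Pow U. \<Union> (h ` M) \<subseteq> Z}. ?w h)"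
    proof (rule sum.cong[OF refl])
      fix Z assume "Z \<in> Pow U"
      then have "M \<rightarrow>\<^sub>E Pow Z = {h \<in> M \<rightarrow>\<^sub>E Pow U. \<Union> (h ` M) \<subseteq> Z}"
        unfolding PiE_iff set_eq_iff mem_Collect_eq by blast
      then show "(\<Sum>h\<in>M \<rightarrow>\<^sub>E Pow Z. ?w h) = (\<Sum>h\<in>{h \<in> M \<rightarrow>\<^sub>E Pow U. \<Union> (h ` M) \<subseteq> Z}. ?w h)"
        by (simp only:)
    qed
    also have "\<dots> = (\<Sum>h\<in>M \<rightarrow>\<^sub>E Pow U. \<Sum>Z\<in>{Z \<in> Pow U. \<Union> (h ` M) \<subseteq> Z}. ?w h)"
      by (rule sum.swap_restrict[OF _ fin]) (use assms(1) in simp)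
    also have "\<dots> = (\<Sum>h\<in>M \<rightarrow>\<^sub>E Pow U. if \<Union> (h ` M) = U then ?w h else 0)"
    proof (rule sum.cong[OF refl])
      fix h assume "h \<in> M \<rightarrow>\<^sub>E Pow U"
      then have "\<Union> (h ` M) \<subseteq> U" by (auto simp: PiE_iff)
      moreover have "{Z \<in> Pow U. \<Union> (h ` M) \<subseteq> Z} = {Z. \<Union> (h ` M) \<subseteq> Z \<and> Z \<subseteq> U}" by auto
      ultimately show "(\<Sum>Z\<in>{Z \<in> Pow U. \<Union> (h ` M) \<subseteq> Z}. ?w h) = (if \<Union> (h ` M) = U then ?w h else 0)"
        using sum_supersets[OF assms(1)] by simp
    qed
    also have "\<dots> = (\<Sum>h\<in>covering U M. ?w h)"
      unfolding covering_def by (rule sum.inter_filter[OF fin, symmetric])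
    finally show "(\<Sum>Z\<in>Pow U. \<Prod>e\<in>M. \<Sum>S\<in>Pow Z. g e S) = (\<Sum>h\<in>covering U M. ?w h)" .
  qed
  finally show ?thesis .
qed

subsection \<open>Zeros of multilinear polynomials\<close>

text \<open>Schwartz--Zippel for homogeneous multilinear polynomials with coefficients 1, given by
  their monomials as sets of variables. For a variable \<open>v\<close> of some monomial the
  polynomial is \<open>t * P1 + P0\<close> in \<open>t = x v\<close>, where \<open>P1\<close> is
  nonzero of degree one less. A zero either makes \<open>P1\<close> vanish, which is rare by
  induction, or has its value at \<open>v\<close> determined by the others.\<close>

lemma card_multilinear_zeros:
  fixes K :: "'a :: field set"
  assumes "finite K" "finite Vs" "finite F" "F \<noteq> {}" "\<And>T. T \<in> F \<Longrightarrow> T \<subseteq> Vs \<and> card T = d"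
  shows "card {x \<in> Vs \<rightarrow>\<^sub>E K. (\<Sum>T\<in>F. \<Prod>v\<in>T. x v) = 0} * card K \<le> d * card K ^ card Vs"
  using assms(2-)
proof (induction d arbitrary: Vs F)
  case 0
  have "T = {}" if "T \<in> F" for T using 0(4)[OF that] 0(1) by (auto dest: finite_subset)
  then have "F = {{}}" using \<open>F \<noteq> {}\<close> by auto
  then show ?case by simp
next
  case (Suc d)
  obtain T0 where T0: "T0 \<in> F" using Suc by blast
  then obtain v where v: "v \<in> T0" using Suc.prems(4)[OF T0] by fastforce
  have vV: "v \<in> Vs" using Suc.prems(4)[OF T0] v by auto
  have finT: "finite T" if "T \<in> F" for T using Suc.prems that finite_subset by metis
  let ?V = "Vs - {v}"
  define F1 where "F1 = (\<lambda>T. T - {v}) ` {T \<in> F. v \<in> T}"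
  define F0 where "F0 = {T \<in> F. v \<notin> T}"
  define P where "P G x = (\<Sum>T\<in>G. \<Prod>u\<in>T. x u)" for G and x :: "'b \<Rightarrow> 'a"
  have F1: "finite F1" "F1 \<noteq> {}" "\<And>T. T \<in> F1 \<Longrightarrow> T \<subseteq> ?V \<and> card T = d"
    using Suc.prems T0 v finT by (auto simp: F1_def card_Diff_singleton)
  have split: "P F (y(v := t)) = t * P F1 y + P F0 y" for y t
  proof -
    have "P F (y(v := t)) = (\<Sum>T | T \<in> F \<and> v \<in> T. \<Prod>u\<in>T. (y(v := t)) u) + P F0 (y(v := t))"
      unfolding P_def F0_def using Suc.prems(2)
      by (subst sum.union_disjoint[symmetric]) (auto intro!: sum.cong)
    also have "P F0 (y(v := t)) = P F0 y"
      unfolding P_def F0_def by (intro sum.cong prod.cong refl) auto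
    also have "(\<Sum>T | T \<in> F \<and> v \<in> T. \<Prod>u\<in>T. (y(v := t)) u) = (\<Sum>T | T \<in> F \<and> v \<in> T. t * (\<Prod>u\<in>T - {v}. y u))"
    proof (rule sum.cong[OF refl], clarify)
      fix T assume "T \<in> F" "v \<in> T"
      then have "(\<Prod>u\<in>T. (y(v := t)) u) = (y(v := t)) v * (\<Prod>u\<in>T - {v}. (y(v := t)) u)"
        using finT by (intro prod.remove) auto
      also have "(\<Prod>u\<in>T - {v}. (y(v := t)) u) = (\<Prod>u\<in>T - {v}. y u)" by (intro prod.cong) auto
      finally show "(\<Prod>u\<in>T. (y(v := t)) u) = t * (\<Prod>u\<in>T - {v}. y u)" by simp
    qed
    also have "\<dots> = t * P F1 y"
    proof -
      have "inj_on (\<lambda>T. T - {v}) {T \<in> F. v \<in> T}" by (rule inj_onI) blast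
      then show ?thesis unfolding P_def F1_def by (subst sum.reindex) (auto simp: sum_distrib_left)
    qed
    finally show ?thesis .
  qed
  let ?Z = "{x \<in> Vs \<rightarrow>\<^sub>E K. P F x = 0}"
  let ?A = "{y \<in> ?V \<rightarrow>\<^sub>E K. P F1 y = 0}"
  have finV: "finite (?V \<rightarrow>\<^sub>E K)" using Suc.prems assms(1) by (intro finite_PiE) auto
  have "?Z \<subseteq> (\<lambda>(y, t). y(v := t)) ` (?A \<times> K) \<union> (\<lambda>y. y(v := - P F0 y / P F1 y)) ` (?V \<rightarrow>\<^sub>E K)"
  proof
    fix x assume x: "x \<in> ?Z"
    define y where "y = x(v := undefined)"
    have y: "y \<in> ?V \<rightarrow>\<^sub>E K" "x v \<in> K" "x = y(v := x v)"
      using x vV by (auto simp: y_def PiE_iff extensional_def)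
    have s: "x v * P F1 y + P F0 y = 0" using split[of y "x v"] x y(3) by simp
    show "x \<in> (\<lambda>(y, t). y(v := t)) ` (?A \<times> K) \<union> (\<lambda>y. y(v := - P F0 y / P F1 y)) ` (?V \<rightarrow>\<^sub>E K)"
    proof (cases "P F1 y = 0")
      case True
      then have "(y, x v) \<in> ?A \<times> K" using y by simp
      moreover have "x = (\<lambda>(y, t). y(v := t)) (y, x v)" using y(3) by simp
      ultimately show ?thesis by blast
    next
      case False
      then have "x v = - P F0 y / P F1 y" using s by (simp add: field_simps eq_neg_iff_add_eq_0)
      then have "x = y(v := - P F0 y / P F1 y)" using y(3) by metis
      then show ?thesis using y(1) by blast
    qed
  qed
  then have "card ?Z \<le> card ((\<lambda>(y, t). y(v := t)) ` (?A \<times> K) \<union> (\<lambda>y. y(v := - P F0 y / P F1 y)) ` (?V \<rightarrow>\<^sub>E K))"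
    using finV assms(1) by (intro card_mono) auto
  also have "\<dots> \<le> card (?A \<times> K) + card (?V \<rightarrow>\<^sub>E K)"
    using finV assms(1) by (intro order_trans[OF card_Un_le] add_mono card_image_le) auto
  also have "\<dots> = card ?A * card K + card K ^ card ?V"
    using Suc.prems by (simp add: card_cartesian_product card_PiE)
  also have "\<dots> \<le> d * card K ^ card ?V + card K ^ card ?V"
    using Suc.IH[OF _ F1] Suc.prems(1) by (simp add: P_def)
  finally have "card ?Z * card K \<le> Suc d * card K ^ card ?V * card K"
    by (intro mult_le_mono1) simp
  also have "\<dots> = Suc d * card K ^ card Vs"
    unfolding card.remove[OF Suc.prems(1) vV] by (simp only: power_Suc ac_simps)
  finally show ?case by (simp add: P_def)
qed

subsection \<open>Random field elements from coins\<close>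

lemma space_coin_space [simp]: "space coin_space = UNIV"
  by (simp add: coin_space_def space_stream_space)

lemma stake_event_measurable: "{\<omega>. Q (stake T \<omega>)} \<in> sets coin_space"
proof -
  have "sets coin_space = sets (stream_space (count_space UNIV))"
    unfolding coin_space_def by (intro sets_stream_space_cong) simp
  moreover have "stake T -` {bs. Q bs} \<inter> space (stream_space (count_space UNIV)) \<in>
      sets (stream_space (count_space (UNIV :: bool set)))"
    by (rule measurable_sets[OF measurable_stake]) simp
  ultimately show ?thesis by (simp add: space_stream_space vimage_def)
qed

lemma finite_bool_lists: "finite {bs :: bool list. length bs = T \<and> Q bs}"
  by (rule finite_subset[OF _ finite_lists_length_eq[of "UNIV :: bool set" T]]) auto

lemma card_Cons_split:
  "card {bs. length bs = Suc T \<and> Q bs} =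
   card {bs. length bs = T \<and> Q (True # bs)} + card {bs. length bs = T \<and> Q (False # bs)}"
proof -
  have "{bs. length bs = Suc T \<and> Q bs} =
      (#) True ` {bs. length bs = T \<and> Q (True # bs)} \<union> (#) False ` {bs. length bs = T \<and> Q (False # bs)}"
  proof (rule set_eqI)
    fix bs
    show "bs \<in> {bs. length bs = Suc T \<and> Q bs} \<longleftrightarrow> bs \<in> (#) True ` {bs. length bs = T \<and> Q (True # bs)} \<union>
        (#) False ` {bs. length bs = T \<and> Q (False # bs)}"
      by (cases bs; cases "hd bs") auto
  qed
  then show ?thesis
    by (simp only:) (subst card_Un_disjoint, auto simp: card_image finite_bool_lists)
qed

lemma emeasure_stake_event:
  "emeasure coin_space {\<omega>. Q (stake T \<omega>)} = ennreal (real (card {bs. length bs = T \<and> Q bs}) / 2 ^ T)"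
proof (induction T arbitrary: Q)
  case 0
  have S1: "emeasure coin_space (space coin_space) = 1"
    unfolding coin_space_def by (rule prob_space.emeasure_space_1[OF prob_space.prob_space_stream_space[OF prob_space_measure_pmf]])
  have "{bs. bs = [] \<and> Q bs} = (if Q [] then {[]} else {})" by auto
  then show ?case using S1 by auto
next
  case (Suc T)
  let ?c = "\<lambda>b. real (card {bs. length bs = T \<and> Q (b # bs)}) / 2 ^ T"
  have "emeasure coin_space {\<omega>. Q (stake (Suc T) \<omega>)} =
      (\<integral>\<^sup>+b. emeasure coin_space {x\<in>space coin_space. b ## x \<in> {\<omega>. Q (stake (Suc T) \<omega>)}} \<partial>bernoulli_pmf (1/2))"
    using stake_event_measurable[of Q "Suc T"] unfolding coin_space_def by (rule prob_space.emeasure_stream_space[OF prob_space_measure_pmf])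
  also have "\<dots> = (\<integral>\<^sup>+b. ennreal (?c b) \<partial>bernoulli_pmf (1/2))"
    using Suc.IH[of "\<lambda>bs. Q (_ # bs)"] by (intro nn_integral_cong) simp
  also have "\<dots> = ennreal (?c True) * ennreal (1/2) + ennreal (?c False) * ennreal (1/2)"
    by (subst nn_integral_bernoulli_pmf) auto
  also have "\<dots> = ennreal (?c True * (1/2) + ?c False * (1/2))"
  proof -
    have e: "ennreal (?c b) * ennreal (1/2) = ennreal (?c b * (1/2))" for b
      by (rule ennreal_mult[symmetric]) auto
    show ?thesis unfolding e by (rule ennreal_plus[symmetric]) auto
  qed
  also have "?c True * (1/2) + ?c False * (1/2) = real (card {bs. length bs = Suc T \<and> Q bs}) / 2 ^ Suc T"
    unfolding card_Cons_split by (simp add: field_simps)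
  finally show ?case .
qed

lemma measure_stake_event:
  "measure coin_space {\<omega>. Q (stake T \<omega>)} = real (card {bs. length bs = T \<and> Q bs}) / 2 ^ T"
  by (simp add: measure_def emeasure_stake_event)

text \<open>The most significant bit comes first, matching a loop that doubles and adds the next
  bit.\<close>

primrec bn :: "(nat \<Rightarrow> bool) \<Rightarrow> nat \<Rightarrow> nat" where
  "bn f 0 = 0"
| "bn f (Suc b) = 2 * bn f b + of_bool (f b)"

lemma bn_less: "bn f r < 2 ^ r"
  by (induction r) auto

lemma bn_inj: "bn f r = bn g r \<Longrightarrow> b < r \<Longrightarrow> f b = g b"
proof (induction r)
  case (Suc r)
  have "of_bool (f r) = (of_bool (g r) :: nat) \<and> bn f r = bn g r"
    using Suc.prems(1) by (auto simp: of_bool_def split: if_splits) presburger+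
  then show ?case using Suc by (cases "b = r") (auto simp: of_bool_def split: if_splits)
qed simp

lemma bn_cong: "(\<And>b. b < r \<Longrightarrow> f b = g b) \<Longrightarrow> bn f r = bn g r"
  by (induction r) auto

text \<open>Each variable reads its own block of \<open>r\<close> coins, so the values are uniform
  and independent.\<close>

definition rnd :: "nat \<Rightarrow> (nat \<Rightarrow> bool) \<Rightarrow> nat \<Rightarrow> gf" where
  "rnd r f v = Gf (bn (\<lambda>b. f (v * r + b)) r)"

lemma pair_less_prod: "v < V \<Longrightarrow> b < r \<Longrightarrow> v * r + b < V * (r::nat)"
proof -
  assume "v < V" "b < r"
  then have "v * r + b < Suc v * r" by simp
  also have "\<dots> \<le> V * r" using \<open>v < V\<close> by (intro mult_le_mono1) simp
  finally show ?thesis .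
qed

text \<open>Binary digits give injectivity, and equal cardinalities give surjectivity. Uniform coins
  thus become a uniform assignment, and probabilities become counts of assignments.\<close>

lemma bij_betw_rnd:
  "bij_betw (\<lambda>bs. restrict (rnd r ((!) bs)) {..<V}) {bs. length bs = V * r}
     ({..<V} \<rightarrow>\<^sub>E {x. code x < 2 ^ r})" (is "bij_betw ?f ?A ?B")
proof -
  have K: "{x. code x < 2 ^ r} = Gf ` {..<2 ^ r}"
    by (auto simp: image_iff) (metis code_inverse lessThan_iff, metis Gf_inverse UNIV_I)
  have cK: "card {x. code x < 2 ^ r} = 2 ^ r" "finite {x. code x < 2 ^ r}"
    unfolding K by (subst card_image) (auto simp: inj_on_def Gf_inject)
  have fB: "finite ?B" using cK by (intro finite_PiE) auto
  have cA: "card ?A = 2 ^ (V * r)"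
    using card_lists_length_eq[of "UNIV :: bool set" "V * r"] by simp
  have inj: "inj_on ?f ?A"
  proof (rule inj_onI)
    fix bs bs' :: "bool list"
    assume l: "bs \<in> ?A" "bs' \<in> ?A" and eq: "?f bs = ?f bs'"
    show "bs = bs'"
    proof (rule nth_equalityI)
      fix i assume "i < length bs"
      then have i: "i < V * r" using l by simp
      then have r: "0 < r" by (cases r) auto
      then have v: "i div r < V" "i mod r < r" using i by (auto simp: less_mult_imp_div_less)
      have "rnd r ((!) bs) (i div r) = rnd r ((!) bs') (i div r)"
        using fun_cong[OF eq, of "i div r"] v by simp
      then have "bn (\<lambda>b. bs ! (i div r * r + b)) r = bn (\<lambda>b. bs' ! (i div r * r + b)) r"
        by (simp add: rnd_def Gf_inject)
      from bn_inj[OF this v(2)] show "bs ! i = bs' ! i" by simp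
    qed (use l in simp)
  qed
  have sub: "?f ` ?A \<subseteq> ?B"
  proof (rule image_subsetI, rule PiE_I)
    fix bs :: "bool list" and v assume "v \<in> {..<V}"
    then show "?f bs v \<in> {x. code x < 2 ^ r}" by (simp add: rnd_def Gf_inverse bn_less)
  qed simp
  have "card (?f ` ?A) = card ?B"
    using card_image[OF inj] cA cK by (simp add: card_PiE power_mult[symmetric] mult.commute)
  then have "?f ` ?A = ?B" using sub fB by (intro card_subset_eq)
  then show ?thesis using inj by (simp add: bij_betw_def)
qed

text \<open>Each variable is sampled from \<open>2 ^ r\<close> elements, so the fraction of zeros is
  at most \<open>d / 2 ^ r\<close>, hence at most \<open>1 / 3\<close> by the assumption on
  \<open>r\<close>.\<close>

theorem multilinear_nonzero_prob:
  assumes F: "finite F" "F \<noteq> {}" "\<And>T. T \<in> F \<Longrightarrow> T \<subseteq> {..<V} \<and> card T = d" and q: "3 * d \<le> 2 ^ r"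
  shows "measure coin_space {\<omega>. (\<Sum>T\<in>F. \<Prod>v\<in>T. rnd r ((!!) \<omega>) v) \<noteq> 0} \<ge> 2/3"
proof -
  let ?K = "{x. code x < 2 ^ r}"
  let ?B = "{..<V} \<rightarrow>\<^sub>E ?K"
  let ?f = "\<lambda>bs. restrict (rnd r ((!) bs)) {..<V}"
  define P where "P x = (\<Sum>T\<in>F. \<Prod>v\<in>T. x v)" for x :: "nat \<Rightarrow> gf"
  have Pcong: "P x = P y" if "\<And>v. v < V \<Longrightarrow> x v = y v" for x y
    unfolding P_def using F(3) that by (intro sum.cong prod.cong) auto
  have K: "?K = Gf ` {..<2 ^ r}"
    by (auto simp: image_iff) (metis code_inverse lessThan_iff, metis Gf_inverse UNIV_I)
  have cK: "card ?K = 2 ^ r" "finite ?K"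
    unfolding K by (subst card_image) (auto simp: inj_on_def Gf_inject)
  have fB: "finite ?B" using cK by (intro finite_PiE) auto
  have rw: "rnd r ((!!) \<omega>) v = ?f (stake (V * r) \<omega>) v" if "v < V" for \<omega> v
    using that pair_less_prod[of v V _ r] unfolding rnd_def
    by (simp add: rnd_def) (intro arg_cong[of _ _ Gf] bn_cong, simp add: stake_nth)
  have "{\<omega>. P (rnd r ((!!) \<omega>)) \<noteq> 0} = {\<omega>. P (?f (stake (V * r) \<omega>)) \<noteq> 0}"
  proof -
    have "P (rnd r ((!!) \<omega>)) = P (?f (stake (V * r) \<omega>))" for \<omega>
      by (rule Pcong) (rule rw)
    then show ?thesis by (simp only:)
  qed
  then have m: "measure coin_space {\<omega>. P (rnd r ((!!) \<omega>)) \<noteq> 0} =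
      real (card {bs. length bs = V * r \<and> P (?f bs) \<noteq> 0}) / 2 ^ (V * r)"
    by (simp only: measure_stake_event[of "\<lambda>bs. P (?f bs) \<noteq> 0"])
  have "bij_betw ?f {bs. length bs = V * r \<and> P (?f bs) \<noteq> 0} {x \<in> ?B. P x \<noteq> 0}"
    using bij_betw_rnd[of r V] unfolding bij_betw_def by (auto intro: inj_on_subset)
  then have c: "card {bs. length bs = V * r \<and> P (?f bs) \<noteq> 0} = card {x \<in> ?B. P x \<noteq> 0}"
    by (rule bij_betw_same_card)
  have z: "card {x \<in> ?B. P x = 0} * 2 ^ r \<le> d * (2 ^ r) ^ V"
    using card_multilinear_zeros[OF cK(2) _ F(1,2), of "{..<V}" d] F(3) cK(1) by (simp add: P_def)
  have "card {x \<in> ?B. P x = 0} + card {x \<in> ?B. P x \<noteq> 0} = card ?B"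
    using fB by (subst card_Un_disjoint[symmetric]) (auto intro!: arg_cong[of _ _ card])
  then have t: "real (card {x \<in> ?B. P x = 0}) + real (card {x \<in> ?B. P x \<noteq> 0}) = (2 ^ r) ^ V"
    using cK by (simp add: card_PiE flip: of_nat_add)
  let ?z = "real (card {x \<in> ?B. P x = 0})"
  have "real (card {x \<in> ?B. P x = 0} * 2 ^ r) \<le> real (d * (2 ^ r) ^ V)"
    using z by (simp only: of_nat_le_iff)
  then have "3 * (?z * 2 ^ r) \<le> real (3 * d) * (2 ^ r) ^ V" by simp
  also have "real (3 * d) \<le> 2 ^ r" using q by (metis of_nat_le_iff of_nat_numeral of_nat_power)
  then have "real (3 * d) * (2 ^ r) ^ V \<le> 2 ^ r * (2 ^ r) ^ V" by (intro mult_right_mono) auto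
  finally have "3 * ?z \<le> (2 ^ r) ^ V" by (simp add: mult.commute)
  then have "real (card {x \<in> ?B. P x \<noteq> 0}) \<ge> 2/3 * (2 ^ r) ^ V" using t by simp
  then have "measure coin_space {\<omega>. P (rnd r ((!!) \<omega>)) \<noteq> 0} \<ge> 2/3"
    unfolding m c by (simp add: field_simps power_mult[symmetric] mult.commute)
  then show ?thesis by (simp add: P_def)
qed

subsection \<open>Packings and matchings\<close>

lemma bij_betw_rank:
  fixes A :: "nat set"
  assumes "finite A"
  shows "bij_betw (\<lambda>x. card {y. y < x \<and> y \<in> A}) A {..<card A}"
proof -
  let ?r = "\<lambda>x. card {y. y < x \<and> y \<in> A}"
  have mono: "?r x < ?r y" if "x \<in> A" "x < y" for x y
  proof (rule psubset_card_mono)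
    have "x \<in> {z. z < y \<and> z \<in> A}" "x \<notin> {z. z < x \<and> z \<in> A}" using that by simp_all
    moreover have "{z. z < x \<and> z \<in> A} \<subseteq> {z. z < y \<and> z \<in> A}" using that by auto
    ultimately show "{z. z < x \<and> z \<in> A} \<subset> {z. z < y \<and> z \<in> A}" by blast
  qed simp
  have inj: "inj_on ?r A"
  proof (rule inj_onI)
    fix x y assume "x \<in> A" "y \<in> A" "?r x = ?r y"
    then show "x = y" using mono[of x y] mono[of y x] by (cases x y rule: linorder_cases) simp_all
  qed
  have "?r x < card A" if "x \<in> A" for x
  proof (rule psubset_card_mono[OF assms])
    have "x \<notin> {z. z < x \<and> z \<in> A}" by simp
    then show "{z. z < x \<and> z \<in> A} \<subset> A" using that by blast
  qed
  then have "?r ` A \<subseteq> {..<card A}" by auto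
  moreover have "card (?r ` A) = card A" using inj by (rule card_image)
  ultimately show ?thesis using inj by (simp add: bij_betw_def card_subset_eq)
qed

lemma card_fibers:
  fixes g :: "'a \<Rightarrow> nat"
  assumes "finite A" "g ` A \<subseteq> {..<L}"
  shows "(\<Sum>b<L. card {a \<in> A. g a = b}) = card A"
  using sum.group[OF assms(1) finite_lessThan assms(2), of "\<lambda>_. 1::nat"] by simp

text \<open>As long as a dummy is left, the total \<open>2 * L\<close> leaves a bin with fewer than
  two vertices, and the dummy goes there. In the end at most two vertices per bin and
  \<open>2 * L\<close> in all force exactly two.\<close>

lemma extend_to_pairs:
  fixes g :: "'a \<Rightarrow> nat"
  assumes "finite D" "finite A" "A \<inter> D = {}" "g ` A \<subseteq> {..<L}"
    "\<And>b. b < L \<Longrightarrow> card {a \<in> A. g a = b} \<le> 2" "card A + card D = 2 * L"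
  shows "\<exists>f. (\<forall>a\<in>A. f a = g a) \<and> f ` (A \<union> D) \<subseteq> {..<L} \<and> (\<forall>b<L. card {a \<in> A \<union> D. f a = b} = 2)"
  using assms
proof (induction D arbitrary: A g rule: finite_induct)
  case empty
  have "card {a \<in> A. g a = b} = 2" if "b < L" for b
  proof (rule ccontr)
    assume "card {a \<in> A. g a = b} \<noteq> 2"
    then have "card {a \<in> A. g a = b} < 2" using empty.prems(4)[OF that] by simp
    then have "(\<Sum>b<L. card {a \<in> A. g a = b}) < (\<Sum>b<L. 2)"
      using empty.prems that by (intro sum_strict_mono_ex1) auto
    then show False using card_fibers[of A g L] empty.prems by simp
  qed
  then show ?case using empty.prems by (intro exI[of _ g]) auto
next
  case (insert x D)
  have "\<exists>b<L. card {a \<in> A. g a = b} < 2"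
  proof (rule ccontr)
    assume "\<not> ?thesis"
    then have "(\<Sum>b<L. 2) \<le> (\<Sum>b<L. card {a \<in> A. g a = b})" by (intro sum_mono) (metis lessThan_iff not_less)
    then show False using card_fibers[of A g L] insert by simp
  qed
  then obtain b where b: "b < L" "card {a \<in> A. g a = b} < 2" by blast
  have xA: "x \<notin> A" using insert.prems by auto
  have fib: "card {a \<in> insert x A. (g(x := b)) a = c} \<le> 2" if "c < L" for c
  proof (cases "c = b")
    case True
    have "{a \<in> insert x A. (g(x := b)) a = c} = insert x {a \<in> A. g a = b}" using True xA by auto
    then show ?thesis using b xA insert.prems(1) by simp
  next
    case False
    have "{a \<in> insert x A. (g(x := b)) a = c} = {a \<in> A. g a = c}" using False xA by auto
    then show ?thesis using insert.prems that by simp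
  qed
  have "\<exists>f. (\<forall>a\<in>insert x A. f a = (g(x := b)) a) \<and> f ` (insert x A \<union> D) \<subseteq> {..<L} \<and>
      (\<forall>c<L. card {a \<in> insert x A \<union> D. f a = c} = 2)"
  proof (rule insert.IH)
    show "(g(x := b)) ` insert x A \<subseteq> {..<L}" using insert.prems b by auto
    show "card (insert x A) + card D = 2 * L" using insert xA by simp
  qed (use insert fib in auto)
  then obtain f where f: "\<forall>a\<in>insert x A. f a = (g(x := b)) a" "f ` (insert x A \<union> D) \<subseteq> {..<L}"
      "\<forall>c<L. card {a \<in> insert x A \<union> D. f a = c} = 2" by blast
  have "f a = g a" if "a \<in> A" for a
  proof -
    have "f a = (g(x := b)) a" using f(1) that by blast
    then show ?thesis using that xA by auto
  qed
  moreover have "insert x A \<union> D = A \<union> insert x D" by auto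
  ultimately show ?case using f(2,3) by metis
qed

lemma card_pms:
  assumes "M \<in> pms V" "finite V"
  shows "card V = 2 * card M"
proof -
  have fM: "finite M" using assms finite_in_pms by blast
  have e: "fst e < snd e" "fst e \<in> V" "snd e \<in> V" if "e \<in> M" for e
    using in_pmsD[OF assms(1) that] by auto
  have ex1: "\<exists>!e. e \<in> M \<and> (x = fst e \<or> x = snd e)" if "x \<in> V" for x
    using assms(1) that by (auto simp: pms_def)
  have "V = (\<Union>e\<in>M. {fst e, snd e})"
  proof (intro equalityI subsetI)
    fix x assume "x \<in> V"
    then obtain e where "e \<in> M" "x = fst e \<or> x = snd e" using ex1 by metis
    then show "x \<in> (\<Union>e\<in>M. {fst e, snd e})" by auto
  next
    fix x assume "x \<in> (\<Union>e\<in>M. {fst e, snd e})"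
    then show "x \<in> V" using e by auto
  qed
  also have "card \<dots> = (\<Sum>e\<in>M. card {fst e, snd e})"
  proof (rule card_UN_disjoint[OF fM])
    show "\<forall>i\<in>M. \<forall>j\<in>M. i \<noteq> j \<longrightarrow> {fst i, snd i} \<inter> {fst j, snd j} = {}"
    proof (intro ballI impI)
      fix i j assume ij: "i \<in> M" "j \<in> M" "i \<noteq> j"
      have False if "x \<in> {fst i, snd i}" "x \<in> {fst j, snd j}" for x
      proof -
        have "x \<in> V" using that(1) e[OF ij(1)] by auto
        then have "\<exists>!e. e \<in> M \<and> (x = fst e \<or> x = snd e)" by (rule ex1)
        moreover have "x = fst i \<or> x = snd i" "x = fst j \<or> x = snd j" using that by auto
        ultimately show False using ij by (elim ex1E) metis
      qed
      then show "{fst i, snd i} \<inter> {fst j, snd j} = {}" by blast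
    qed
  qed auto
  also have "\<dots> = (\<Sum>e\<in>M. 2)"
    by (rule sum.cong[OF refl]) (use e(1) in \<open>fastforce simp: card_insert_if\<close>)
  finally show ?thesis by simp
qed

locale packing =
  fixes n d l :: nat and w :: "nat \<Rightarrow> nat \<Rightarrow> rat" and Sm :: "nat set"
  assumes nonneg: "\<And>x j. x < n \<Longrightarrow> j < d \<Longrightarrow> 0 \<le> w x j"
    and Sm: "Sm \<subseteq> {..<n}"
    and incompat: "\<And>x y z. x < n \<Longrightarrow> y < n \<Longrightarrow> z < n \<Longrightarrow> x \<notin> Sm \<Longrightarrow> y \<notin> Sm \<Longrightarrow> z \<notin> Sm \<Longrightarrow>
      x \<noteq> y \<Longrightarrow> x \<noteq> z \<Longrightarrow> y \<noteq> z \<Longrightarrow> \<exists>j<d. w x j + w y j + w z j > 1"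
begin

definition Lg :: "nat set" where "Lg = {..<n} - Sm"

text \<open>One function numbers small and large items separately, each class from 0: small ranks
  become bit positions of set codes, large ranks become vertices.\<close>

definition rk :: "nat \<Rightarrow> nat" where "rk x = card {y. y < x \<and> y < n \<and> (y \<in> Sm \<longleftrightarrow> x \<in> Sm)}"

text \<open>
  Vertices \<open>u < card Lg\<close> stand for the large item of rank \<open>u\<close>, all others for a missing item;
  \<open>S\<close> is a set of ranks of small items.
\<close>

definition inbin :: "nat \<times> nat \<Rightarrow> nat set \<Rightarrow> nat \<Rightarrow> bool" where
  "inbin e S x \<longleftrightarrow> (if x \<in> Sm then rk x \<in> S else rk x = fst e \<or> rk x = snd e)"

definition feas :: "nat \<times> nat \<Rightarrow> nat set \<Rightarrow> bool" where
  "feas e S \<longleftrightarrow> (\<forall>j<d. (\<Sum>x | x < n \<and> inbin e S x. w x j) \<le> 1)"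

definition packed :: "(nat \<Rightarrow> nat) \<Rightarrow> nat \<Rightarrow> bool" where
  "packed f L \<longleftrightarrow> (\<forall>x<n. f x < L) \<and> (\<forall>i<L. \<forall>j<d. (\<Sum>x | x < n \<and> f x = i. w x j) \<le> 1)"

lemma fin [simp]: "finite Sm" "finite Lg"
  using Sm finite_subset by (auto simp: Lg_def)

lemma bij_rk_Sm: "bij_betw rk Sm {..<card Sm}"
proof -
  have "rk x = card {y. y < x \<and> y \<in> Sm}" if "x \<in> Sm" for x
    unfolding rk_def using that Sm by (intro arg_cong[of _ _ card]) auto
  then show ?thesis using bij_betw_rank[OF fin(1)] by (simp cong: bij_betw_cong)
qed

lemma bij_rk_Lg: "bij_betw rk Lg {..<card Lg}"
proof -
  have "rk x = card {y. y < x \<and> y \<in> Lg}" if "x \<in> Lg" for x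
    unfolding rk_def using that by (intro arg_cong[of _ _ card]) (auto simp: Lg_def)
  then show ?thesis using bij_betw_rank[OF fin(2)] by (simp cong: bij_betw_cong)
qed

lemma sum_mono_bin:
  assumes "A \<subseteq> B" "B \<subseteq> {..<n}" "j < d"
  shows "(\<Sum>x\<in>A. w x j) \<le> (\<Sum>x\<in>B. w x j)"
  using assms nonneg by (intro sum_mono2) (auto intro: finite_subset)

text \<open>The number of bins is given in binary and may exceed every polynomial in the input size.
  At most \<open>n\<close> bins are occupied, and an injective renumbering moves these below
  \<open>min l n\<close>.\<close>

lemma packed_min:
  assumes "packed f l"
  shows "\<exists>f'. packed f' (min l n)"
proof -
  let ?I = "f ` {..<n}"
  have "card ?I \<le> min l n"
    using assms card_image_le[of "{..<n}" f] card_mono[of "{..<l}" ?I] by (auto simp: packed_def)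
  then obtain \<phi> where \<phi>: "inj_on \<phi> ?I" "\<phi> ` ?I \<subseteq> {..<min l n}"
    using inj_on_iff_card_le[of ?I "{..<min l n}"] by auto
  have "packed (\<phi> \<circ> f) (min l n)"
    unfolding packed_def
  proof (intro conjI allI impI)
    fix i j assume i: "i < min l n" "j < d"
    show "(\<Sum>x | x < n \<and> (\<phi> \<circ> f) x = i. w x j) \<le> 1"
    proof (cases "\<exists>y<n. \<phi> (f y) = i")
      case True
      then obtain y where y: "y < n" "\<phi> (f y) = i" by blast
      have "{x. x < n \<and> (\<phi> \<circ> f) x = i} = {x. x < n \<and> f x = f y}"
        using y \<phi>(1) by (auto simp: inj_on_def)
      then show ?thesis using assms y i by (auto simp: packed_def)
    next
      case False
      then have e: "{x. x < n \<and> (\<phi> \<circ> f) x = i} = {}" by auto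
      show ?thesis unfolding e by simp
    qed
  next
    fix x assume "x < n"
    then have "\<phi> (f x) \<in> {..<min l n}" using \<phi>(2) by blast
    then show "(\<phi> \<circ> f) x < min l n" by simp
  qed
  then show ?thesis by blast
qed

text \<open>Three large items in one bin would violate a coordinate by incompatibility and
  nonnegativity. So each bin holds at most two, dummies fill it up to a pair, these pairs are the
  edges, and an edge gets the small items of its bin.\<close>

theorem packed_imp_matching:
  assumes "packed f L"
  shows "card Lg \<le> 2 * L \<and>
    (\<exists>M\<in>pms {..<2 * L}. \<exists>h\<in>covering {..<card Sm} M. \<forall>e\<in>M. feas e (h e))"
proof -
  let ?m = "card Lg"
  define it where "it = the_inv_into Lg rk"
  define its where "its = the_inv_into Sm rk"
  have it: "it u \<in> Lg" "rk (it u) = u" if "u < ?m" for u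
    using bij_rk_Lg that f_the_inv_into_f_bij_betw[OF bij_rk_Lg, of u] bij_betw_the_inv_into[OF bij_rk_Lg]
    unfolding it_def by (auto dest: bij_betwE)
  have it_rk: "it (rk x) = x" if "x \<in> Lg" for x
    using that bij_rk_Lg unfolding it_def by (auto simp: bij_betw_def the_inv_into_f_f)
  have its: "its s \<in> Sm" "rk (its s) = s" if "s < card Sm" for s
    using bij_rk_Sm that f_the_inv_into_f_bij_betw[OF bij_rk_Sm, of s] bij_betw_the_inv_into[OF bij_rk_Sm]
    unfolding its_def by (auto dest: bij_betwE)
  have its_rk: "its (rk x) = x" if "x \<in> Sm" for x
    using that bij_rk_Sm unfolding its_def by (auto simp: bij_betw_def the_inv_into_f_f)
  define g where "g = f \<circ> it"
  have fL: "f x < L" if "x < n" for x using assms that by (simp add: packed_def)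
  have itn: "it u < n" if "u < ?m" for u using it(1)[OF that] by (simp add: Lg_def)
  have fib: "card {u \<in> {..<?m}. g u = b} \<le> 2" if b: "b < L" for b
  proof (rule ccontr)
    assume "\<not> ?thesis"
    then have "3 \<le> card {u \<in> {..<?m}. g u = b}" by simp
    then obtain X where X: "X \<subseteq> {u \<in> {..<?m}. g u = b}" "card X = 3"
      by (rule obtain_subset_with_card_n)
    from X(2) obtain x y z where xyz: "X = {x, y, z}" "x \<noteq> y" "x \<noteq> z" "y \<noteq> z"
      unfolding card_3_iff by blast
    have u: "x < ?m" "y < ?m" "z < ?m" "f (it x) = b" "f (it y) = b" "f (it z) = b"
      using X xyz by (auto simp: g_def)
    have ne: "it x \<noteq> it y" "it x \<noteq> it z" "it y \<noteq> it z" using it u xyz by metis+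
    have L: "it x < n" "it y < n" "it z < n" "it x \<notin> Sm" "it y \<notin> Sm" "it z \<notin> Sm"
      using it(1) u by (auto simp: Lg_def)
    obtain j where j: "j < d" "w (it x) j + w (it y) j + w (it z) j > 1"
      using incompat[OF L ne] by blast
    have "(\<Sum>v\<in>{it x, it y, it z}. w v j) \<le> (\<Sum>v | v < n \<and> f v = b. w v j)"
      using L u j(1) by (intro sum_mono_bin) auto
    also have "\<dots> \<le> 1" using assms b j(1) by (simp add: packed_def)
    finally show False using j(2) ne by simp
  qed
  have gim: "g ` {..<?m} \<subseteq> {..<L}" using fL itn by (auto simp: g_def)
  have mN: "?m \<le> 2 * L"
  proof -
    have "?m = (\<Sum>b<L. card {u \<in> {..<?m}. g u = b})" using card_fibers[OF _ gim] by simp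
    also have "\<dots> \<le> (\<Sum>b<L. 2)" using fib by (intro sum_mono) auto
    finally show ?thesis by simp
  qed
  have "\<exists>G. (\<forall>a\<in>{..<?m}. G a = g a) \<and> G ` ({..<?m} \<union> {?m..<2 * L}) \<subseteq> {..<L} \<and>
      (\<forall>b<L. card {a \<in> {..<?m} \<union> {?m..<2 * L}. G a = b} = 2)"
    by (rule extend_to_pairs) (use gim fib mN in auto)
  moreover have "{..<?m} \<union> {?m..<2 * L} = {..<2 * L}" using mN by auto
  ultimately obtain G where G: "\<And>a. a < ?m \<Longrightarrow> G a = g a" "\<And>a. a < 2 * L \<Longrightarrow> G a < L"
      "\<And>b. b < L \<Longrightarrow> card {a. a < 2 * L \<and> G a = b} = 2"
    by (auto simp: image_subset_iff)
  define M where "M = {(u, v). u < v \<and> v < 2 * L \<and> G u = G v}"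
  have pair: "\<exists>u v. u < v \<and> v < 2 * L \<and> {a. a < 2 * L \<and> G a = b} = {u, v}" if b: "b < L" for b
  proof -
    obtain u v where uv: "{a. a < 2 * L \<and> G a = b} = {u, v}" "u \<noteq> v"
      using G(3)[OF b] unfolding card_2_iff by blast
    then have "u \<in> {a. a < 2 * L \<and> G a = b}" "v \<in> {a. a < 2 * L \<and> G a = b}" by simp_all
    then have "u < 2 * L" "v < 2 * L" by simp_all
    show ?thesis
    proof (cases "u < v")
      case True
      then show ?thesis using uv \<open>v < 2 * L\<close> by blast
    next
      case False
      then have "v < u" using uv by simp
      moreover have "{a. a < 2 * L \<and> G a = b} = {v, u}" using uv by (simp only: insert_commute)
      ultimately show ?thesis using \<open>u < 2 * L\<close> by blast
    qed
  qed
  have M_sub: "fst e \<in> {..<2 * L} \<and> snd e \<in> {..<2 * L} \<and> fst e < snd e" if "e \<in> M" for e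
    using that by (auto simp: M_def)
  have M_ex1: "\<exists>!e. e \<in> M \<and> (x = fst e \<or> x = snd e)" if x: "x < 2 * L" for x
  proof -
    obtain u v where uv: "u < v" "v < 2 * L" "{a. a < 2 * L \<and> G a = G x} = {u, v}"
      using pair[OF G(2)[OF x]] by (elim exE conjE) (rule that)
    have mem: "a < 2 * L \<and> G a = G x \<longleftrightarrow> a = u \<or> a = v" for a
      using uv(3) by (simp add: set_eq_iff)
    have xuv: "x = u \<or> x = v" using mem[of x] x by simp
    show "\<exists>!e. e \<in> M \<and> (x = fst e \<or> x = snd e)"
    proof (rule ex1I[of _ "(u, v)"])
      show "(u, v) \<in> M \<and> (x = fst (u, v) \<or> x = snd (u, v))"
        using uv mem[of u] mem[of v] xuv by (auto simp: M_def)
    next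
      fix e assume e: "e \<in> M \<and> (x = fst e \<or> x = snd e)"
      obtain a b where [simp]: "e = (a, b)" by fastforce
      have "a < b" "b < 2 * L" "G a = G x" "G b = G x" using e by (auto simp: M_def)
      then show "e = (u, v)" using mem[of a] mem[of b] uv(1) by auto
    qed
  qed
  have "M \<in> pms {..<2 * L}"
    unfolding pms_def using M_sub M_ex1 by auto
  moreover define h where "h = (\<lambda>e\<in>M. {s. s < card Sm \<and> f (its s) = G (fst e)})"
  have "h \<in> covering {..<card Sm} M"
    unfolding covering_def
  proof (intro CollectI conjI)
    show "h \<in> M \<rightarrow>\<^sub>E Pow {..<card Sm}" by (auto simp: h_def)
    show "\<Union> (h ` M) = {..<card Sm}"
    proof
      show "\<Union> (h ` M) \<subseteq> {..<card Sm}" by (auto simp: h_def)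
      show "{..<card Sm} \<subseteq> \<Union> (h ` M)"
      proof
        fix s assume "s \<in> {..<card Sm}"
        then have s: "s < card Sm" by simp
        then have "its s < n" using its(1) Sm by auto
        then obtain u v where uv: "u < v" "v < 2 * L" "{a. a < 2 * L \<and> G a = f (its s)} = {u, v}"
          using pair[of "f (its s)"] fL[of "its s"] by blast
        then have "u \<in> {a. a < 2 * L \<and> G a = f (its s)}" "v \<in> {a. a < 2 * L \<and> G a = f (its s)}" by simp_all
        then have "G u = f (its s)" "G v = f (its s)" by simp_all
        then have "(u, v) \<in> M" "s \<in> h (u, v)" using uv s by (auto simp: M_def h_def)
        then show "s \<in> \<Union> (h ` M)" by blast
      qed
    qed
  qed
  moreover have "feas e (h e)" if e: "e \<in> M" for e
    unfolding feas_def
  proof (intro allI impI)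
    fix j assume j: "j < d"
    have ge: "G (fst e) < L" "G (snd e) = G (fst e)" using e G(2)[of "fst e"] by (auto simp: M_def)
    have "{x. x < n \<and> inbin e (h e) x} \<subseteq> {x. x < n \<and> f x = G (fst e)}"
    proof clarify
      fix x assume x: "x < n" "inbin e (h e) x"
      show "f x = G (fst e)"
      proof (cases "x \<in> Sm")
        case True
        then have "rk x \<in> h e" using x(2) by (simp add: inbin_def)
        then show ?thesis using e its_rk[OF True] by (simp add: h_def)
      next
        case False
        then have xL: "x \<in> Lg" using x by (simp add: Lg_def)
        then have "rk x < ?m" using bij_rk_Lg by (auto dest: bij_betwE)
        then have "G (rk x) = f x" using G(1) it_rk[OF xL] by (simp add: g_def)
        then show ?thesis using x(2) False ge by (auto simp: inbin_def)
      qed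
    qed
    then have "(\<Sum>x | x < n \<and> inbin e (h e) x. w x j) \<le> (\<Sum>x | x < n \<and> f x = G (fst e). w x j)"
      using j by (intro sum_mono_bin) auto
    also have "\<dots> \<le> 1" using assms ge(1) j by (simp add: packed_def)
    finally show "(\<Sum>x | x < n \<and> inbin e (h e) x. w x j) \<le> 1" .
  qed
  ultimately show ?thesis using mN by blast
qed

text \<open>Edges are numbered as bins, and every item is sent to one edge that offers it. A bin
  then receives a subset of a feasible content, which is feasible since the weights are nonnegative;
  bins from \<open>L\<close> on stay empty.\<close>

theorem matching_imp_packed:
  assumes "card Lg \<le> 2 * L" "M \<in> pms {..<2 * L}" "h \<in> covering {..<card Sm} M"
    "\<forall>e\<in>M. feas e (h e)" "L \<le> l"
  shows "\<exists>f. packed f l"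
proof -
  have fM: "finite M" by (rule finite_in_pms[OF _ assms(2)]) simp
  have cM: "card M = L" using card_pms[OF assms(2)] by simp
  obtain \<beta> where "bij_betw \<beta> M {0..<card M}"
    using ex_bij_betw_finite_nat[OF fM] by (rule exE)
  then have \<beta>: "bij_betw \<beta> M {..<L}" by (simp only: cM atLeast0LessThan)
  have \<beta>L: "\<beta> e < L" if "e \<in> M" for e using bij_betwE[OF \<beta>] that by auto
  have ex: "\<exists>e. e \<in> M \<and> inbin e (h e) x" if x: "x < n" for x
  proof (cases "x \<in> Sm")
    case True
    then have "rk x \<in> {..<card Sm}" using bij_rk_Sm by (auto dest: bij_betwE)
    also have "\<dots> = \<Union> (h ` M)" using assms(3) by (simp add: covering_def)
    finally show ?thesis using True by (auto simp: inbin_def)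
  next
    case False
    then have "x \<in> Lg" using x by (simp add: Lg_def)
    then have "rk x < card Lg" using bij_rk_Lg by (auto dest: bij_betwE)
    then have "rk x \<in> {..<2 * L}" using assms(1) by simp
    then have "\<exists>!e. e \<in> M \<and> (rk x = fst e \<or> rk x = snd e)" using assms(2) by (simp add: pms_def)
    then obtain e where "e \<in> M" "rk x = fst e \<or> rk x = snd e" by (elim ex1E conjE) (rule that)
    then show ?thesis using False by (intro exI[of _ e]) (simp add: inbin_def)
  qed
  define \<epsilon> where "\<epsilon> x = (SOME e. e \<in> M \<and> inbin e (h e) x)" for x
  have \<epsilon>: "\<epsilon> x \<in> M" "inbin (\<epsilon> x) (h (\<epsilon> x)) x" if "x < n" for x
    unfolding \<epsilon>_def using someI_ex[OF ex[OF that]] by (rule conjunct1, rule conjunct2)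
  have "packed (\<beta> \<circ> \<epsilon>) l"
    unfolding packed_def
  proof (intro conjI allI impI)
    fix x assume "x < n"
    then show "(\<beta> \<circ> \<epsilon>) x < l" using \<beta>L[OF \<epsilon>(1)[of x]] assms(5) by simp
  next
    fix i j assume i: "i < l" and j: "j < d"
    show "(\<Sum>x | x < n \<and> (\<beta> \<circ> \<epsilon>) x = i. w x j) \<le> 1"
    proof (cases "i < L")
      case True
      then have "i \<in> \<beta> ` M" using bij_betw_imp_surj_on[OF \<beta>] by simp
      then obtain e where e: "e \<in> M" "\<beta> e = i" by blast
      have "{x. x < n \<and> (\<beta> \<circ> \<epsilon>) x = i} \<subseteq> {x. x < n \<and> inbin e (h e) x}"
      proof clarify
        fix x assume x: "x < n" "i = (\<beta> \<circ> \<epsilon>) x"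
        then have "\<beta> (\<epsilon> x) = \<beta> e" using e by simp
        then have "\<epsilon> x = e" by (rule inj_onD[OF bij_betw_imp_inj_on[OF \<beta>]]) (use e \<epsilon>(1)[OF x(1)] in auto)
        then show "inbin e (h e) x" using \<epsilon>(2)[OF x(1)] by simp
      qed
      then have "(\<Sum>x | x < n \<and> (\<beta> \<circ> \<epsilon>) x = i. w x j) \<le> (\<Sum>x | x < n \<and> inbin e (h e) x. w x j)"
        using j by (intro sum_mono_bin) auto
      also have "\<dots> \<le> 1" using assms(4) e j by (simp add: feas_def)
      finally show ?thesis .
    next
      case False
      have e: "{x. x < n \<and> (\<beta> \<circ> \<epsilon>) x = i} = {}"
      proof (rule equals0I)
        fix x assume "x \<in> {x. x < n \<and> (\<beta> \<circ> \<epsilon>) x = i}"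
        then show False using \<beta>L[OF \<epsilon>(1)[of x]] False by simp
      qed
      show ?thesis unfolding e by simp
    qed
  qed
  then show ?thesis by blast
qed

theorem packed_iff_matching:
  "(\<exists>f. packed f l) \<longleftrightarrow> card Lg \<le> 2 * min l n \<and>
    (\<exists>M\<in>pms {..<2 * min l n}. \<exists>h\<in>covering {..<card Sm} M. \<forall>e\<in>M. feas e (h e))"
  proof
  assume "\<exists>f. packed f l"
  then obtain f where "packed f (min l n)" using packed_min by blast
  then show "card Lg \<le> 2 * min l n \<and>
    (\<exists>M\<in>pms {..<2 * min l n}. \<exists>h\<in>covering {..<card Sm} M. \<forall>e\<in>M. feas e (h e))"
    by (rule packed_imp_matching)
next
  assume "card Lg \<le> 2 * min l n \<and>
    (\<exists>M\<in>pms {..<2 * min l n}. \<exists>h\<in>covering {..<card Sm} M. \<forall>e\<in>M. feas e (h e))"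
  then obtain M h where "card Lg \<le> 2 * min l n" "M \<in> pms {..<2 * min l n}"
    "h \<in> covering {..<card Sm} M" "\<forall>e\<in>M. feas e (h e)" by blast
  then show "\<exists>f. packed f l" by (rule matching_imp_packed) simp
qed

end

subsection \<open>The program: preparation\<close>

abbreviation (input) "vL \<equiv> 2::nat"
abbreviation (input) "vi \<equiv> 3::nat"
abbreviation (input) "vn \<equiv> 4::nat"
abbreviation (input) "vd \<equiv> 5::nat"
abbreviation (input) "vl \<equiv> 6::nat"
abbreviation (input) "vN \<equiv> 7::nat"
abbreviation (input) "vQ0 \<equiv> 8::nat"
abbreviation (input) "vQ \<equiv> 9::nat"
abbreviation (input) "vks \<equiv> 10::nat"
abbreviation (input) "vm \<equiv> 11::nat"
abbreviation (input) "vrk \<equiv> 12::nat"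
abbreviation (input) "vP2 \<equiv> 13::nat"
abbreviation (input) "vK2 \<equiv> 14::nat"
abbreviation (input) "vX \<equiv> 15::nat"
abbreviation (input) "vT \<equiv> 16::nat"
abbreviation (input) "vq \<equiv> 17::nat"
abbreviation (input) "vr \<equiv> 18::nat"
abbreviation (input) "vqq \<equiv> 19::nat"
abbreviation (input) "vMk \<equiv> 20::nat"
abbreviation (input) "vc \<equiv> 21::nat"
abbreviation (input) "va \<equiv> 22::nat"
abbreviation (input) "vb \<equiv> 23::nat"
abbreviation (input) "vt \<equiv> 24::nat"
abbreviation (input) "vt11 \<equiv> 25::nat"
abbreviation (input) "vhi \<equiv> 26::nat"
abbreviation (input) "vNT \<equiv> 27::nat"

abbreviation (input) "Vr a \<equiv> Arr a (Cst 0)"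
abbreviation (input) "setv a e \<equiv> Store a (Cst 0) e"
abbreviation (input) plus_ex (infixl "+!" 65) where "e +! e' \<equiv> Bin Add e e'"
abbreviation (input) minus_ex (infixl "-!" 65) where "e -! e' \<equiv> Bin Sub e e'"
abbreviation (input) times_ex (infixl "*!" 70) where "e *! e' \<equiv> Bin Mul e e'"
abbreviation (input) div_ex (infixl "div!" 70) where "e div! e' \<equiv> Bin Div e e'"
abbreviation (input) mod_ex (infixl "mod!" 70) where "e mod! e' \<equiv> Bin Mod e e'"
abbreviation (input) "capm e \<equiv> e mod! Vr vcap"
abbreviation (input) "XT e e' \<equiv> Arr vX (e *! Vr vQ +! e')"
abbreviation (input) "MT e e' \<equiv> Arr vT (e *! Vr vQ +! e')"

lemma For_rule':
  assumes "a \<notin> writes p" "\<sigma> b 0 = n" "I 0 (upd \<sigma> a 0 0)"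
    and "\<And>i \<tau>. i < n \<Longrightarrow> \<tau> a 0 = i \<Longrightarrow> (\<And>x. x \<notin> insert a (writes p) \<Longrightarrow> \<tau> x = \<sigma> x) \<Longrightarrow>
      I i \<tau> \<Longrightarrow> I (Suc i) (upd (run p \<tau>) a 0 (Suc i))"
  shows "I n (run (For a b p) \<sigma>)"
  using For_rule[of a p I \<sigma> b, OF assms(1,3)] assms(2,4) by simp

lemma pair_index_eq:
  "b < Q \<Longrightarrow> b' < Q \<Longrightarrow> a * Q + b = a' * Q + b' \<longleftrightarrow> a = a' \<and> b = (b'::nat)"
proof
  assume *: "b < Q" "b' < Q" "a * Q + b = a' * Q + b'"
  have "(a * Q + b) div Q = a" "(a' * Q + b') div Q = a'" using *(1,2) by auto
  then have "a = a'" using *(3) by metis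
  then show "a = a' \<and> b = b'" using *(3) by simp
qed auto

lemma prod_subset_le:
  fixes f :: "'a \<Rightarrow> nat"
  assumes "finite B" "A \<subseteq> B" "\<And>b. b \<in> B \<Longrightarrow> 0 < f b"
  shows "prod f A \<le> prod f B"
proof -
  have "0 < prod f (B - A)" using assms by (intro prod_pos) auto
  then have "1 * prod f A \<le> prod f (B - A) * prod f A" by (intro mult_le_mono1) simp
  also have "\<dots> = prod f B" by (rule prod.subset_diff[OF assms(2,1), symmetric])
  finally show ?thesis by simp
qed

text \<open>The product of all input numbers, each raised by 2, has a bit length linear in the input
  size, yet dominates any product of inputs at distinct positions. The 2 makes every factor at least
  2, so that \<open>2 ^ n\<close> is dominated too.\<close>

definition pCapLoop :: prog where
  "pCapLoop = For vi vL (setv vcap (Vr vcap *! (Inp (Vr vi +! Cst 1) +! Cst 2)))"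

definition pSquare :: prog where "pSquare = setv vcap (Vr vcap *! Vr vcap)"

text \<open>Six squarings raise the product to the power \<open>2 ^ 6 = 64\<close>, which leaves
  room for the later values; the correctness proof estimates these by powers of the product up to
  the fifth.\<close>

definition pCap :: prog where
  "pCap = pCapLoop ;; pSquare ;; pSquare ;; pSquare ;; pSquare ;; pSquare ;; pSquare"

text \<open>\<open>vQ0\<close> is the size demanded of the field: more than three times the degree,
  and at least 2. A step of the tower squares the size, so the first level of size at least
  \<open>vQ0\<close> has at most \<open>vQ0\<close> squared elements; that number,
  \<open>vQ\<close>, is the row length of all field tables.\<close>

definition pSizes :: prog where
  "pSizes = setv vn (Inp (Cst 1)) ;; setv vd (Inp (Cst 2)) ;;
     Cond (Vr vn) Nop (setv vd (Cst 0)) ;; setv vl (Inp (Cst 3)) ;;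
     Cond (Vr vl -! Vr vn) (setv vl (Vr vn)) Nop ;;
     setv vN (capm (Vr vl +! Vr vl)) ;; setv vQ0 (capm (Cst 3 *! Vr vn +! Cst 2)) ;;
     setv vQ (capm (Vr vQ0 *! Vr vQ0))"

definition pRank :: prog where
  "pRank = setv vks (Cst 0) ;; setv vm (Cst 0) ;;
     For va vn (Cond (Inp (Cst 4 +! Vr va))
       (Store vrk (Vr va) (Vr vks) ;; setv vks (capm (Vr vks +! Cst 1)))
       (Store vrk (Vr va) (Vr vm) ;; setv vm (capm (Vr vm +! Cst 1))))"

definition pPow :: prog where
  "pPow = setv vK2 (Cst 1) ;;
     For va vn (Cond (Vr vks -! Vr va)
       (Store vP2 (Vr va) (Vr vK2) ;; setv vK2 (capm (Vr vK2 +! Vr vK2))) Nop)"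

text \<open>Exclusive or is no machine operation, so a table is filled in lexicographic order by
  recursion on the halves. Only the entry at \<open>(0, 0)\<close> reads itself, which is right
  because arrays start with zeros.\<close>

definition pXor :: prog where
  "pXor = For va vQ (For vb vQ (Store vX (Vr va *! Vr vQ +! Vr vb)
     (capm (Cst 2 *! XT (Vr va div! Cst 2) (Vr vb div! Cst 2) +! (Vr va +! Vr vb) mod! Cst 2))))"

text \<open>The values \<open>x^2 + x\<close> are marked; the last unmarked element of the current
  field, that is the largest one, stays in \<open>vc\<close>.\<close>

definition pMark :: prog where
  "pMark = For va vQ (Store vMk (Vr va) (Cst 0)) ;;
     For va vQ (Cond (Vr vq -! Vr va) (Store vMk (XT (MT (Vr va) (Vr va)) (Vr va)) (Cst 1)) Nop) ;;
     For va vQ (Cond (Vr vq -! Vr va) (Cond (Arr vMk (Vr va)) Nop (setv vc (Vr va))) Nop)"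

text \<open>The multiplication table grows in place. All reads concern pairs of the old field, and
  such entries are overwritten only by equal values because the levels are nested.\<close>

definition pExt :: prog where
  "pExt = For va vQ (For vb vQ (Cond (Vr vqq -! Vr va) (Cond (Vr vqq -! Vr vb)
     (setv vt11 (MT (Vr va div! Vr vq) (Vr vb div! Vr vq)) ;;
      setv vhi (XT (Vr vt11) (XT (MT (Vr va div! Vr vq) (Vr vb mod! Vr vq)) (MT (Vr va mod! Vr vq) (Vr vb div! Vr vq)))) ;;
      Store vT (Vr va *! Vr vQ +! Vr vb)
        (capm (Vr vhi *! Vr vq +! XT (MT (Vr va mod! Vr vq) (Vr vb mod! Vr vq)) (MT (Vr vc) (Vr vt11))))) Nop) Nop))"

definition pTower :: prog where
  "pTower = Cond (Vr vQ0 -! Vr vq)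
     (setv vqq (capm (Vr vq *! Vr vq)) ;; pMark ;; pExt ;; setv vq (Vr vqq) ;; setv vr (capm (Vr vr +! Vr vr))) Nop"

text \<open>The table of the two-element field has one nonzero entry, the product
  \<open>1 * 1\<close> at index \<open>vQ + 1\<close>. The loop of \<open>vQ\<close> rounds is
  generous: once the size reaches \<open>vQ0\<close>, further rounds do nothing.\<close>

definition pField :: prog where
  "pField = setv vq (Cst 2) ;; setv vr (Cst 1) ;; Store vT (Vr vQ +! Cst 1) (Cst 1) ;; For vt vQ pTower"

definition pTables :: prog where
  "pTables = pRank ;; pPow ;; pXor ;; pField ;; setv vNT (capm (Vr vN *! Vr vN *! Vr vK2 *! Vr vr))"

lemma writes_preparation [simp]:
  "writes pCapLoop = {vi, vcap}" "writes pSquare = {vcap}" "writes pCap = {vi, vcap}"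
  "writes pSizes = {vn, vd, vl, vN, vQ0, vQ}" "writes pRank = {vks, vm, va, vrk}"
  "writes pPow = {vK2, va, vP2}" "writes pXor = {va, vb, vX}" "writes pMark = {va, vMk, vc}"
  "writes pExt = {va, vb, vt11, vhi, vT}" "writes pTower = {vqq, va, vMk, vc, vb, vt11, vhi, vT, vq, vr}"
  "writes pField = {vq, vr, vT, vt, vqq, va, vMk, vc, vb, vt11, vhi}"
  by (auto simp: pCapLoop_def pSquare_def pCap_def pSizes_def pRank_def pPow_def pXor_def pMark_def
      pExt_def pTower_def pField_def)

section \<open>Arithmetic behind the tables, and positions in the encoded input\<close>

lemma xor_rec: "xor a b = 2 * xor (a div 2) (b div 2) + (a + b) mod (2::nat)"
proof -
  have "xor a b = of_bool (odd a \<noteq> odd b) + 2 * xor (a div 2) (b div 2)" by (rule xor_rec)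
  moreover have "of_bool (odd a \<noteq> odd b) = (a + b) mod 2" by (auto simp: mod2_eq_if)
  ultimately show ?thesis by simp
qed

lemma xor_le_add: "xor a b \<le> a + (b::nat)"
proof (induction a arbitrary: b rule: less_induct)
  case (less a)
  show ?case
  proof (cases "a = 0")
    case False
    then have "xor (a div 2) (b div 2) \<le> a div 2 + b div 2" by (intro less) simp
    then show ?thesis unfolding xor_rec[of a b] by presburger
  qed simp
qed

lemma nmul_01: "a < 2 \<Longrightarrow> b < 2 \<Longrightarrow> nmul a b = a * b"
  using nmul_eq[of a 0 b] by (simp add: fsz_0)

lemma nonsq_nmul: "nonsq (fsz j) (fmul j) = nonsq (fsz j) nmul"
  unfolding nonsq_def by (intro arg_cong[of _ _ Max] Collect_cong) (auto simp: nmul_eq)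

lemma nmul_less: "a < fsz j \<Longrightarrow> b < fsz j \<Longrightarrow> nmul a b < fsz j"
  using field2.mcl[OF field2_nmul] .

lemma nmul_step:
  assumes "a < fsz j * fsz j" "b < fsz j * fsz j"
  shows "nmul a b = qmul (fsz j) nmul (nonsq (fsz j) nmul) a b"
proof -
  have d: "a div fsz j < fsz j" "a mod fsz j < fsz j" "b div fsz j < fsz j" "b mod fsz j < fsz j"
    using split_div_mod assms by auto
  have c: "nonsq (fsz j) nmul < fsz j" by (rule field2.nonsq(1)[OF field2_nmul])
  have "nmul a b = fmul (Suc j) a b" using assms by (intro nmul_eq) (simp_all add: fsz_Suc)
  then show ?thesis
    using d c by (simp add: nonsq_nmul qmul_def Let_def nmul_eq[of _ j, symmetric] nmul_less)
qed

lemma concat_encode_length: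
  "\<forall>v\<in>set V. length v = e \<Longrightarrow>
    length (concat (map (\<lambda>v. concat (map encode_rat v)) V)) = 2 * (length V * e)"
proof (induction V)
  case (Cons v V)
  have "length (concat (map encode_rat u)) = 2 * length u" for u
    by (induction u) (auto simp: encode_rat_def split: prod.splits)
  then show ?case using Cons by (simp del: length_concat map_concat)
qed simp

lemma concat_encode_nth:
  assumes "\<forall>v\<in>set V. length v = e" "x < length V" "j < e"
  shows "concat (map (\<lambda>v. concat (map encode_rat v)) V) ! (2 * (x * e + j)) = nat (fst (quotient_of (V ! x ! j)))"
    "concat (map (\<lambda>v. concat (map encode_rat v)) V) ! Suc (2 * (x * e + j)) = nat (snd (quotient_of (V ! x ! j)))"
proof -
  have er: "encode_rat z = [nat (fst (quotient_of z)), nat (snd (quotient_of z))]" for z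
    by (simp add: encode_rat_def split: prod.splits)
  have l1: "length (concat (map encode_rat v)) = 2 * length v" for v
    by (induction v) (auto simp: er)
  have n1: "concat (map encode_rat v) ! (2 * j) = nat (fst (quotient_of (v ! j)))"
    "concat (map encode_rat v) ! Suc (2 * j) = nat (snd (quotient_of (v ! j)))" if "j < length v" for v j
    using that by (induction v arbitrary: j) (auto simp: er nth_Cons less_Suc_eq_0_disj split: nat.splits)
  have idx: "2 * (Suc x * e + j) = 2 * e + 2 * (x * e + j)" for x by simp
  show "concat (map (\<lambda>v. concat (map encode_rat v)) V) ! (2 * (x * e + j)) = nat (fst (quotient_of (V ! x ! j)))"
    using assms
  proof (induction V arbitrary: x)
    case (Cons v V)
    then show ?case by (cases x) (simp_all only: idx, simp_all add: nth_append l1 n1)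
  qed simp
  show "concat (map (\<lambda>v. concat (map encode_rat v)) V) ! Suc (2 * (x * e + j)) = nat (snd (quotient_of (V ! x ! j)))"
    using assms
  proof (induction V arbitrary: x)
    case (Cons v V)
    then show ?case by (cases x) (simp_all only: idx, simp_all add: nth_append l1 n1)
  qed simp
qed


section \<open>Correctness of the preparation: cap, sizes, ranks, powers of two and exclusive
  or\<close>

locale vbp_run =
  fixes I :: vbp_instance
  assumes I: "vbp_few_small I"
begin

definition n :: nat where "n = length (items I)"

text \<open>Without items, the dimension may be exponential in the size of the input.\<close>

definition d :: nat where "d = (if n = 0 then 0 else vdim I)"
definition w :: "nat \<Rightarrow> nat \<Rightarrow> rat" where "w x j = items I ! x ! j"
definition xs :: "nat list" where "xs = encode_vbp I"
definition \<iota> :: "nat \<Rightarrow> nat" where "\<iota> = init_mem xs"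
definition pn :: "nat \<Rightarrow> nat \<Rightarrow> nat" where "pn x j = nat (fst (quotient_of (w x j)))"
definition qn :: "nat \<Rightarrow> nat \<Rightarrow> nat" where "qn x j = nat (snd (quotient_of (w x j)))"
definition C0 :: nat where "C0 = (\<Prod>t<length xs. \<iota> (Suc t) + 2)"
definition CAP :: nat where "CAP = C0 ^ 64"
definition L :: nat where "L = min (nbins I) n"
definition N :: nat where "N = 2 * L"
definition Q0 :: nat where "Q0 = 3 * n + 2"
definition Q :: nat where "Q = Q0 * Q0"

lemma small_sub: "small I \<subseteq> {..<n}"
  and len_item: "x < n \<Longrightarrow> length (items I ! x) = d"
  using I by (auto simp: vbp_few_small_def n_def d_def)

lemma items_len: "\<forall>v\<in>set (items I). length v = d"
  using len_item by (auto simp: in_set_conv_nth n_def)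

lemma w_nonneg: "x < n \<Longrightarrow> j < d \<Longrightarrow> 0 \<le> w x j"
proof -
  assume "x < n" "j < d"
  then have "items I ! x \<in> set (items I)" "items I ! x ! j \<in> set (items I ! x)"
    using len_item by (auto simp: n_def)
  then show ?thesis using I by (auto simp: vbp_few_small_def w_def)
qed

sublocale packing n d "nbins I" w "small I"
proof
  fix x y z
  assume "x < n" "y < n" "z < n" "x \<notin> small I" "y \<notin> small I" "z \<notin> small I" "x \<noteq> y" "x \<noteq> z" "y \<noteq> z"
  moreover from this have "d = vdim I" by (simp add: d_def)
  ultimately show "\<exists>j<d. w x j + w y j + w z j > 1"
    using I unfolding vbp_few_small_def three_incompatible_def n_def w_def by simp
qed (use small_sub w_nonneg in auto)

definition k :: nat where "k = card (small I)"

lemma k_le_n: "k \<le> n"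
  using card_mono[OF _ small_sub] by (simp add: k_def)


lemma length_xs: "length xs = 3 + n + 2 * (n * d)"
proof -
  have "length (concat (map (\<lambda>v. concat (map encode_rat v)) (items I))) = 2 * (n * d)"
    unfolding n_def by (rule concat_encode_length[OF items_len])
  then show ?thesis by (simp add: xs_def encode_vbp_def n_def)
qed

lemma \<iota>_nth: "i < length xs \<Longrightarrow> \<iota> (Suc i) = xs ! i"
  by (simp add: \<iota>_def init_mem_def)

lemma \<iota>_simps [simp]: "\<iota> 0 = length xs" "\<iota> (Suc 0) = n" "\<iota> 2 = vdim I" "\<iota> 3 = nbins I"
proof -
  show "\<iota> 0 = length xs" by (simp add: \<iota>_def init_mem_def)
  show "\<iota> (Suc 0) = n" using \<iota>_nth[of 0] length_xs by (simp add: xs_def encode_vbp_def n_def)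
  have "xs ! Suc 0 = vdim I" "xs ! 2 = nbins I" by (simp_all add: xs_def encode_vbp_def)
  then show "\<iota> 2 = vdim I" "\<iota> 3 = nbins I" by (simp_all add: \<iota>_def init_mem_def length_xs)
qed

lemma \<iota>_flag [simp]: "y < n \<Longrightarrow> \<iota> (4 + y) = of_bool (y \<in> small I)"
proof -
  assume y: "y < n"
  have "xs ! (3 + y) = of_bool (y \<in> small I)"
    using y by (simp add: xs_def encode_vbp_def nth_append n_def)
  then show ?thesis using \<iota>_nth[of "3 + y"] y length_xs by simp
qed

lemma data_index: "y < n \<Longrightarrow> j < d \<Longrightarrow> Suc (4 + n + 2 * (y * d + j)) \<le> length xs"
  using pair_less_prod[of y n j d] by (simp add: length_xs)

lemma \<iota>_data:
  assumes y: "y < n" "j < d"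
  shows "\<iota> (4 + n + 2 * (y * d + j)) = pn y j" "\<iota> (Suc (4 + n + 2 * (y * d + j))) = qn y j"
proof -
  have all: "\<forall>v\<in>set (items I). length v = d" "y < length (items I)"
    using items_len y by (simp_all add: n_def)
  note c = concat_encode_nth[OF all y(2)]
  have nth: "xs ! (3 + n + z) = concat (map (\<lambda>v. concat (map encode_rat v)) (items I)) ! z" for z
    by (simp add: xs_def encode_vbp_def nth_append n_def)
  have "xs ! (3 + n + 2 * (y * d + j)) = pn y j" "xs ! (3 + n + Suc (2 * (y * d + j))) = qn y j"
    unfolding nth c by (simp_all only: pn_def qn_def w_def)
  moreover have "\<iota> (Suc (3 + n + 2 * (y * d + j))) = xs ! (3 + n + 2 * (y * d + j))"
    "\<iota> (Suc (3 + n + Suc (2 * (y * d + j)))) = xs ! (3 + n + Suc (2 * (y * d + j)))"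
    using data_index[OF y] by (intro \<iota>_nth; simp)+
  ultimately show "\<iota> (4 + n + 2 * (y * d + j)) = pn y j" "\<iota> (Suc (4 + n + 2 * (y * d + j))) = qn y j"
    by (simp_all add: add.assoc)
qed

text \<open>The first input number is \<open>n\<close> and gives the factor \<open>n + 2\<close>.
  The input has at least \<open>n + 2\<close> further numbers, each with a factor of at least
  2.\<close>

lemma C0_bound: "(n + 2) * 2 ^ (n + 2) \<le> C0"
proof -
  have "(n + 2) * 2 ^ (n + 2) \<le> (n + 2) * 2 ^ (length xs - 1)"
    by (intro mult_le_mono2 power_increasing) (simp_all add: length_xs)
  also have "\<dots> = (\<Prod>t<length xs. if t = 0 then n + 2 else 2)"
  proof -
    have "{..<length xs} = insert 0 {1..<length xs}" using length_xs by auto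
    then show ?thesis by simp
  qed
  also have "\<dots> \<le> C0"
    unfolding C0_def by (intro prod_mono) auto
  finally show ?thesis .
qed

lemma C0_ge: "2 \<le> C0" "n + 2 \<le> C0" "3 * n + 2 \<le> C0" "2 ^ n \<le> C0" "length xs \<le> C0" "8 \<le> C0"
proof -
  have "1 \<le> (2::nat) ^ n" by simp
  then have "4 * (n + 2) * 1 \<le> 4 * (n + 2) * 2 ^ n" by (intro mult_le_mono2)
  then have "4 * (n + 2) \<le> (n + 2) * 2 ^ (n + 2)" by (simp add: power_add algebra_simps)
  with C0_bound have *: "4 * (n + 2) \<le> C0" by linarith
  then show "2 \<le> C0" "n + 2 \<le> C0" "3 * n + 2 \<le> C0" "8 \<le> C0" by auto
  have "1 * 2 ^ n \<le> (n + 2) * 2 ^ (n + 2)" by (intro mult_le_mono power_increasing) auto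
  with C0_bound show "2 ^ n \<le> C0" by linarith
  have "length xs \<le> 2 ^ length xs" by simp
  also have "\<dots> = (\<Prod>t<length xs. 2)" by simp
  also have "\<dots> \<le> C0" unfolding C0_def by (intro prod_mono) auto
  finally show "length xs \<le> C0" .
qed

lemma less_CAP: "x \<le> C0 ^ a \<Longrightarrow> a < 64 \<Longrightarrow> x < CAP"
  unfolding CAP_def using C0_ge(1) by (intro le_less_trans[OF _ power_strict_increasing]) auto

lemma CAP_ge: "64 \<le> CAP"
proof -
  have "8 * 8 \<le> C0 * C0" using C0_ge(6) by (intro mult_le_mono)
  then have "64 \<le> C0 ^ 2" by (simp add: power2_eq_square)
  then show ?thesis using less_CAP[of 64 2] by simp
qed

lemma le_C0_mult: "x \<le> C0 ^ a \<Longrightarrow> y \<le> C0 ^ b \<Longrightarrow> x * y \<le> C0 ^ (a + b)"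
  by (simp add: power_add mult_le_mono)

lemma L_le: "L \<le> n" by (simp add: L_def)

lemma size_bounds: "N < CAP" "Q0 < CAP" "Q < CAP" "Q0 \<le> C0" "N \<le> C0" "Q \<le> C0 ^ 2" "2 \<le> Q0" "Q0 \<le> Q" "n \<le> Q"
proof -
  show q0: "Q0 \<le> C0" using C0_ge(3) by (simp add: Q0_def)
  show nn: "N \<le> C0" using C0_ge(3) L_le by (simp add: N_def)
  show q: "Q \<le> C0 ^ 2" using q0 by (simp add: Q_def power2_eq_square mult_le_mono)
  show "N < CAP" "Q0 < CAP" "Q < CAP"
    using less_CAP[of _ 1] less_CAP[of Q 2] q0 nn q by simp_all
  show "2 \<le> Q0" by (simp add: Q0_def)
  then have "Q0 * 1 \<le> Q" unfolding Q_def by (intro mult_le_mono2) simp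
  then show "Q0 \<le> Q" by simp
  then show "n \<le> Q" by (simp add: Q0_def)
qed

definition base :: "st \<Rightarrow> bool" where "base \<sigma> \<longleftrightarrow> \<sigma> 0 = \<iota> \<and> \<sigma> vcap 0 = CAP"

lemma baseD: "base \<sigma> \<Longrightarrow> \<sigma> 0 = \<iota>" "base \<sigma> \<Longrightarrow> \<sigma> vcap 0 = CAP"
  by (simp_all add: base_def)

lemma cap_loop_iter:
  assumes "\<sigma> 0 = \<iota>" "\<sigma> vL 0 = length xs" "\<sigma> vcap 0 = 1" "i \<le> length xs"
  shows "(((\<lambda>\<tau>. bump vi (run (setv vcap (Vr vcap *! (Inp (Vr vi +! Cst 1) +! Cst 2))) \<tau>)) ^^ i) (upd \<sigma> vi 0 0)) vcap 0
    = (\<Prod>t<i. \<iota> (Suc t) + 2)"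
proof (rule For_iter_rule[where n = "length xs" and I = "\<lambda>i \<tau>. \<tau> vcap 0 = (\<Prod>t<i. \<iota> (Suc t) + 2)"])
  fix i \<tau> assume i: "i < length xs" "\<tau> vi 0 = i" and I: "\<tau> vcap 0 = (\<Prod>t<i. \<iota> (Suc t) + 2)"
    and fr: "\<And>x. x \<notin> insert vi (writes (setv vcap (Vr vcap *! (Inp (Vr vi +! Cst 1) +! Cst 2)))) \<Longrightarrow> \<tau> x = \<sigma> x"
  have "\<tau> 0 = \<iota>" using fr[of 0] assms(1) by simp
  moreover have "min (Suc i) (length xs) = Suc i" using i by simp
  ultimately show "upd (run (setv vcap (Vr vcap *! (Inp (Vr vi +! Cst 1) +! Cst 2))) \<tau>) vi 0 (Suc i) vcap 0 =
      (\<Prod>t<Suc i. \<iota> (Suc t) + 2)"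
    using i I by (simp del: \<iota>_simps(2-4) mult_Suc_right)
qed (use assms in simp_all)

text \<open>The cap is built up in its own cell, where the generic value bound does not apply.
  \<open>ok\<close> is shown directly: all intermediate values are partial products of
  \<open>C0\<close> or its powers up to the 64th.\<close>

lemma run_cap:
  assumes "\<sigma> 0 = \<iota>" "\<sigma> vL 0 = length xs" "\<sigma> vcap 0 = 1"
  shows "run pCap \<sigma> vcap 0 = CAP" "ok (Suc CAP) pCap \<sigma>"
proof -
  let ?b = "setv vcap (Vr vcap *! (Inp (Vr vi +! Cst 1) +! Cst 2))"
  let ?f = "\<lambda>i. ((\<lambda>\<tau>. bump vi (run ?b \<tau>)) ^^ i) (upd \<sigma> vi 0 0)"
  have it: "?f i vcap 0 = (\<Prod>t<i. \<iota> (Suc t) + 2)" if "i \<le> length xs" for i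
    using cap_loop_iter[OF assms that] .
  have loop: "run pCapLoop \<sigma> vcap 0 = C0"
    using it[of "length xs"] assms unfolding pCapLoop_def by (simp add: C0_def)
  have sq: "run pSquare \<tau> vcap 0 = (\<tau> vcap 0)\<^sup>2" for \<tau>
    by (simp add: pSquare_def power2_eq_square)
  show "run pCap \<sigma> vcap 0 = CAP"
    by (simp add: pCap_def sq loop CAP_def power_mult[symmetric])
  have le: "C0 ^ a \<le> CAP" if "a \<le> 64" for a
    unfolding CAP_def using C0_ge(1) that by (intro power_increasing) auto
  have "ok (Suc CAP) ?b (?f i)" if i: "i < length xs" for i
  proof -
    have fr: "?f i 0 = \<iota>" using assms(1) by (subst For_frame) auto
    have c: "?f i vi 0 = i" by (rule For_counter) simp
    have "eval (Vr vcap *! (Inp (Vr vi +! Cst 1) +! Cst 2)) (?f i) = (\<Prod>t<Suc i. \<iota> (Suc t) + 2)"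
      using i it[of i] fr c by simp
    also have "\<dots> \<le> C0" unfolding C0_def using i by (intro prod_subset_le) auto
    also have "\<dots> \<le> CAP" using le[of 1] by simp
    finally show ?thesis by simp
  qed
  then have "ok (Suc CAP) pCapLoop \<sigma>" using assms(2) by (simp add: pCapLoop_def)
  moreover have oksq: "ok (Suc CAP) pSquare \<tau> \<longleftrightarrow> (\<tau> vcap 0)\<^sup>2 \<le> CAP" for \<tau>
    by (simp add: pSquare_def less_Suc_eq_le power2_eq_square)
  ultimately show "ok (Suc CAP) pCap \<sigma>"
    using le by (simp add: pCap_def sq loop oksq power_mult[symmetric])
qed

lemma run_sizes:
  assumes "base \<sigma>"
  shows "run pSizes \<sigma> vn 0 = n" "run pSizes \<sigma> vd 0 = d" "run pSizes \<sigma> vN 0 = N"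
    "run pSizes \<sigma> vQ0 0 = Q0" "run pSizes \<sigma> vQ 0 = Q"
proof -
  have m: "min (Suc 0) (length xs) = Suc 0" "min 2 (length xs) = 2" "min 3 (length xs) = 3"
    by (simp_all add: length_xs)
  have "(L + L) mod CAP = N" using size_bounds(1) unfolding mult_2[symmetric] N_def[symmetric] by (rule mod_less)
  moreover have "(3 * n + 2) mod CAP = Q0" using size_bounds(2) unfolding Q0_def[symmetric] by (rule mod_less)
  moreover have "(Q0 * Q0) mod CAP = Q" using size_bounds(3) unfolding Q_def[symmetric] by (rule mod_less)
  ultimately have b: "(L + L) mod CAP = N" "Suc (Suc (3 * n)) mod CAP = Q0" "(Q0 * Q0) mod CAP = Q" by simp_all
  show "run pSizes \<sigma> vn 0 = n" "run pSizes \<sigma> vd 0 = d" "run pSizes \<sigma> vN 0 = N"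
    "run pSizes \<sigma> vQ0 0 = Q0" "run pSizes \<sigma> vQ 0 = Q"
    using baseD[OF assms] b by (cases "nbins I \<le> n"; cases "n = 0"; simp add: pSizes_def m L_def d_def)+
qed


definition cs :: "nat \<Rightarrow> nat" where "cs i = card {y. y < i \<and> y \<in> small I}"
definition cl :: "nat \<Rightarrow> nat" where "cl i = card {y. y < i \<and> y < n \<and> y \<notin> small I}"

lemma counts:
  "cs 0 = 0" "cl 0 = 0" "i < n \<Longrightarrow> cs (Suc i) = (if i \<in> small I then Suc (cs i) else cs i)"
  "i < n \<Longrightarrow> cl (Suc i) = (if i \<in> small I then cl i else Suc (cl i))"
  "i < n \<Longrightarrow> rk i = (if i \<in> small I then cs i else cl i)" "cs n = k" "cl n = card Lg"
  "cs i \<le> i" "cl i \<le> i"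
proof -
  show "cs 0 = 0" "cl 0 = 0" by (simp_all add: cs_def cl_def)
  have "{y. y < Suc i \<and> y \<in> small I} = (if i \<in> small I then insert i {y. y < i \<and> y \<in> small I} else {y. y < i \<and> y \<in> small I})"
    by (auto simp: less_Suc_eq)
  then show "i < n \<Longrightarrow> cs (Suc i) = (if i \<in> small I then Suc (cs i) else cs i)" by (simp add: cs_def)
  have "i < n \<Longrightarrow> {y. y < Suc i \<and> y < n \<and> y \<notin> small I} = (if i \<in> small I then {y. y < i \<and> y < n \<and> y \<notin> small I}
      else insert i {y. y < i \<and> y < n \<and> y \<notin> small I})"
    by (auto simp: less_Suc_eq)
  then show "i < n \<Longrightarrow> cl (Suc i) = (if i \<in> small I then cl i else Suc (cl i))" by (simp add: cl_def)
  show "i < n \<Longrightarrow> rk i = (if i \<in> small I then cs i else cl i)"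
    using small_sub by (auto simp: rk_def cs_def cl_def intro!: arg_cong[of _ _ card])
  show "cs n = k" using small_sub by (auto simp: k_def cs_def intro!: arg_cong[of _ _ card])
  show "cl n = card Lg" by (auto simp: Lg_def cl_def intro!: arg_cong[of _ _ card])
  have "card {y. y < i \<and> P y} \<le> i" for P using card_mono[of "{..<i}" "{y. y < i \<and> P y}"] by auto
  then show "cs i \<le> i" "cl i \<le> i" by (auto simp: cs_def cl_def)
qed

lemma run_rank:
  assumes "base \<sigma>" "\<sigma> vn 0 = n"
  shows "\<forall>y<n. run pRank \<sigma> vrk y = rk y" "run pRank \<sigma> vks 0 = k" "run pRank \<sigma> vm 0 = card Lg"
proof -
  let ?I = "\<lambda>i \<tau>. (\<forall>y<i. \<tau> vrk y = rk y) \<and> \<tau> vks 0 = cs i \<and> \<tau> vm 0 = cl i"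
  have "?I n (run pRank \<sigma>)"
    unfolding pRank_def run.simps(3)
  proof (rule For_rule'[where I = ?I])
    fix i \<tau> assume i: "i < n" "\<tau> va 0 = i" and I: "?I i \<tau>"
      and fr: "\<And>x. x \<notin> insert va (writes (Cond (Inp (Cst 4 +! Vr va))
       (Store vrk (Vr va) (Vr vks) ;; setv vks (capm (Vr vks +! Cst 1)))
       (Store vrk (Vr va) (Vr vm) ;; setv vm (capm (Vr vm +! Cst 1))))) \<Longrightarrow>
         \<tau> x = run (setv vm (Cst 0)) (run (setv vks (Cst 0)) \<sigma>) x"
    have f: "\<tau> 0 = \<iota>" "\<tau> vcap 0 = CAP" using fr[of 0] fr[of vcap] baseD[OF assms(1)] by simp_all
    have m: "min (4 + i) (length xs) = 4 + i" using i length_xs by simp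
    have "Suc i < CAP" using i C0_ge(2) less_CAP[of "Suc i" 1] by simp
    then have c: "Suc (cs i) < CAP" "Suc (cl i) < CAP" using counts(8,9)[of i] by linarith+
    show "?I (Suc i) (upd (run (Cond (Inp (Cst 4 +! Vr va))
       (Store vrk (Vr va) (Vr vks) ;; setv vks (capm (Vr vks +! Cst 1)))
       (Store vrk (Vr va) (Vr vm) ;; setv vm (capm (Vr vm +! Cst 1)))) \<tau>) va 0 (Suc i))"
      using I i f c by (cases "i \<in> small I") (simp_all add: m counts less_Suc_eq)
  qed (use assms counts in auto)
  then show "\<forall>y<n. run pRank \<sigma> vrk y = rk y" "run pRank \<sigma> vks 0 = k" "run pRank \<sigma> vm 0 = card Lg"
    by (simp_all add: counts)
qed

lemma run_pow:
  assumes "base \<sigma>" "\<sigma> vn 0 = n" "\<sigma> vks 0 = k"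
  shows "run pPow \<sigma> vK2 0 = 2 ^ k" "\<forall>y<k. run pPow \<sigma> vP2 y = 2 ^ y"
proof -
  let ?I = "\<lambda>i \<tau>. \<tau> vK2 0 = 2 ^ min i k \<and> (\<forall>y<min i k. \<tau> vP2 y = 2 ^ y)"
  let ?b = "Cond (Vr vks -! Vr va)
       (Store vP2 (Vr va) (Vr vK2) ;; setv vK2 (capm (Vr vK2 +! Vr vK2))) Nop"
  have "?I n (run pPow \<sigma>)"
    unfolding pPow_def run.simps(3)
  proof (rule For_rule'[where I = ?I])
    fix i \<tau> assume i: "i < n" "\<tau> va 0 = i" and I: "?I i \<tau>"
      and fr: "\<And>x. x \<notin> insert va (writes ?b) \<Longrightarrow> \<tau> x = run (setv vK2 (Cst 1)) \<sigma> x"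
    have f: "\<tau> vks 0 = k" "\<tau> vcap 0 = CAP" using fr[of vks] fr[of vcap] baseD[OF assms(1)] assms(3) by simp_all
    show "?I (Suc i) (upd (run ?b \<tau>) va 0 (Suc i))"
    proof (cases "i < k")
      case True
      have "(2::nat) ^ Suc i \<le> 2 ^ n" using i by (intro power_increasing) auto
      then have "2 ^ Suc i < CAP" using C0_ge(4) less_CAP[of "2 ^ Suc i" 1] by simp
      moreover have "min (Suc i) k = Suc i" "min i k = i" using True by auto
      ultimately show ?thesis using I i f True by (simp add: less_Suc_eq mult_2[symmetric])
    next
      case False
      then show ?thesis using I i f by (simp add: min_def)
    qed
  qed (use assms in auto)
  then show "run pPow \<sigma> vK2 0 = 2 ^ k" "\<forall>y<k. run pPow \<sigma> vP2 y = 2 ^ y"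
    using k_le_n by (simp_all add: min_def split: if_splits)
qed

definition xtab :: "st \<Rightarrow> bool" where "xtab \<sigma> \<longleftrightarrow> (\<forall>a<Q. \<forall>b<Q. \<sigma> vX (a * Q + b) = xor a b)"

lemma run_xor:
  assumes "base \<sigma>" "\<sigma> vQ 0 = Q" "\<sigma> vX 0 = 0"
  shows "xtab (run pXor \<sigma>)"
proof -
  let ?b = "Store vX (Vr va *! Vr vQ +! Vr vb)
     (capm (Cst 2 *! XT (Vr va div! Cst 2) (Vr vb div! Cst 2) +! (Vr va +! Vr vb) mod! Cst 2))"
  let ?I = "\<lambda>i \<tau>. (\<forall>a<i. \<forall>b<Q. \<tau> vX (a * Q + b) = xor a b) \<and> (i = 0 \<longrightarrow> \<tau> vX 0 = 0)"
  have "?I Q (run pXor \<sigma>)"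
    unfolding pXor_def
  proof (rule For_rule'[where I = ?I])
    fix i \<tau> assume i: "i < Q" "\<tau> va 0 = i" and I: "?I i \<tau>"
      and fr: "\<And>x. x \<notin> insert va (writes (For vb vQ ?b)) \<Longrightarrow> \<tau> x = \<sigma> x"
    let ?J = "\<lambda>j \<tau>. (\<forall>a<i. \<forall>b<Q. \<tau> vX (a * Q + b) = xor a b) \<and>
      (\<forall>b<j. \<tau> vX (i * Q + b) = xor i b) \<and> (i = 0 \<and> j = 0 \<longrightarrow> \<tau> vX 0 = 0)"
    have "?J Q (run (For vb vQ ?b) \<tau>)"
    proof (rule For_rule'[where I = ?J])
      fix j \<rho> assume j: "j < Q" "\<rho> vb 0 = j" and J: "?J j \<rho>"
        and fr2: "\<And>x. x \<notin> insert vb (writes ?b) \<Longrightarrow> \<rho> x = \<tau> x"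
      have f: "\<rho> va 0 = i" "\<rho> vQ 0 = Q" "\<rho> vcap 0 = CAP"
        using fr[of vQ] fr2[of vQ] fr[of vcap] fr2[of vcap] fr2[of va] assms(2) baseD[OF assms(1)] i by simp_all
      have rd: "\<rho> vX (i div 2 * Q + j div 2) = xor (i div 2) (j div 2)"
      proof (cases "i = 0")
        case True
        then show ?thesis using J by (cases "j = 0") auto
      next
        case False
        then have "i div 2 < i" "j div 2 < Q" using j by auto
        then show ?thesis using J by blast
      qed
      have "xor i j \<le> 2 * Q" using xor_le_add[of i j] i j by linarith
      also have "\<dots> \<le> C0 ^ (1 + 2)" using size_bounds(6) C0_ge(1) by (intro le_C0_mult) simp_all
      finally have "xor i j < CAP" by (rule less_CAP) simp
      then have "eval (capm (Cst 2 *! XT (Vr va div! Cst 2) (Vr vb div! Cst 2) +! (Vr va +! Vr vb) mod! Cst 2)) \<rho> = xor i j"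
        using f j rd xor_rec[of i j] by simp
      then have r: "run ?b \<rho> = upd \<rho> vX (i * Q + j) (xor i j)" using f j by simp
      show "?J (Suc j) (upd (run ?b \<rho>) vb 0 (Suc j))"
        unfolding r using J i j by (auto simp: pair_index_eq less_Suc_eq)
    qed (use I i fr[of vQ] assms(2) in auto)
    then show "?I (Suc i) (upd (run (For vb vQ ?b) \<tau>) va 0 (Suc i))"
      by (auto simp: less_Suc_eq simp del: run.simps)
  qed (use assms in auto)
  then show ?thesis by (simp add: xtab_def)
qed

end

section \<open>Correctness of the multiplication table and of the whole preparation\<close>

context vbp_run
begin

definition towok :: "nat \<Rightarrow> st \<Rightarrow> bool" where
  "towok j \<sigma> \<longleftrightarrow> \<sigma> vq 0 = fsz j \<and> \<sigma> vr 0 = 2 ^ j \<and>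
     (\<forall>a<fsz j. \<forall>b<fsz j. \<sigma> vT (a * Q + b) = nmul a b)"

definition config :: "st \<Rightarrow> bool" where
  "config \<sigma> \<longleftrightarrow> base \<sigma> \<and> \<sigma> vQ 0 = Q \<and> \<sigma> vQ0 0 = Q0 \<and> xtab \<sigma>"

lemma configD: "config \<sigma> \<Longrightarrow> \<sigma> 0 = \<iota>" "config \<sigma> \<Longrightarrow> \<sigma> vcap 0 = CAP" "config \<sigma> \<Longrightarrow> \<sigma> vQ 0 = Q"
  "config \<sigma> \<Longrightarrow> \<sigma> vQ0 0 = Q0" "config \<sigma> \<Longrightarrow> a < Q \<Longrightarrow> b < Q \<Longrightarrow> \<sigma> vX (a * Q + b) = xor a b"
  by (auto simp: config_def base_def xtab_def)

lemma config_cong: "config \<sigma> \<Longrightarrow> \<tau> 0 = \<sigma> 0 \<Longrightarrow> \<tau> vcap = \<sigma> vcap \<Longrightarrow> \<tau> vQ = \<sigma> vQ \<Longrightarrow>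
    \<tau> vQ0 = \<sigma> vQ0 \<Longrightarrow> \<tau> vX = \<sigma> vX \<Longrightarrow> config \<tau>"
  by (simp add: config_def base_def xtab_def)

lemma towok_cong: "towok j \<sigma> \<Longrightarrow> \<tau> vq = \<sigma> vq \<Longrightarrow> \<tau> vr = \<sigma> vr \<Longrightarrow> \<tau> vT = \<sigma> vT \<Longrightarrow> towok j \<tau>"
  by (simp add: towok_def)

lemma run_mark:
  assumes cf: "config \<sigma>" and tw: "towok j \<sigma>" and q: "fsz j \<le> Q"
  shows "run pMark \<sigma> vc 0 = nonsq (fsz j) nmul"
proof -
  let ?q = "fsz j"
  let ?h = "\<lambda>x. xor (nmul x x) x"
  let ?p1 = "For va vQ (Store vMk (Vr va) (Cst 0))"
  let ?b2 = "Cond (Vr vq -! Vr va) (Store vMk (XT (MT (Vr va) (Vr va)) (Vr va)) (Cst 1)) Nop"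
  let ?b3 = "Cond (Vr vq -! Vr va) (Cond (Arr vMk (Vr va)) Nop (setv vc (Vr va))) Nop"
  define \<sigma>1 where "\<sigma>1 = run ?p1 \<sigma>"
  define \<sigma>2 where "\<sigma>2 = run (For va vQ ?b2) \<sigma>1"
  have run: "run pMark \<sigma> = run (For va vQ ?b3) \<sigma>2"
    unfolding pMark_def \<sigma>1_def \<sigma>2_def by (simp only: run.simps(3))
  have f1: "\<sigma>1 x = \<sigma> x" if "x \<noteq> va" "x \<noteq> vMk" for x
    unfolding \<sigma>1_def by (rule run_frame) (use that in simp)
  have f2: "\<sigma>2 x = \<sigma> x" if "x \<noteq> va" "x \<noteq> vMk" for x
    unfolding \<sigma>2_def using f1[OF that] by (subst run_frame) (use that in simp_all)
  have clr: "\<forall>a<Q. \<sigma>1 vMk a = 0"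
    unfolding \<sigma>1_def
    by (rule For_rule'[where I = "\<lambda>i \<tau>. \<forall>a<i. \<tau> vMk a = 0"]) (use configD[OF cf] in \<open>simp_all add: less_Suc_eq\<close>)
  have hq: "?h x < ?q" if "x < ?q" for x using that by (intro xor_less nmul_less)
  let ?I2 = "\<lambda>i \<tau>. \<forall>c<Q. \<tau> vMk c = of_bool (\<exists>x<min i ?q. ?h x = c)"
  have mark: "?I2 Q \<sigma>2"
    unfolding \<sigma>2_def
  proof (rule For_rule'[where I = ?I2])
    fix i \<tau> assume i: "i < Q" "\<tau> va 0 = i" and I: "?I2 i \<tau>"
      and fr: "\<And>x. x \<notin> insert va (writes ?b2) \<Longrightarrow> \<tau> x = \<sigma>1 x"
    have f: "\<tau> vQ 0 = Q" "\<tau> vq 0 = ?q" "\<tau> vT = \<sigma> vT" "\<tau> vX = \<sigma> vX"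
      using fr[of vQ] fr[of vq] fr[of vT] fr[of vX] f1 configD[OF cf] tw by (simp_all add: towok_def)
    show "?I2 (Suc i) (upd (run ?b2 \<tau>) va 0 (Suc i))"
    proof (cases "i < ?q")
      case True
      have t: "\<tau> vT (i * Q + i) = nmul i i" using f(3) tw True by (simp add: towok_def)
      have "nmul i i < ?q" using True by (intro nmul_less)
      then have x: "\<tau> vX (nmul i i * Q + i) = ?h i" using f(4) configD(5)[OF cf] i q by simp
      have m: "min (Suc i) ?q = Suc i" "min i ?q = i" using True by auto
      have r: "run ?b2 \<tau> = upd \<tau> vMk (?h i) 1" using True f i t x by simp
      show ?thesis unfolding r m using I unfolding m by (simp add: less_Suc_eq) blast
    next
      case False
      then have "min (Suc i) ?q = ?q" "min i ?q = ?q" "run ?b2 \<tau> = \<tau>" using f i by auto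
      then show ?thesis using I by simp
    qed
  qed (use clr f1 configD[OF cf] in simp_all)
  let ?P = "\<lambda>c. \<forall>x<?q. ?h x \<noteq> c"
  have mk: "\<sigma>2 vMk c = 0 \<longleftrightarrow> ?P c" if "c < Q" for c
    using mark that q by (auto simp: min_def)
  let ?I3 = "\<lambda>i \<tau>. (\<exists>c<min i ?q. ?P c) \<longrightarrow> \<tau> vc 0 < min i ?q \<and> ?P (\<tau> vc 0) \<and> (\<forall>c<min i ?q. ?P c \<longrightarrow> c \<le> \<tau> vc 0)"
  have "?I3 Q (run (For va vQ ?b3) \<sigma>2)"
  proof (rule For_rule'[where I = ?I3])
    fix i \<tau> assume i: "i < Q" "\<tau> va 0 = i" and I: "?I3 i \<tau>"
      and fr: "\<And>x. x \<notin> insert va (writes ?b3) \<Longrightarrow> \<tau> x = \<sigma>2 x"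
    have f: "\<tau> vq 0 = ?q" "\<tau> vMk = \<sigma>2 vMk"
      using fr[of vq] fr[of vMk] f2 tw by (simp_all add: towok_def)
    show "?I3 (Suc i) (upd (run ?b3 \<tau>) va 0 (Suc i))"
    proof (cases "i < ?q")
      case True
      have m: "min (Suc i) ?q = Suc i" "min i ?q = i" using True by auto
      show ?thesis
      proof (cases "?P i")
        case True
        then have r: "run ?b3 \<tau> = upd \<tau> vc 0 i" using \<open>i < ?q\<close> f i mk[OF i(1)] by simp
        show ?thesis unfolding r m using True by simp
      next
        case False
        then have r: "run ?b3 \<tau> = \<tau>" using \<open>i < ?q\<close> f i mk[OF i(1)] by simp
        have "(\<exists>c<Suc i. ?P c) \<longleftrightarrow> (\<exists>c<i. ?P c)" using False less_Suc_eq by blast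
        moreover have "(\<forall>c<Suc i. ?P c \<longrightarrow> c \<le> z) \<longleftrightarrow> (\<forall>c<i. ?P c \<longrightarrow> c \<le> z)" for z
          using False less_Suc_eq by blast
        ultimately show ?thesis unfolding r m using I[unfolded m] by (simp del: not_less) (meson less_SucI)
      qed
    next
      case False
      then have "min (Suc i) ?q = ?q" "min i ?q = ?q" "run ?b3 \<tau> = \<tau>" using f i by auto
      then show ?thesis using I by simp
    qed
  qed (use f2 configD[OF cf] in simp_all)
  moreover have "min Q ?q = ?q" using q by simp
  ultimately have fin: "(\<exists>c<?q. ?P c) \<longrightarrow> run pMark \<sigma> vc 0 < ?q \<and> ?P (run pMark \<sigma> vc 0) \<and>
      (\<forall>c<?q. ?P c \<longrightarrow> c \<le> run pMark \<sigma> vc 0)" unfolding run by simp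
  have "\<exists>c<?q. ?P c" by (rule field2.nonsq_ex[OF field2_nmul])
  with fin show ?thesis
    unfolding nonsq_def by (intro Max_eqI[symmetric]) auto
qed

lemma run_ext:
  assumes cf: "config \<sigma>" and tw: "towok j \<sigma>" and q: "fsz j * fsz j \<le> Q"
    and qq: "\<sigma> vqq 0 = fsz j * fsz j" and c: "\<sigma> vc 0 = nonsq (fsz j) nmul"
  shows "\<forall>a<fsz j * fsz j. \<forall>b<fsz j * fsz j. run pExt \<sigma> vT (a * Q + b) = nmul a b"
proof -
  let ?q = "fsz j"
  let ?s1 = "setv vt11 (MT (Vr va div! Vr vq) (Vr vb div! Vr vq))"
  let ?s2 = "setv vhi (XT (Vr vt11) (XT (MT (Vr va div! Vr vq) (Vr vb mod! Vr vq)) (MT (Vr va mod! Vr vq) (Vr vb div! Vr vq))))"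
  let ?s3 = "Store vT (Vr va *! Vr vQ +! Vr vb)
        (capm (Vr vhi *! Vr vq +! XT (MT (Vr va mod! Vr vq) (Vr vb mod! Vr vq)) (MT (Vr vc) (Vr vt11))))"
  let ?b = "Cond (Vr vqq -! Vr va) (Cond (Vr vqq -! Vr vb) (?s1 ;; ?s2 ;; ?s3) Nop) Nop"
  \<comment> \<open>Besides the lexicographic progress, the invariant keeps the block of the old
    field correct, as it is read in every round and overwritten in some.\<close>
  let ?done = "\<lambda>i j \<tau>. \<forall>a<?q * ?q. \<forall>b<?q * ?q. a < i \<or> a = i \<and> b < j \<or> a < ?q \<and> b < ?q \<longrightarrow> \<tau> vT (a * Q + b) = nmul a b"
  have qQ: "?q \<le> Q" using q le_square[of ?q] by linarith
  have "?done Q 0 (run pExt \<sigma>)"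
    unfolding pExt_def
  proof (rule For_rule'[where I = "\<lambda>i. ?done i 0"])
    fix i \<tau> assume i: "i < Q" "\<tau> va 0 = i" and I: "?done i 0 \<tau>"
      and fr: "\<And>x. x \<notin> insert va (writes (For vb vQ ?b)) \<Longrightarrow> \<tau> x = \<sigma> x"
    have "?done i Q (run (For vb vQ ?b) \<tau>)"
    proof (rule For_rule'[where I = "?done i"])
      fix j' \<rho> assume j: "j' < Q" "\<rho> vb 0 = j'" and J: "?done i j' \<rho>"
        and fr2: "\<And>x. x \<notin> insert vb (writes ?b) \<Longrightarrow> \<rho> x = \<tau> x"
      have fr3: "\<rho> x = \<sigma> x" if "x \<notin> {va, vb, vt11, vhi, vT}" for x
        using fr[of x] fr2[of x] that by simp
      have f: "\<rho> va 0 = i" "\<rho> vQ 0 = Q" "\<rho> vcap 0 = CAP" "\<rho> vq 0 = ?q" "\<rho> vqq 0 = ?q * ?q" "\<rho> vX = \<sigma> vX"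
        "\<rho> vc 0 = nonsq ?q nmul"
        using fr3[of vQ] fr3[of vcap] fr3[of vq] fr3[of vqq] fr3[of vX] fr3[of vc] fr2[of va] i configD[OF cf] tw qq c
        by (simp_all add: towok_def)
      show "?done i (Suc j') (upd (run ?b \<rho>) vb 0 (Suc j'))"
      proof (cases "i < ?q * ?q \<and> j' < ?q * ?q")
        case False
        then have r: "run ?b \<rho> = \<rho>" using f j by auto
        show ?thesis unfolding r using J False by (auto simp: less_Suc_eq)
      next
        case True
        have dm: "i div ?q < ?q" "i mod ?q < ?q" "j' div ?q < ?q" "j' mod ?q < ?q"
          using True split_div_mod by auto
        have cq: "nonsq ?q nmul < ?q" by (rule field2.nonsq(1)[OF field2_nmul])
        have T: "\<rho> vT (a * Q + b) = nmul a b" if "a < ?q" "b < ?q" for a b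
        proof -
          have "?q * 1 \<le> ?q * ?q" by (rule mult_le_mono2) (simp add: Suc_le_eq)
          then have "a < ?q * ?q" "b < ?q * ?q" using that by linarith+
          then show ?thesis using J that by blast
        qed
        have X: "\<rho> vX (a * Q + b) = xor a b" if "a < ?q" "b < ?q" for a b
          using configD(5)[OF cf] f(6) that qQ by simp
        let ?t11 = "nmul (i div ?q) (j' div ?q)"
        let ?hi = "xor ?t11 (xor (nmul (i div ?q) (j' mod ?q)) (nmul (i mod ?q) (j' div ?q)))"
        note lt = dm cq nmul_less xor_less
        have v: "nmul i j' = ?hi * ?q + xor (nmul (i mod ?q) (j' mod ?q)) (nmul (nonsq ?q nmul) ?t11)"
          unfolding nmul_step[OF conjunct1[OF True] conjunct2[OF True]] qmul_def Let_def by (rule refl)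
        have "nmul i j' < fsz (Suc j)" using True by (intro nmul_less) (simp_all add: fsz_Suc)
        then have vC: "nmul i j' < CAP" using q size_bounds(3) by (simp add: fsz_Suc)
        have r1: "run ?s1 \<rho> = upd \<rho> vt11 0 ?t11" using f j lt T by simp
        have r2: "run ?s2 (upd \<rho> vt11 0 ?t11) = upd (upd \<rho> vt11 0 ?t11) vhi 0 ?hi"
          using f j lt T X by simp
        have r3: "run ?s3 (upd (upd \<rho> vt11 0 ?t11) vhi 0 ?hi) =
            upd (upd (upd \<rho> vt11 0 ?t11) vhi 0 ?hi) vT (i * Q + j') (nmul i j')"
          using f j lt T X v[symmetric] vC by simp
        have r: "run ?b \<rho> = upd (upd (upd \<rho> vt11 0 ?t11) vhi 0 ?hi) vT (i * Q + j') (nmul i j')"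
        proof -
          have "run ?b \<rho> = run ?s3 (run ?s2 (run ?s1 \<rho>))" using True f j by (simp del: upd_def)
          then show ?thesis unfolding r1 r2 r3 .
        qed
        show ?thesis unfolding r
        proof (intro allI impI)
          fix a b assume ab: "a < ?q * ?q" "b < ?q * ?q" "a < i \<or> a = i \<and> b < Suc j' \<or> a < ?q \<and> b < ?q"
          have "b < Q" using ab q by simp
          then have ix: "a * Q + b = i * Q + j' \<longleftrightarrow> a = i \<and> b = j'" using j by (intro pair_index_eq)
          show "upd (upd (upd (upd \<rho> vt11 0 ?t11) vhi 0 ?hi) vT (i * Q + j') (nmul i j')) vb 0 (Suc j') vT (a * Q + b) = nmul a b"
            using J ab ix by (cases "a = i \<and> b = j'") (auto simp: less_Suc_eq)
        qed
      qed
    qed (use I fr[of vQ] configD[OF cf] in simp_all)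
    then have D: "?done (Suc i) 0 (run (For vb vQ ?b) \<tau>)" using q by (auto simp: less_Suc_eq)
    then show "?done (Suc i) 0 (upd (run (For vb vQ ?b) \<tau>) va 0 (Suc i))"
      by (simp del: run.simps)
  qed (use tw configD[OF cf] in \<open>auto simp: towok_def\<close>)
  then show ?thesis using q by auto
qed

lemma run_tower:
  assumes cf: "config \<sigma>" and tw: "towok j \<sigma>" and q: "fsz j \<le> Q"
  shows "if fsz j < Q0 then towok (Suc j) (run pTower \<sigma>) \<and> fsz (Suc j) \<le> Q else towok j (run pTower \<sigma>)"
proof (cases "fsz j < Q0")
  case False
  then have "run pTower \<sigma> = \<sigma>" using configD[OF cf] tw by (simp add: pTower_def towok_def)
  then show ?thesis using False tw by simp
next
  case True
  let ?q = "fsz j"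
  have qq: "?q * ?q \<le> Q" unfolding Q_def using True by (intro mult_le_mono) auto
  define \<sigma>1 where "\<sigma>1 = run (setv vqq (capm (Vr vq *! Vr vq))) \<sigma>"
  define \<sigma>2 where "\<sigma>2 = run pMark \<sigma>1"
  define \<sigma>3 where "\<sigma>3 = run pExt \<sigma>2"
  have s1: "\<sigma>1 = upd \<sigma> vqq 0 (?q * ?q)"
    unfolding \<sigma>1_def using tw configD[OF cf] qq size_bounds(3) by (simp add: towok_def)
  have c1: "config \<sigma>1" "towok j \<sigma>1"
    by (rule config_cong[OF cf]; simp add: s1) (rule towok_cong[OF tw]; simp add: s1)
  have f2: "\<sigma>2 x = \<sigma>1 x" if "x \<notin> {va, vMk, vc}" for x
    unfolding \<sigma>2_def by (rule run_frame) (use that in simp)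
  have c2: "config \<sigma>2" by (rule config_cong[OF c1(1)]) (simp_all add: f2)
  have t2: "towok j \<sigma>2" by (rule towok_cong[OF c1(2)]) (simp_all add: f2)
  have e: "\<forall>a<?q * ?q. \<forall>b<?q * ?q. \<sigma>3 vT (a * Q + b) = nmul a b"
    unfolding \<sigma>3_def
    by (rule run_ext[OF c2 t2 qq]) (use run_mark[OF c1 q] f2[of vqq] s1 in \<open>simp_all add: \<sigma>2_def\<close>)
  have f3: "\<sigma>3 x = \<sigma>2 x" if "x \<notin> {va, vb, vt11, vhi, vT}" for x
    unfolding \<sigma>3_def by (rule run_frame) (use that in simp)
  have v: "\<sigma>3 vqq 0 = ?q * ?q" "\<sigma>3 vr 0 = 2 ^ j" "\<sigma>3 vcap 0 = CAP"
    using f2 f3 s1 c2 t2 configD[OF c2] by (simp_all add: towok_def)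
  have "(2::nat) ^ Suc j \<le> fsz (Suc j)"
    unfolding fsz_def by (intro power_increasing less_imp_le) simp_all
  then have "2 ^ Suc j < CAP" using qq size_bounds(3) by (simp add: fsz_Suc)
  then have "run pTower \<sigma> = upd (upd \<sigma>3 vq 0 (?q * ?q)) vr 0 (2 ^ Suc j)"
    using v True configD[OF cf] tw
    by (simp add: pTower_def towok_def \<sigma>1_def[symmetric] \<sigma>2_def[symmetric] \<sigma>3_def[symmetric] del: run.simps(2))
       (simp add: mult_2)
  then have "towok (Suc j) (run pTower \<sigma>)" using e by (simp add: towok_def fsz_Suc)
  then show ?thesis using True qq by (simp add: fsz_Suc)
qed

lemma run_field:
  assumes cf: "config \<sigma>" and T: "\<sigma> vT = (\<lambda>_. 0)"
  shows "\<exists>j. towok j (run pField \<sigma>) \<and> Q0 \<le> fsz j \<and> fsz j \<le> Q"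
proof -
  define \<sigma>1 where "\<sigma>1 = run (setv vq (Cst 2) ;; setv vr (Cst 1) ;; Store vT (Vr vQ +! Cst 1) (Cst 1)) \<sigma>"
  have s1: "\<sigma>1 = upd (upd (upd \<sigma> vq 0 2) vr 0 1) vT (Suc Q) 1"
    using configD[OF cf] by (simp add: \<sigma>1_def)
  have Q4: "4 \<le> Q" using mult_le_mono[OF size_bounds(7,7)] by (simp add: Q_def)
  have "nmul a b = a * b" if "a < 2" "b < 2" for a b using that by (rule nmul_01)
  moreover have "a < 2 \<longleftrightarrow> a = 0 \<or> a = 1" for a :: nat by auto
  ultimately have t1: "towok 0 \<sigma>1" using Q4 by (auto simp: towok_def s1 fsz_0 T)
  have c1: "config \<sigma>1" by (rule config_cong[OF cf]) (simp_all add: s1)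
  \<comment> \<open>Each round raises the level unless the target size is reached. After
    \<open>Q\<close> rounds the second alternative gives \<open>Q \<le> j\<close>, and then
    \<open>Q0 \<le> Q \<le> j < fsz j\<close>.\<close>
  let ?I = "\<lambda>i \<tau>. \<exists>j. towok j \<tau> \<and> fsz j \<le> Q \<and> (Q0 \<le> fsz j \<or> i \<le> j)"
  have "?I Q (run (For vt vQ pTower) \<sigma>1)"
  proof (rule For_rule'[where I = ?I])
    fix i \<tau> assume i: "i < Q" "\<tau> vt 0 = i" and I: "?I i \<tau>"
      and fr: "\<And>x. x \<notin> insert vt (writes pTower) \<Longrightarrow> \<tau> x = \<sigma>1 x"
    have c: "config \<tau>" by (rule config_cong[OF c1]) (simp_all add: fr)
    obtain j where j: "towok j \<tau>" "fsz j \<le> Q" "Q0 \<le> fsz j \<or> i \<le> j" using I by blast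
    have st: "towok j' (upd (run pTower \<tau>) vt 0 (Suc i))" if "towok j' (run pTower \<tau>)" for j'
      by (rule towok_cong[OF that]) simp_all
    show "?I (Suc i) (upd (run pTower \<tau>) vt 0 (Suc i))"
    proof (cases "fsz j < Q0")
      case True
      then show ?thesis using run_tower[OF c j(1,2)] j(3) st[of "Suc j"] by (intro exI[of _ "Suc j"]) auto
    next
      case False
      then show ?thesis using run_tower[OF c j(1,2)] j(2) st[of j] by (intro exI[of _ j]) auto
    qed
  next
    show "?I 0 (upd \<sigma>1 vt 0 0)"
      using towok_cong[OF t1, of "upd \<sigma>1 vt 0 0"] Q4 by (intro exI[of _ 0]) (simp add: fsz_0)
  qed (use configD[OF c1] in simp_all)
  moreover have "run pField \<sigma> = run (For vt vQ pTower) \<sigma>1" by (simp add: pField_def \<sigma>1_def)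
  moreover have "Q0 \<le> fsz j" if "Q \<le> j" for j
    using fsz_gt[of j] that size_bounds(8) by linarith
  ultimately show ?thesis by auto
qed

definition ready :: "nat \<Rightarrow> st \<Rightarrow> bool" where
  "ready j \<sigma> \<longleftrightarrow> config \<sigma> \<and> towok j \<sigma> \<and> Q0 \<le> fsz j \<and> fsz j \<le> Q \<and> \<sigma> vn 0 = n \<and> \<sigma> vd 0 = d \<and> \<sigma> vN 0 = N \<and>
     \<sigma> vks 0 = k \<and> \<sigma> vm 0 = card Lg \<and> (\<forall>y<n. \<sigma> vrk y = rk y) \<and> \<sigma> vK2 0 = 2 ^ k \<and>
     (\<forall>y<k. \<sigma> vP2 y = 2 ^ y)"

lemma run_tables:
  assumes b: "base \<sigma>" and v: "\<sigma> vn 0 = n" "\<sigma> vd 0 = d" "\<sigma> vN 0 = N" "\<sigma> vQ0 0 = Q0" "\<sigma> vQ 0 = Q"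
    and z: "\<sigma> vX = (\<lambda>_. 0)" "\<sigma> vT = (\<lambda>_. 0)"
  shows "\<exists>j. ready j (run pTables \<sigma>) \<and> run pTables \<sigma> vNT 0 = N * N * 2 ^ k * 2 ^ j"
proof -
  define \<sigma>1 where "\<sigma>1 = run pRank \<sigma>"
  define \<sigma>2 where "\<sigma>2 = run pPow \<sigma>1"
  define \<sigma>3 where "\<sigma>3 = run pXor \<sigma>2"
  define \<sigma>4 where "\<sigma>4 = run pField \<sigma>3"
  have f1: "\<sigma>1 x = \<sigma> x" if "x \<notin> {vks, vm, va, vrk}" for x
    unfolding \<sigma>1_def by (rule run_frame) (use that in simp)
  have f2: "\<sigma>2 x = \<sigma>1 x" if "x \<notin> {vK2, va, vP2}" for x
    unfolding \<sigma>2_def by (rule run_frame) (use that in simp)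
  have f3: "\<sigma>3 x = \<sigma>2 x" if "x \<notin> {va, vb, vX}" for x
    unfolding \<sigma>3_def by (rule run_frame) (use that in simp)
  have f4: "\<sigma>4 x = \<sigma>3 x" if "x \<notin> {vq, vr, vT, vt, vqq, va, vMk, vc, vb, vt11, vhi}" for x
    unfolding \<sigma>4_def by (rule run_frame) (use that in simp)
  have base1: "base \<sigma>1" using b by (simp add: base_def f1)
  have base2: "base \<sigma>2" using base1 by (simp add: base_def f2)
  have base3: "base \<sigma>3" using base2 by (simp add: base_def f3)
  note r1 = run_rank[OF b v(1), folded \<sigma>1_def]
  have r2: "\<sigma>2 vK2 0 = 2 ^ k" "\<forall>y<k. \<sigma>2 vP2 y = 2 ^ y"
    using run_pow[OF base1] r1 v f1 by (simp_all add: \<sigma>2_def)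
  have r3: "xtab \<sigma>3" unfolding \<sigma>3_def using base2 v z by (intro run_xor) (simp_all add: f1 f2)
  have c3: "config \<sigma>3" using base3 r3 v by (simp add: config_def f1 f2 f3)
  obtain j where j: "towok j \<sigma>4" "Q0 \<le> fsz j" "fsz j \<le> Q"
    using run_field[OF c3] z by (auto simp: \<sigma>4_def f1 f2 f3)
  have c4: "config \<sigma>4" by (rule config_cong[OF c3]) (simp_all add: f4)
  have s4: "ready j \<sigma>4"
    using j c4 r1 r2 v by (simp add: ready_def f1 f2 f3 f4)
  have "(2::nat) ^ j \<le> fsz j" unfolding fsz_def by (intro power_increasing less_imp_le) simp_all
  then have "2 ^ j \<le> C0 ^ 2" using j(3) size_bounds(6) by linarith
  moreover have "(2::nat) ^ k \<le> 2 ^ n" using k_le_n by (intro power_increasing) auto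
  then have "2 ^ k \<le> C0 ^ 1" using C0_ge(4) unfolding power_one_right by (rule order_trans)
  moreover have "N \<le> C0 ^ 1" using size_bounds(5) by simp
  \<comment> \<open>One factor \<open>C0\<close> for each \<open>N\<close> and for
    \<open>2 ^ k\<close>, two for \<open>2 ^ j \<le> fsz j \<le> Q\<close>.\<close>
  ultimately have "N * N * 2 ^ k * 2 ^ j \<le> C0 ^ (1 + 1 + 1 + 2)"
    by (intro le_C0_mult)
  then have lt: "N * N * 2 ^ k * 2 ^ j < CAP" by (rule less_CAP) simp
  have "run pTables \<sigma> = run (setv vNT (capm (Vr vN *! Vr vN *! Vr vK2 *! Vr vr))) \<sigma>4"
    by (simp add: pTables_def \<sigma>4_def \<sigma>3_def \<sigma>2_def \<sigma>1_def)
  also have "\<dots> = upd \<sigma>4 vNT 0 (N * N * 2 ^ k * 2 ^ j)"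
    using s4 lt by (simp add: ready_def towok_def configD)
  finally have r: "run pTables \<sigma> = upd \<sigma>4 vNT 0 (N * N * 2 ^ k * 2 ^ j)" .
  have "ready j (upd \<sigma>4 vNT 0 x)" for x
    using s4 config_cong[OF c4, of "upd \<sigma>4 vNT 0 x"] towok_cong[OF j(1), of "upd \<sigma>4 vNT 0 x"]
    by (simp add: ready_def)
  then show ?thesis unfolding r by auto
qed

end

subsection \<open>The program: main stage\<close>

abbreviation (input) "vR \<equiv> 28::nat"
abbreviation (input) "vu \<equiv> 29::nat"
abbreviation (input) "vv \<equiv> 30::nat"
abbreviation (input) "vS \<equiv> 31::nat"
abbreviation (input) "vx \<equiv> 32::nat"
abbreviation (input) "vbb \<equiv> 33::nat"
abbreviation (input) "vfe \<equiv> 34::nat"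
abbreviation (input) "vj \<equiv> 35::nat"
abbreviation (input) "vnum \<equiv> 36::nat"
abbreviation (input) "vden \<equiv> 37::nat"
abbreviation (input) "vy \<equiv> 38::nat"
abbreviation (input) "vG \<equiv> 39::nat"
abbreviation (input) "vii \<equiv> 40::nat"

definition pDraw :: prog where
  "pDraw = setv vx (Cst 0) ;; For vbb vr (setv vx (capm (Cst 2 *! Vr vx +!
     Arr vR (((Vr vu *! Vr vN +! Vr vv) *! Vr vK2 +! Vr vS) *! Vr vr +! Vr vbb))))"

abbreviation (input) "flagE \<equiv> Inp (Cst 4 +! Vr vy)"
abbreviation (input) "rkE \<equiv> Arr vrk (Vr vy)"
abbreviation (input) "neqE e e' \<equiv> (e -! e') +! (e' -! e)"
abbreviation (input) "dataE \<equiv> Cst 4 +! Vr vn +! Cst 2 *! (Vr vy *! Vr vd +! Vr vj)"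

text \<open>An arithmetic form of \<open>inbin\<close>: the flag of the item selects the case,
  \<open>1 - neqE\<close> tests equality, and addition serves as disjunction. The expression is only
  tested, never stored, and so carries no reduction by the cap.\<close>

definition memE :: ex where
  "memE = flagE *! ((Vr vS div! Arr vP2 rkE) mod! Cst 2) +!
     (Cst 1 -! flagE) *! ((Cst 1 -! neqE rkE (Vr vu)) +! (Cst 1 -! neqE rkE (Vr vv)))"

text \<open>Fractions are added without cancelling. The sum of numerator and denominator then stays
  below the product of the sums \<open>p + q\<close> of the items seen so far.\<close>

definition pAdd :: prog where
  "pAdd = Cond memE
     (setv vnum (capm (Vr vnum *! Inp (dataE +! Cst 1) +! Inp dataE *! Vr vden)) ;;
      setv vden (capm (Vr vden *! Inp (dataE +! Cst 1)))) Nop"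

definition pCoord :: prog where
  "pCoord = setv vnum (Cst 0) ;; setv vden (Cst 1) ;; For vy vn pAdd ;;
     Cond (Vr vnum -! Vr vden) (setv vfe (Cst 0)) Nop"

definition pLoad :: prog where "pLoad = setv vfe (Cst 1) ;; For vj vd pCoord"

abbreviation (input) "idxE \<equiv> (Vr vu *! Vr vN +! Vr vv) *! Vr vK2 +! Vr vS"

definition pEntry :: prog where
  "pEntry = pDraw ;; pLoad ;; Cond (Vr vfe) (Store vG idxE (Vr vx)) (Store vG idxE (Cst 0))"

definition pWeights :: prog where "pWeights = For vu vN (For vv vN (For vS vK2 pEntry))"

text \<open>One step of the subset sum transform, in place. The entry added to that of
  \<open>S\<close> belongs to a set without \<open>vii\<close>, and such entries keep their values
  during the round for \<open>vii\<close>.\<close>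

definition pFold :: prog where
  "pFold = Cond ((Vr vS div! Arr vP2 (Vr vii)) mod! Cst 2)
     (Store vG idxE (XT (Arr vG idxE) (Arr vG ((Vr vu *! Vr vN +! Vr vv) *! Vr vK2 +! (Vr vS -! Arr vP2 (Vr vii)))))) Nop"

definition pZeta :: prog where "pZeta = For vu vN (For vv vN (For vii vks (For vS vK2 pFold)))"

lemma writes_weights [simp]:
  "writes pDraw = {vx, vbb}" "writes pAdd = {vnum, vden}" "writes pCoord = {vnum, vden, vy, vfe}"
  "writes pLoad = {vfe, vj, vnum, vden, vy}" "writes pEntry = {vx, vbb, vfe, vj, vnum, vden, vy, vG}"
  "writes pWeights = {vu, vv, vS, vx, vbb, vfe, vj, vnum, vden, vy, vG}"
  "writes pFold = {vG}" "writes pZeta = {vu, vv, vii, vS, vG}"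
  by (auto simp: pDraw_def pAdd_def pCoord_def pLoad_def pEntry_def pWeights_def pFold_def pZeta_def)

section \<open>Binary codes of sets and partial subset sums\<close>

lemma set_decode_sub:
  assumes "odd (S div 2 ^ i)"
  shows "set_decode (S - 2 ^ i) = set_decode S - {i}" "2 ^ i \<le> S"
proof -
  have i: "i \<in> set_decode S" using assms by (simp add: set_decode_def)
  have "set_encode (set_decode S) = 2 ^ i + set_encode (set_decode S - {i})"
    unfolding set_encode_def using i by (simp add: sum.remove)
  then have e: "S = 2 ^ i + set_encode (set_decode S - {i})" by simp
  then show "2 ^ i \<le> S" by linarith
  have "S - 2 ^ i = set_encode (set_decode S - {i})" using e by linarith
  then show "set_decode (S - 2 ^ i) = set_decode S - {i}" by simp
qed

lemma set_decode_Pow: "S < 2 ^ k \<Longrightarrow> set_decode S \<subseteq> {..<k}"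
proof
  fix i assume "S < 2 ^ k" "i \<in> set_decode S"
  then have "odd (S div 2 ^ i)" by (simp add: set_decode_def)
  then have "2 ^ i \<le> S" by (rule set_decode_sub)
  then have "(2::nat) ^ i < 2 ^ k" using \<open>S < 2 ^ k\<close> by linarith
  then show "i \<in> {..<k}" by simp
qed

lemma set_encode_less: "A \<subseteq> {..<k} \<Longrightarrow> set_encode A < 2 ^ k"
proof -
  assume A: "A \<subseteq> {..<k}"
  have "set_encode A \<le> set_encode {..<k}"
    unfolding set_encode_def using A by (intro sum_mono2) auto
  also have "\<dots> < 2 ^ k"
    unfolding set_encode_def by (induction k) auto
  finally show ?thesis .
qed

lemma bij_betw_set_decode: "bij_betw set_decode {..<2 ^ k} (Pow {..<k})"
proof (rule bij_betw_byWitness[where f' = set_encode])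
  show "\<forall>A\<in>Pow {..<k}. set_decode (set_encode A) = A"
    by (auto simp del: set_decode_def intro!: set_encode_inverse finite_subset[of _ "{..<k}"])
  show "set_decode ` {..<2 ^ k} \<subseteq> Pow {..<k}" using set_decode_Pow by auto
  show "set_encode ` Pow {..<k} \<subseteq> {..<2 ^ k}" using set_encode_less by auto
qed simp

text \<open>Partial subset sums: coordinates below \<open>i\<close> have been summed over.\<close>

definition zsum :: "nat \<Rightarrow> (nat set \<Rightarrow> gf) \<Rightarrow> nat set \<Rightarrow> gf" where
  "zsum i \<phi> Z = (\<Sum>S | S \<subseteq> Z \<and> Z - S \<subseteq> {..<i}. \<phi> S)"

lemma zsum_0: "zsum 0 \<phi> Z = \<phi> Z"
proof -
  have "{S. S \<subseteq> Z \<and> Z - S \<subseteq> {..<0::nat}} = {Z}" by auto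
  then show ?thesis by (simp add: zsum_def)
qed

text \<open>For \<open>i \<in> Z\<close> the sets \<open>S\<close> split into those that contain
  \<open>i\<close>, which are the ones of stage \<open>i\<close> for \<open>Z\<close>, and those
  that omit it, which are the ones of stage \<open>i\<close> for \<open>Z - {i}\<close>.\<close>

lemma zsum_Suc:
  assumes "finite Z"
  shows "zsum (Suc i) \<phi> Z = (if i \<in> Z then zsum i \<phi> Z + zsum i \<phi> (Z - {i}) else zsum i \<phi> Z)"
proof (cases "i \<in> Z")
  case False
  then have "{S. S \<subseteq> Z \<and> Z - S \<subseteq> {..<Suc i}} = {S. S \<subseteq> Z \<and> Z - S \<subseteq> {..<i}}"
    by (auto simp: lessThan_Suc)
  then show ?thesis using False by (simp add: zsum_def)
next
  case True
  have "{S. S \<subseteq> Z \<and> Z - S \<subseteq> {..<Suc i}} =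
      {S. S \<subseteq> Z \<and> Z - S \<subseteq> {..<i}} \<union> {S. S \<subseteq> Z - {i} \<and> Z - {i} - S \<subseteq> {..<i}}" (is "_ = ?A \<union> ?B")
    by (auto simp: lessThan_Suc)
  moreover have "?A \<inter> ?B = {}" using True by auto
  moreover have "finite ?A" "finite ?B" using assms by (auto intro: finite_subset[of _ "Pow Z"])
  ultimately show ?thesis using True by (simp add: zsum_def sum.union_disjoint)
qed

lemma zsum_top: "Z \<subseteq> {..<k} \<Longrightarrow> zsum k \<phi> Z = (\<Sum>S\<in>Pow Z. \<phi> S)"
  unfolding zsum_def by (intro sum.cong) auto

lemma code_sum_less: "(\<And>x. x \<in> A \<Longrightarrow> code (g x) < fsz j) \<Longrightarrow> code (\<Sum>x\<in>A. g x) < fsz j"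
  by (induction A rule: infinite_finite_induct) (auto intro: code_add_less)

section \<open>Random weights, feasibility tests and the subset sum transform\<close>

locale vbp_main = vbp_run +
  fixes jj :: nat and f :: "nat \<Rightarrow> bool"
  assumes jj: "Q0 \<le> fsz jj" "fsz jj \<le> Q"
begin

text \<open>\<open>jj\<close> is the tower level reached by the preparation and \<open>f\<close> the
  coin sequence as a function. With both fixed, the main stage is a deterministic computation on a
  stored table of coins.\<close>

definition mready :: "st \<Rightarrow> bool" where
  "mready \<sigma> \<longleftrightarrow> ready jj \<sigma> \<and> (\<forall>t<N * N * 2 ^ k * 2 ^ jj. \<sigma> vR t = of_bool (f t))"

text \<open>All prepared data, including the coins in array 28, lives below 29, and the main stage
  writes only from 29 on.\<close>

lemma mready_frame:
  assumes "mready \<sigma>" "\<And>x. x < 29 \<Longrightarrow> \<tau> x = \<sigma> x"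
  shows "mready \<tau>"
  using assms(1) config_cong[of \<sigma> \<tau>] towok_cong[of jj \<sigma> \<tau>] unfolding mready_def ready_def
  by (simp add: assms(2))

lemma mreadyD:
  assumes "mready \<sigma>"
  shows "\<sigma> 0 = \<iota>" "\<sigma> vcap 0 = CAP" "\<sigma> vQ 0 = Q" "\<sigma> vq 0 = fsz jj" "\<sigma> vr 0 = 2 ^ jj"
    "\<sigma> vn 0 = n" "\<sigma> vd 0 = d" "\<sigma> vN 0 = N" "\<sigma> vks 0 = k" "\<sigma> vm 0 = card Lg" "\<sigma> vK2 0 = 2 ^ k"
    "y < n \<Longrightarrow> \<sigma> vrk y = rk y" "y < k \<Longrightarrow> \<sigma> vP2 y = 2 ^ y"
    "t < N * N * 2 ^ k * 2 ^ jj \<Longrightarrow> \<sigma> vR t = of_bool (f t)"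
  using assms by (auto simp: mready_def ready_def config_def base_def towok_def)

lemma mready_X: "mready \<sigma> \<Longrightarrow> code a < fsz jj \<Longrightarrow> code b < fsz jj \<Longrightarrow> \<sigma> vX (code a * Q + code b) = code (a + b)"
  using jj(2) by (simp add: mready_def ready_def configD code_add)

lemma mready_T: "mready \<sigma> \<Longrightarrow> code a < fsz jj \<Longrightarrow> code b < fsz jj \<Longrightarrow> \<sigma> vT (code a * Q + code b) = code (a * b)"
  by (simp add: mready_def ready_def towok_def code_mult)

definition gg :: "nat \<times> nat \<Rightarrow> nat set \<Rightarrow> gf" where
  "gg e S = (if feas e S then rnd (2 ^ jj) f ((fst e * N + snd e) * 2 ^ k + set_encode S) else 0)"

lemma code_rnd_less: "code (rnd (2 ^ jj) f v) < fsz jj"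
  by (simp add: rnd_def Gf_inverse fsz_def bn_less)

lemma code_gg_less: "code (gg e S) < fsz jj"
  by (simp add: gg_def code_rnd_less)

lemma index3_less: "u < N \<Longrightarrow> v < N \<Longrightarrow> S < 2 ^ k \<Longrightarrow> (u * N + v) * 2 ^ k + S < N * N * 2 ^ k"
  by (intro pair_less_prod)

lemma index3_eq:
  "v < N \<Longrightarrow> v' < N \<Longrightarrow> S < 2 ^ k \<Longrightarrow> S' < 2 ^ k \<Longrightarrow>
    (u * N + v) * 2 ^ k + S = (u' * N + v') * 2 ^ k + S' \<longleftrightarrow> u = u' \<and> v = v' \<and> S = S'"
  by (simp add: pair_index_eq)

lemma run_draw:
  assumes m: "mready \<sigma>" and uvS: "\<sigma> vu 0 = u" "\<sigma> vv 0 = v" "\<sigma> vS 0 = S" "u < N" "v < N" "S < 2 ^ k"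
  shows "run pDraw \<sigma> vx 0 = code (rnd (2 ^ jj) f ((u * N + v) * 2 ^ k + S))"
proof -
  let ?i = "(u * N + v) * 2 ^ k + S"
  let ?f = "\<lambda>b. f (?i * 2 ^ jj + b)"
  let ?b = "setv vx (capm (Cst 2 *! Vr vx +!
     Arr vR (((Vr vu *! Vr vN +! Vr vv) *! Vr vK2 +! Vr vS) *! Vr vr +! Vr vbb)))"
  let ?I = "\<lambda>i \<tau>. \<tau> vx 0 = bn ?f i"
  have "?I (2 ^ jj) (run pDraw \<sigma>)"
    unfolding pDraw_def run.simps(3)
  proof (rule For_rule'[where I = ?I])
    fix i \<tau> assume i: "i < 2 ^ jj" "\<tau> vbb 0 = i" and I: "?I i \<tau>"
      and fr: "\<And>x. x \<notin> insert vbb (writes ?b) \<Longrightarrow> \<tau> x = run (setv vx (Cst 0)) \<sigma> x"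
    have fr': "\<tau> x = \<sigma> x" if "x \<notin> {vx, vbb}" for x using fr[of x] that by simp
    have mt: "mready \<tau>" by (rule mready_frame[OF m]) (rule fr', auto)
    have "?i * 2 ^ jj + i < N * N * 2 ^ k * 2 ^ jj"
      using index3_less uvS i by (intro pair_less_prod)
    then have R: "\<tau> vR (?i * 2 ^ jj + i) = of_bool (?f i)" by (rule mreadyD(14)[OF mt])
    have "bn ?f (Suc i) < 2 ^ Suc i" by (rule bn_less)
    also have "(2::nat) ^ Suc i \<le> 2 ^ 2 ^ jj" using i by (intro power_increasing) auto
    also have "\<dots> \<le> Q" using jj by (simp add: fsz_def)
    finally have "bn ?f (Suc i) < CAP" using size_bounds(3) by linarith
    then show "?I (Suc i) (upd (run ?b \<tau>) vbb 0 (Suc i))"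
      using mreadyD(2,5,8,11)[OF mt] R I i uvS fr'[of vu] fr'[of vv] fr'[of vS] by simp
  qed (use mreadyD[OF m] in simp_all)
  then show ?thesis by (simp add: rnd_def Gf_inverse)
qed

lemma eval_memE:
  assumes m: "mready \<tau>" and y: "\<tau> vy 0 = y" "y < n"
    and uvS: "\<tau> vu 0 = u" "\<tau> vv 0 = v" "\<tau> vS 0 = S" "u < N" "v < N" "S < 2 ^ k"
  shows "eval memE \<tau> \<noteq> 0 \<longleftrightarrow> inbin (u, v) (set_decode S) y"
proof -
  have mn: "min (4 + y) (length xs) = 4 + y" using y length_xs by simp
  show ?thesis
  proof (cases "y \<in> small I")
    case True
    then have "rk y < k" using bij_betwE[OF bij_rk_Sm] by (auto simp: k_def)
    then have "eval memE \<tau> = (S div 2 ^ rk y) mod 2"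
      using mreadyD[OF m] y uvS True by (simp add: memE_def mn)
    then show ?thesis using True by (simp add: inbin_def set_decode_def odd_iff_mod_2_eq_one)
  next
    case False
    have "eval memE \<tau> = (1 - ((rk y - u) + (u - rk y))) + (1 - ((rk y - v) + (v - rk y)))"
      using mreadyD[OF m] y uvS False by (simp add: memE_def mn)
    then show ?thesis using False by (auto simp: inbin_def)
  qed
qed

lemma w_quotient:
  assumes "x < n" "j < d"
  shows "w x j = of_nat (pn x j) / of_nat (qn x j)" "0 < qn x j"
proof -
  obtain p q where pq: "quotient_of (w x j) = (p, q)" by fastforce
  have q: "0 < q" using quotient_of_denom_pos[OF pq] .
  have e: "w x j = of_int p / of_int q" using quotient_of_div[OF pq] .
  then have "0 \<le> p" using w_nonneg[OF assms] q by (simp add: zero_le_divide_iff)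
  then show "w x j = of_nat (pn x j) / of_nat (qn x j)" "0 < qn x j"
    using e q pq by (simp_all add: pn_def qn_def)
qed

text \<open>For a fixed coordinate the items use distinct input positions, so the left-hand side is
  a subproduct of \<open>C0\<close>, all of whose factors are positive.\<close>

lemma prod_inputs_le:
  assumes "j < d" "\<And>x. x < n \<Longrightarrow> g x = \<iota> (Suc (c + 2 * (x * d + j)))" "\<And>x. x < n \<Longrightarrow> c + 2 * (x * d + j) < length xs"
  shows "(\<Prod>x<n. g x + 2) \<le> C0"
proof -
  let ?h = "\<lambda>x. c + 2 * (x * d + j)"
  have inj: "inj_on ?h {..<n}" using assms(1) by (intro inj_onI) auto
  have "(\<Prod>x<n. g x + 2) = (\<Prod>x<n. \<iota> (Suc (?h x)) + 2)" using assms(2) by simp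
  also have "\<dots> = (\<Prod>t\<in>?h ` {..<n}. \<iota> (Suc t) + 2)" unfolding prod.reindex[OF inj] comp_def ..
  also have "\<dots> \<le> C0" unfolding C0_def using assms(3) by (intro prod_subset_le) auto
  finally show ?thesis .
qed

text \<open>\<open>p + q \<le> (p + 2) * (q + 2)\<close> separates numerators from denominators;
  either product is at most \<open>C0\<close>.\<close>

lemma prod_pq_le: "j < d \<Longrightarrow> y \<le> n \<Longrightarrow> (\<Prod>x<y. pn x j + qn x j) < CAP"
proof -
  assume j: "j < d" and y: "y \<le> n"
  have 1: "(\<Prod>x<n. pn x j + 2) \<le> C0"
    using \<iota>_data data_index j
    by (intro prod_inputs_le[where j = j and c = "3 + n"]) (auto simp: less_eq_Suc_le add.assoc intro: Suc_leD)
  have 2: "(\<Prod>x<n. qn x j + 2) \<le> C0"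
    using \<iota>_data data_index j
    by (intro prod_inputs_le[where j = j and c = "4 + n"]) (auto simp: less_eq_Suc_le add.assoc)
  have "(\<Prod>x<y. pn x j + qn x j) \<le> (\<Prod>x<y. (pn x j + 2) * (qn x j + 2))"
    by (intro prod_mono) (auto simp: algebra_simps)
  also have "\<dots> \<le> (\<Prod>x<n. (pn x j + 2) * (qn x j + 2))"
    using y by (intro prod_subset_le) auto
  also have "\<dots> = (\<Prod>x<n. pn x j + 2) * (\<Prod>x<n. qn x j + 2)" by (rule prod.distrib)
  also have "\<dots> \<le> C0 ^ 2" using 1 2 by (simp add: power2_eq_square mult_le_mono)
  finally show ?thesis by (rule less_CAP) simp
qed

lemma run_coord:
  assumes m: "mready \<sigma>" and j: "\<sigma> vj 0 = j" "j < d"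
    and uvS: "\<sigma> vu 0 = u" "\<sigma> vv 0 = v" "\<sigma> vS 0 = S" "u < N" "v < N" "S < 2 ^ k"
  shows "run pCoord \<sigma> vfe 0 =
    (if (\<Sum>x | x < n \<and> inbin (u, v) (set_decode S) x. w x j) \<le> 1 then \<sigma> vfe 0 else 0)"
proof -
  let ?in = "inbin (u, v) (set_decode S)"
  let ?s = "\<lambda>y. \<Sum>x | x < y \<and> ?in x. w x j"
  define \<sigma>1 where "\<sigma>1 = run (setv vnum (Cst 0) ;; setv vden (Cst 1)) \<sigma>"
  have f1: "\<sigma>1 x = \<sigma> x" if "x \<notin> {vnum, vden}" for x
    unfolding \<sigma>1_def by (rule run_frame) (use that in simp)
  have i1: "\<sigma>1 vnum 0 = 0" "\<sigma>1 vden 0 = 1" by (simp_all add: \<sigma>1_def)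
  have m1: "mready \<sigma>1" by (rule mready_frame[OF m]) (rule f1, auto)
  \<comment> \<open>The size bound is preserved because the new numerator and denominator sum up to
    \<open>a * q + p * b + b * q\<close>, at most \<open>(a + b) * (p + q)\<close>. It shows that
    reducing by the cap changes neither of them.\<close>
  let ?I = "\<lambda>y \<tau>. 0 < \<tau> vden 0 \<and> of_nat (\<tau> vnum 0) / of_nat (\<tau> vden 0) = ?s y \<and>
     \<tau> vnum 0 + \<tau> vden 0 \<le> (\<Prod>x<y. pn x j + qn x j)"
  have loop: "?I n (run (For vy vn pAdd) \<sigma>1)"
  proof (rule For_rule'[where I = ?I])
    fix y \<tau> assume y: "y < n" "\<tau> vy 0 = y" and I: "?I y \<tau>"
      and fr: "\<And>x. x \<notin> insert vy (writes pAdd) \<Longrightarrow> \<tau> x = \<sigma>1 x"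
    have fr': "\<tau> x = \<sigma> x" if "x \<notin> {vy, vnum, vden}" for x using fr[of x] f1[of x] that by simp
    have mt: "mready \<tau>" by (rule mready_frame[OF m]) (rule fr', auto)
    have uvt: "\<tau> vu 0 = u" "\<tau> vv 0 = v" "\<tau> vS 0 = S" "\<tau> vj 0 = j"
      using fr'[of vu] fr'[of vv] fr'[of vS] fr'[of vj] uvS j by simp_all
    have mem: "eval memE \<tau> \<noteq> 0 \<longleftrightarrow> ?in y"
      using uvt uvS y by (intro eval_memE mt) auto
    let ?p = "pn y j" and ?q = "qn y j" and ?a = "\<tau> vnum 0" and ?b = "\<tau> vden 0"
    have q0: "0 < ?q" and wq: "w y j = of_nat ?p / of_nat ?q" using w_quotient[OF y(1) j(2)] by auto
    have P: "(?a + ?b) * (?p + ?q) \<le> (\<Prod>x<Suc y. pn x j + qn x j)" using I by (simp add: mult_le_mono)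
    have "(\<Prod>x<Suc y. pn x j + qn x j) < CAP" using y j by (intro prod_pq_le) auto
    then have lt: "?a * ?q + ?p * ?b < CAP" "?b * ?q < CAP" "?a * ?q + ?p * ?b + ?b * ?q \<le> (\<Prod>x<Suc y. pn x j + qn x j)"
      using P by (simp_all add: algebra_simps)
    show "?I (Suc y) (upd (run pAdd \<tau>) vy 0 (Suc y))"
    proof (cases "?in y")
      case False
      then have r: "run pAdd \<tau> = \<tau>" using mem by (simp add: pAdd_def)
      have "{x. x < Suc y \<and> ?in x} = {x. x < y \<and> ?in x}" using False by (auto simp: less_Suc_eq)
      moreover have "?a + ?b \<le> (\<Prod>x<Suc y. pn x j + qn x j)"
      proof -
        have "(?a + ?b) * 1 \<le> (?a + ?b) * (?p + ?q)" using q0 by (intro mult_le_mono2) simp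
        then show ?thesis using P unfolding mult_1_right by (rule order_trans)
      qed
      ultimately show ?thesis unfolding r using I by simp
    next
      case True
      have ix: "Suc (4 + n + 2 * (y * d + j)) \<le> length xs" using data_index[OF y(1) j(2)] .
      have e: "eval (Inp dataE) \<tau> = ?p" "eval (Inp (dataE +! Cst 1)) \<tau> = ?q"
        using mreadyD[OF mt] y uvt ix \<iota>_data[OF y(1) j(2)] by (simp_all add: min_absorb1)
      have r: "run pAdd \<tau> = upd (upd \<tau> vnum 0 (?a * ?q + ?p * ?b)) vden 0 (?b * ?q)"
      proof -
        have "eval (Inp (dataE +! Cst 1)) (upd \<tau> vnum 0 z) = ?q" for z
          using mreadyD[OF mt] y uvt ix \<iota>_data[OF y(1) j(2)] by (simp add: min_absorb1)
        then show ?thesis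
          using mem True e lt mreadyD(2)[OF mt] by (simp add: pAdd_def del: eval.simps(2))
      qed
      have "{x. x < Suc y \<and> ?in x} = insert y {x. x < y \<and> ?in x}" using True by (auto simp: less_Suc_eq)
      then have "?s (Suc y) = w y j + ?s y" by simp
      also have "\<dots> = of_nat (?a * ?q + ?p * ?b) / of_nat (?b * ?q)"
      proof -
        have "0 < ?b" "?s y = of_nat ?a / of_nat ?b" using I by simp_all
        then show ?thesis using q0 by (simp add: wq field_simps)
      qed
      finally show ?thesis unfolding r using I q0 lt(3) by simp
    qed
  next
    show "?I 0 (upd \<sigma>1 vy 0 0)" using i1 by simp
  qed (use mreadyD[OF m1] in simp_all)
  define \<sigma>2 where "\<sigma>2 = run (For vy vn pAdd) \<sigma>1"
  have f2: "\<sigma>2 vfe 0 = \<sigma> vfe 0"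
    unfolding \<sigma>2_def using f1[of vfe] by (subst run_frame) simp_all
  have r: "run pCoord \<sigma> = (if \<sigma>2 vnum 0 - \<sigma>2 vden 0 \<noteq> 0 then upd \<sigma>2 vfe 0 0 else \<sigma>2)"
    by (simp add: pCoord_def \<sigma>2_def \<sigma>1_def)
  have "?s n \<le> 1 \<longleftrightarrow> \<sigma>2 vnum 0 \<le> \<sigma>2 vden 0"
    using loop unfolding \<sigma>2_def[symmetric] by (metis divide_le_eq_1_pos of_nat_0_less_iff of_nat_le_iff)
  then show ?thesis using f2 by (simp add: r)
qed

lemma run_load:
  assumes m: "mready \<sigma>" and uvS: "\<sigma> vu 0 = u" "\<sigma> vv 0 = v" "\<sigma> vS 0 = S" "u < N" "v < N" "S < 2 ^ k"
  shows "run pLoad \<sigma> vfe 0 = of_bool (feas (u, v) (set_decode S))"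
proof -
  let ?P = "\<lambda>j. (\<Sum>x | x < n \<and> inbin (u, v) (set_decode S) x. w x j) \<le> 1"
  let ?I = "\<lambda>i \<tau>. \<tau> vfe 0 = of_bool (\<forall>j<i. ?P j)"
  have "?I d (run pLoad \<sigma>)"
    unfolding pLoad_def run.simps(3)
  proof (rule For_rule'[where I = ?I])
    fix i \<tau> assume i: "i < d" "\<tau> vj 0 = i" and I: "?I i \<tau>"
      and fr: "\<And>x. x \<notin> insert vj (writes pCoord) \<Longrightarrow> \<tau> x = run (setv vfe (Cst 1)) \<sigma> x"
    have fr': "\<tau> x = \<sigma> x" if "x \<notin> {vj, vnum, vden, vy, vfe}" for x using fr[of x] that by simp
    have mt: "mready \<tau>" by (rule mready_frame[OF m]) (rule fr', auto)
    have "run pCoord \<tau> vfe 0 = (if ?P i then \<tau> vfe 0 else 0)"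
      using fr'[of vu] fr'[of vv] fr'[of vS] uvS i by (intro run_coord mt) simp_all
    then show "?I (Suc i) (upd (run pCoord \<tau>) vj 0 (Suc i))"
      using I by (auto simp: less_Suc_eq)
  qed (use mreadyD[OF m] in simp_all)
  then show ?thesis by (simp add: feas_def)
qed

lemma run_entry:
  assumes m: "mready \<sigma>" and uvS: "\<sigma> vu 0 = u" "\<sigma> vv 0 = v" "\<sigma> vS 0 = S" "u < N" "v < N" "S < 2 ^ k"
  shows "run pEntry \<sigma> vG = (\<sigma> vG)((u * N + v) * 2 ^ k + S := code (gg (u, v) (set_decode S)))"
proof -
  define \<sigma>1 where "\<sigma>1 = run pDraw \<sigma>"
  define \<sigma>2 where "\<sigma>2 = run pLoad \<sigma>1"
  have f1: "\<sigma>1 x = \<sigma> x" if "x \<notin> {vx, vbb}" for x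
    unfolding \<sigma>1_def by (rule run_frame) (use that in simp)
  have f2: "\<sigma>2 x = \<sigma>1 x" if "x \<notin> {vfe, vj, vnum, vden, vy}" for x
    unfolding \<sigma>2_def by (rule run_frame) (use that in simp)
  have m1: "mready \<sigma>1" by (rule mready_frame[OF m]) (rule f1, auto)
  have m2: "mready \<sigma>2" by (rule mready_frame[OF m1]) (rule f2, auto)
  have x: "\<sigma>2 vx 0 = code (rnd (2 ^ jj) f ((u * N + v) * 2 ^ k + S))"
    using run_draw[OF m uvS] by (simp add: f2 \<sigma>1_def)
  have fe: "\<sigma>2 vfe 0 = of_bool (feas (u, v) (set_decode S))"
    unfolding \<sigma>2_def using uvS by (intro run_load m1) (simp_all add: f1)
  have r: "run pEntry \<sigma> = run (Cond (Vr vfe) (Store vG idxE (Vr vx)) (Store vG idxE (Cst 0))) \<sigma>2"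
    by (simp add: pEntry_def \<sigma>1_def \<sigma>2_def)
  show ?thesis
    unfolding r using fe x mreadyD[OF m2] uvS by (simp add: gg_def f1 f2)
qed

definition wdone :: "nat \<Rightarrow> nat \<Rightarrow> nat \<Rightarrow> st \<Rightarrow> bool" where
  "wdone u v s \<tau> \<longleftrightarrow> (\<forall>u'<N. \<forall>v'<N. \<forall>S<2 ^ k. u' < u \<or> u' = u \<and> v' < v \<or> u' = u \<and> v' = v \<and> S < s \<longrightarrow>
     \<tau> vG ((u' * N + v') * 2 ^ k + S) = code (gg (u', v') (set_decode S)))"

lemma wdone_cong: "wdone u v s \<tau> \<Longrightarrow> \<tau>' vG = \<tau> vG \<Longrightarrow> wdone u v s \<tau>'"
  by (simp add: wdone_def)

lemma wdone_step: "wdone u v (2 ^ k) \<tau> \<Longrightarrow> wdone u (Suc v) 0 \<tau>" "wdone u N 0 \<tau> \<Longrightarrow> wdone (Suc u) 0 0 \<tau>"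
  unfolding wdone_def by (auto simp: less_Suc_eq)

lemma run_weights:
  assumes m: "mready \<sigma>"
  shows "wdone N 0 0 (run pWeights \<sigma>)"
  unfolding pWeights_def
proof (rule For_rule'[where I = "\<lambda>u. wdone u 0 0"])
  fix u \<tau> assume u: "u < N" "\<tau> vu 0 = u" and I: "wdone u 0 0 \<tau>"
    and fr: "\<And>x. x \<notin> insert vu (writes (For vv vN (For vS vK2 pEntry))) \<Longrightarrow> \<tau> x = \<sigma> x"
  have m1: "mready \<tau>" by (rule mready_frame[OF m]) (rule fr, auto)
  have "wdone u N 0 (run (For vv vN (For vS vK2 pEntry)) \<tau>)"
  proof (rule For_rule'[where I = "\<lambda>v. wdone u v 0"])
    fix v \<rho> assume v: "v < N" "\<rho> vv 0 = v" and J: "wdone u v 0 \<rho>"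
      and fr2: "\<And>x. x \<notin> insert vv (writes (For vS vK2 pEntry)) \<Longrightarrow> \<rho> x = \<tau> x"
    have m2: "mready \<rho>" by (rule mready_frame[OF m1]) (rule fr2, auto)
    have "wdone u v (2 ^ k) (run (For vS vK2 pEntry) \<rho>)"
    proof (rule For_rule'[where I = "wdone u v"])
      fix s \<theta> assume s: "s < 2 ^ k" "\<theta> vS 0 = s" and K: "wdone u v s \<theta>"
        and fr3: "\<And>x. x \<notin> insert vS (writes pEntry) \<Longrightarrow> \<theta> x = \<rho> x"
      have m3: "mready \<theta>" by (rule mready_frame[OF m2]) (rule fr3, auto)
      have "run pEntry \<theta> vG = (\<theta> vG)((u * N + v) * 2 ^ k + s := code (gg (u, v) (set_decode s)))"
        using u v s fr3[of vu] fr3[of vv] fr2[of vu] by (intro run_entry m3) simp_all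
      then show "wdone u v (Suc s) (upd (run pEntry \<theta>) vS 0 (Suc s))"
        using K v s by (auto simp: wdone_def less_Suc_eq index3_eq)
    qed (use J mreadyD[OF m2] in \<open>simp_all add: wdone_def\<close>)
    then have "wdone u (Suc v) 0 (run (For vS vK2 pEntry) \<rho>)" by (rule wdone_step)
    then show "wdone u (Suc v) 0 (upd (run (For vS vK2 pEntry) \<rho>) vv 0 (Suc v))"
      by (rule wdone_cong) simp
  qed (use I mreadyD[OF m1] in \<open>simp_all add: wdone_def\<close>)
  then have "wdone (Suc u) 0 0 (run (For vv vN (For vS vK2 pEntry)) \<tau>)" by (rule wdone_step)
  then show "wdone (Suc u) 0 0 (upd (run (For vv vN (For vS vK2 pEntry)) \<tau>) vu 0 (Suc u))"
    by (rule wdone_cong) simp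
qed (use mreadyD[OF m] in \<open>simp_all add: wdone_def\<close>)

text \<open>Progress of the four nested loops: earlier pairs are fully transformed, later ones
  untouched, and at the current pair the codes below \<open>s\<close> are one coordinate
  ahead.\<close>

definition zst :: "nat \<Rightarrow> nat \<Rightarrow> nat \<Rightarrow> nat \<Rightarrow> st \<Rightarrow> bool" where
  "zst u v i s \<tau> \<longleftrightarrow> (\<forall>u'<N. \<forall>v'<N. \<forall>Z<2 ^ k. \<tau> vG ((u' * N + v') * 2 ^ k + Z) =
     code (zsum (if u' < u \<or> u' = u \<and> v' < v then k else if u' = u \<and> v' = v then if Z < s then Suc i else i else 0)
       (gg (u', v')) (set_decode Z)))"

lemma zst_cong: "zst u v i s \<tau> \<Longrightarrow> \<tau>' vG = \<tau> vG \<Longrightarrow> zst u v i s \<tau>'"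
  by (simp add: zst_def)

lemma zst_step:
  "zst u v i (2 ^ k) \<tau> \<Longrightarrow> zst u v (Suc i) 0 \<tau>" "zst u v k 0 \<tau> \<Longrightarrow> zst u (Suc v) 0 0 \<tau>"
  "zst u N 0 0 \<tau> \<Longrightarrow> zst (Suc u) 0 0 0 \<tau>"
proof -
  have a: "zsum (if A then k else if B then if Z < 2 ^ k then Suc i else i else 0) = zsum (if A then k else if B then Suc i else 0)"
    if "Z < 2 ^ k" for A B and Z :: nat using that by simp
  show "zst u v i (2 ^ k) \<tau> \<Longrightarrow> zst u v (Suc i) 0 \<tau>" unfolding zst_def by (simp add: a cong: if_cong)
  have b: "(u' < u \<or> u' = u \<and> v' < Suc v) \<longleftrightarrow> (u' < u \<or> u' = u \<and> v' < v) \<or> u' = u \<and> v' = v" for u' v' by auto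
  show "zst u v k 0 \<tau> \<Longrightarrow> zst u (Suc v) 0 0 \<tau>" unfolding zst_def b
    by (elim all_forward imp_forward) (auto simp: if_distrib split: if_splits)
  assume z: "zst u N 0 0 \<tau>"
  show "zst (Suc u) 0 0 0 \<tau>"
    unfolding zst_def
  proof (intro allI impI)
    fix u' v' Z :: nat assume *: "u' < N" "v' < N" "Z < 2 ^ k"
    then have "\<tau> vG ((u' * N + v') * 2 ^ k + Z) =
      code (zsum (if u' < Suc u then k else 0) (gg (u', v')) (set_decode Z))"
      using z by (auto simp: zst_def less_Suc_eq)
    then show "\<tau> vG ((u' * N + v') * 2 ^ k + Z) =
      code (zsum (if u' < Suc u \<or> u' = Suc u \<and> v' < 0 then k
        else if u' = Suc u \<and> v' = 0 then if Z < 0 then Suc 0 else 0 else 0) (gg (u', v')) (set_decode Z))"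
      by simp
  qed
qed

lemma code_zsum_less: "code (zsum i (gg e) Z) < fsz jj"
  unfolding zsum_def by (intro code_sum_less code_gg_less)

lemma run_fold:
  assumes m: "mready \<sigma>" and uv: "\<sigma> vu 0 = u" "\<sigma> vv 0 = v" "u < N" "v < N"
    and i: "\<sigma> vii 0 = i" "i < k" and s: "\<sigma> vS 0 = s" "s < 2 ^ k" and z: "zst u v i s \<sigma>"
  shows "zst u v i (Suc s) (run pFold \<sigma>)"
proof -
  let ?p = "u * N + v"
  have G: "\<sigma> vG (?p * 2 ^ k + Z) = code (zsum (if Z < s then Suc i else i) (gg (u, v)) (set_decode Z))"
    if "Z < 2 ^ k" for Z using z that uv by (simp add: zst_def)
  have "run pFold \<sigma> vG = (\<sigma> vG)(?p * 2 ^ k + s := code (zsum (Suc i) (gg (u, v)) (set_decode s)))"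
  proof (cases "odd (s div 2 ^ i)")
    case False
    then have "i \<notin> set_decode s" by (simp add: set_decode_def)
    then have "zsum (Suc i) (gg (u, v)) (set_decode s) = zsum i (gg (u, v)) (set_decode s)"
      by (simp add: zsum_Suc)
    moreover have "run pFold \<sigma> = \<sigma>" using mreadyD[OF m] i s False by (simp add: pFold_def even_iff_mod_2_eq_zero)
    ultimately show ?thesis using G[OF s(2)] by (simp add: fun_upd_idem)
  next
    case True
    have isd: "i \<in> set_decode s" using True by (simp add: set_decode_def)
    note sd = set_decode_sub[OF True]
    have "(0::nat) < 2 ^ i" by simp
    then have lt: "s - 2 ^ i < s" using sd(2) by linarith
    then have lt2: "s - 2 ^ i < 2 ^ k" using s by linarith
    \<comment> \<open>The smaller code is already at stage \<open>Suc i\<close>, but for a set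
      without \<open>i\<close> both stages have the same sum.\<close>
    have G2: "\<sigma> vG (?p * 2 ^ k + (s - 2 ^ i)) = code (zsum i (gg (u, v)) (set_decode s - {i}))"
      using G[OF lt2] lt sd(1) by (simp add: zsum_Suc)
    have G1: "\<sigma> vG (?p * 2 ^ k + s) = code (zsum i (gg (u, v)) (set_decode s))" using G[OF s(2)] by simp
    have X: "\<sigma> vX (\<sigma> vG (?p * 2 ^ k + s) * Q + \<sigma> vG (?p * 2 ^ k + (s - 2 ^ i))) =
        code (zsum (Suc i) (gg (u, v)) (set_decode s))"
      unfolding G1 G2 using isd by (simp add: mready_X[OF m code_zsum_less code_zsum_less] zsum_Suc)
    have "(s div 2 ^ i) mod 2 = 1" using True by (simp add: odd_iff_mod_2_eq_one)
    then show ?thesis using mreadyD[OF m] i s uv X by (simp add: pFold_def)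
  qed
  then show ?thesis using z s uv unfolding zst_def
    by (auto simp: index3_eq less_Suc_eq)
qed

lemma run_zeta:
  assumes m: "mready \<sigma>" and w: "wdone N 0 0 \<sigma>"
  shows "zst N 0 0 0 (run pZeta \<sigma>)"
  unfolding pZeta_def
proof (rule For_rule'[where I = "\<lambda>u. zst u 0 0 0"])
  fix u \<tau> assume u: "u < N" "\<tau> vu 0 = u" and I: "zst u 0 0 0 \<tau>"
    and fr: "\<And>x. x \<notin> insert vu (writes (For vv vN (For vii vks (For vS vK2 pFold)))) \<Longrightarrow> \<tau> x = \<sigma> x"
  have m1: "mready \<tau>" by (rule mready_frame[OF m]) (rule fr, auto)
  have "zst u N 0 0 (run (For vv vN (For vii vks (For vS vK2 pFold))) \<tau>)"
  proof (rule For_rule'[where I = "\<lambda>v. zst u v 0 0"])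
    fix v \<rho> assume v: "v < N" "\<rho> vv 0 = v" and J: "zst u v 0 0 \<rho>"
      and fr2: "\<And>x. x \<notin> insert vv (writes (For vii vks (For vS vK2 pFold))) \<Longrightarrow> \<rho> x = \<tau> x"
    have m2: "mready \<rho>" by (rule mready_frame[OF m1]) (rule fr2, auto)
    have "zst u v k 0 (run (For vii vks (For vS vK2 pFold)) \<rho>)"
    proof (rule For_rule'[where I = "\<lambda>i. zst u v i 0"])
      fix i \<theta> assume i: "i < k" "\<theta> vii 0 = i" and K: "zst u v i 0 \<theta>"
        and fr3: "\<And>x. x \<notin> insert vii (writes (For vS vK2 pFold)) \<Longrightarrow> \<theta> x = \<rho> x"
      have m3: "mready \<theta>" by (rule mready_frame[OF m2]) (rule fr3, auto)
      have "zst u v i (2 ^ k) (run (For vS vK2 pFold) \<theta>)"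
      proof (rule For_rule'[where I = "zst u v i"])
        fix s \<eta> assume s: "s < 2 ^ k" "\<eta> vS 0 = s" and K: "zst u v i s \<eta>"
          and fr4: "\<And>x. x \<notin> insert vS (writes pFold) \<Longrightarrow> \<eta> x = \<theta> x"
        have m4: "mready \<eta>" by (rule mready_frame[OF m3]) (rule fr4, auto)
        have "zst u v i (Suc s) (run pFold \<eta>)"
          using K s i v u fr4[of vu] fr4[of vv] fr4[of vii] fr3[of vu] fr3[of vv] fr2[of vu]
          by (intro run_fold m4) simp_all
        then show "zst u v i (Suc s) (upd (run pFold \<eta>) vS 0 (Suc s))" by (rule zst_cong) simp
      qed (use zst_cong[OF K] mreadyD[OF m3] in simp_all)
      then have "zst u v (Suc i) 0 (run (For vS vK2 pFold) \<theta>)" by (rule zst_step)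
      then show "zst u v (Suc i) 0 (upd (run (For vS vK2 pFold) \<theta>) vii 0 (Suc i))" by (rule zst_cong) simp
    qed (use zst_cong[OF J] mreadyD[OF m2] in simp_all)
    then have "zst u (Suc v) 0 0 (run (For vii vks (For vS vK2 pFold)) \<rho>)" by (rule zst_step)
    then show "zst u (Suc v) 0 0 (upd (run (For vii vks (For vS vK2 pFold)) \<rho>) vv 0 (Suc v))" by (rule zst_cong) simp
  qed (use zst_cong[OF I] mreadyD[OF m1] in simp_all)
  then have "zst (Suc u) 0 0 0 (run (For vv vN (For vii vks (For vS vK2 pFold))) \<tau>)" by (rule zst_step)
  then show "zst (Suc u) 0 0 0 (upd (run (For vv vN (For vii vks (For vS vK2 pFold))) \<tau>) vu 0 (Suc u))"
    by (rule zst_cong) simp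
next
  show "zst 0 0 0 0 (upd \<sigma> vu 0 0)" using w by (simp add: zst_def wdone_def zsum_0)
qed (use mreadyD[OF m] in simp_all)

end

section \<open>The program for summing hafnians by symmetric elimination\<close>

abbreviation (input) "vtot \<equiv> 42::nat"
abbreviation (input) "vZ \<equiv> 43::nat"
abbreviation (input) "vMx \<equiv> 44::nat"
abbreviation (input) "val \<equiv> 45::nat"
abbreviation (input) "vacc \<equiv> 46::nat"
abbreviation (input) "vp \<equiv> 47::nat"
abbreviation (input) "vrr \<equiv> 48::nat"
abbreviation (input) "vpv \<equiv> 49::nat"
abbreviation (input) "viv \<equiv> 50::nat"
abbreviation (input) "vout \<equiv> 51::nat"
abbreviation (input) "vtt \<equiv> 52::nat"

abbreviation (input) "mxE e e' \<equiv> e *! Vr vN +! e'"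
abbreviation (input) "Mx e e' \<equiv> Arr vMx (mxE e e')"

definition pFill :: prog where
  "pFill = Cond (Vr vv -! Vr vu) (Store vMx (mxE (Vr vu) (Vr vv)) (Arr vG (mxE (Vr vu) (Vr vv) *! Vr vK2 +! Vr vZ)))
    (Cond (Vr vu -! Vr vv) (Store vMx (mxE (Vr vu) (Vr vv)) (Arr vG (mxE (Vr vv) (Vr vu) *! Vr vK2 +! Vr vZ)))
      (Store vMx (mxE (Vr vu) (Vr vv)) (Cst 0)))"

definition pMatrix :: prog where
  "pMatrix = For vu vN (Store val (Vr vu) (Cst 1) ;; For vv vN pFill)"

text \<open>The initial value \<open>vN\<close> is no vertex and remains exactly if the row vanishes
  on all remaining vertices.\<close>

definition pPivot :: prog where
  "pPivot = setv vrr (Vr vN) ;; For vy vN (Cond (Arr val (Vr vy) *! Mx (Vr vp) (Vr vy)) (setv vrr (Vr vy)) Nop)"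

text \<open>An exhaustive search through one row of the multiplication table is affordable, since
  the field has polynomial size.\<close>

definition pInvert :: prog where
  "pInvert = For vtt vq (Cond (Cst 1 -! neqE (MT (Vr vpv) (Vr vtt)) (Cst 1)) (setv viv (Vr vtt)) Nop)"

text \<open>The two pivot rows enter every new entry. Their vertices are already marked dead, so
  they are not overwritten and the update can work in place.\<close>

definition pUpdate :: prog where
  "pUpdate = For vu vN (For vv vN (Cond (Arr val (Vr vu) *! Arr val (Vr vv))
     (Store vMx (mxE (Vr vu) (Vr vv)) (XT (Mx (Vr vu) (Vr vv)) (MT (Vr viv)
       (XT (MT (Mx (Vr vp) (Vr vu)) (Mx (Vr vrr) (Vr vv))) (MT (Mx (Vr vp) (Vr vv)) (Mx (Vr vrr) (Vr vu))))))) Nop))"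

definition pStep :: prog where
  "pStep = setv vpv (Mx (Vr vp) (Vr vrr)) ;; setv vacc (MT (Vr vacc) (Vr vpv)) ;; pInvert ;;
     Store val (Vr vp) (Cst 0) ;; Store val (Vr vrr) (Cst 0) ;; pUpdate"

text \<open>A row without pivot makes the hafnian zero. The accumulator is then zero and stays so,
  and the elimination simply goes on without a special exit.\<close>

definition pRow :: prog where
  "pRow = Cond (Arr val (Vr vp)) (pPivot ;; Cond (Vr vN -! Vr vrr) pStep (setv vacc (Cst 0) ;; Store val (Vr vp) (Cst 0))) Nop"

definition pElim :: prog where "pElim = setv vacc (Cst 1) ;; For vp vN pRow"

definition pTerm :: prog where
  "pTerm = pMatrix ;; pElim ;; setv vtot (XT (Vr vtot) (Vr vacc))"

text \<open>If there are more than \<open>vN\<close> large items, those of rank at least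
  \<open>vN\<close> correspond to no vertex and the sieve would overlook them; this case is rejected
  at the end.\<close>

definition pMain :: prog where
  "pMain = pWeights ;; pZeta ;; setv vtot (Cst 0) ;; For vZ vK2 pTerm ;;
     Cond (Vr vm -! Vr vN) (setv vout (Cst 0)) (setv vout (Vr vtot))"

lemma writes_main [simp]:
  "writes pFill = {vMx}" "writes pMatrix = {vu, val, vv, vMx}" "writes pPivot = {vrr, vy}" "writes pInvert = {vtt, viv}"
  "writes pUpdate = {vu, vv, vMx}" "writes pStep = {vpv, vacc, vtt, viv, val, vu, vv, vMx}"
  "writes pRow = {vrr, vy, vpv, vacc, vtt, viv, val, vu, vv, vMx}"
  "writes pElim = {vp, vrr, vy, vpv, vacc, vtt, viv, val, vu, vv, vMx}"
  "writes pTerm = {vtot, vp, vrr, vy, vpv, vacc, vtt, viv, val, vu, vv, vMx}"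
  by (auto simp: pFill_def pMatrix_def pPivot_def pInvert_def pUpdate_def pStep_def pRow_def pElim_def pTerm_def)

section \<open>Correctness of the elimination and of the main stage\<close>

context vbp_main
begin

definition gdone :: "st \<Rightarrow> bool" where
  "gdone \<sigma> \<longleftrightarrow> (\<forall>u<N. \<forall>v<N. \<forall>Z<2 ^ k. \<sigma> vG ((u * N + v) * 2 ^ k + Z) = code (zsum k (gg (u, v)) (set_decode Z)))"

definition a0 :: "nat set \<Rightarrow> nat \<Rightarrow> nat \<Rightarrow> gf" where
  "a0 Z u v = (if u = v then 0 else zsum k (gg (ed u v)) Z)"

definition matok :: "(nat \<Rightarrow> nat \<Rightarrow> gf) \<Rightarrow> nat set \<Rightarrow> st \<Rightarrow> bool" where
  "matok a V \<tau> \<longleftrightarrow> (\<forall>u\<in>V. \<forall>v\<in>V. \<tau> vMx (u * N + v) = code (a u v))"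

definition alive :: "nat set \<Rightarrow> st \<Rightarrow> bool" where
  "alive V \<tau> \<longleftrightarrow> (\<forall>u<N. \<tau> val u = of_bool (u \<in> V))"

definition good :: "(nat \<Rightarrow> nat \<Rightarrow> gf) \<Rightarrow> bool" where
  "good a \<longleftrightarrow> (\<forall>x y. a x y = a y x) \<and> (\<forall>x. a x x = 0) \<and> (\<forall>x y. code (a x y) < fsz jj)"

definition schur :: "(nat \<Rightarrow> nat \<Rightarrow> gf) \<Rightarrow> nat \<Rightarrow> nat \<Rightarrow> nat \<Rightarrow> nat \<Rightarrow> gf" where
  "schur a p r x y = a x y + inverse (a p r) * (a p x * a r y + a p y * a r x)"

lemma goodD: "good a \<Longrightarrow> a x y = a y x" "good a \<Longrightarrow> a x x = 0" "good a \<Longrightarrow> code (a x y) < fsz jj"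
  by (auto simp: good_def)

lemma good_a0: "good (a0 Z)"
  by (auto simp: good_def a0_def ed_sym code_zsum_less)

lemma good_schur: "good a \<Longrightarrow> good (schur a p r)"
proof -
  assume g: "good a"
  have "schur a p r x y = schur a p r y x" for x y
    using goodD(1)[OF g, of x y] by (simp add: schur_def ac_simps)
  moreover have "schur a p r x x = 0" for x
    using goodD(2)[OF g] by (simp add: schur_def)
  moreover have "code (schur a p r x y) < fsz jj" for x y
    unfolding schur_def by (intro code_add_less code_mult_less code_inverse_less goodD(3)[OF g])
  ultimately show ?thesis unfolding good_def by blast
qed

lemma matok_cong: "matok a V \<tau> \<Longrightarrow> \<tau>' vMx = \<tau> vMx \<Longrightarrow> matok a V \<tau>'"
  by (simp add: matok_def)

lemma alive_cong: "alive V \<tau> \<Longrightarrow> \<tau>' val = \<tau> val \<Longrightarrow> alive V \<tau>'"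
  by (simp add: alive_def)

lemma run_matrix:
  assumes m: "mready \<sigma>" and g: "gdone \<sigma>" and z: "\<sigma> vZ 0 = z" "z < 2 ^ k"
  shows "matok (a0 (set_decode z)) {..<N} (run pMatrix \<sigma>)" "alive {..<N} (run pMatrix \<sigma>)"
proof -
  let ?a = "a0 (set_decode z)"
  let ?I = "\<lambda>i j \<tau>. (\<forall>u<N. \<forall>v<N. u < i \<or> u = i \<and> v < j \<longrightarrow> \<tau> vMx (u * N + v) = code (?a u v)) \<and>
     (\<forall>u<N. u < i \<longrightarrow> \<tau> val u = 1)"
  let ?b = "Store val (Vr vu) (Cst 1) ;; For vv vN pFill"
  have "?I N 0 (run pMatrix \<sigma>)"
    unfolding pMatrix_def
  proof (rule For_rule'[where I = "\<lambda>i. ?I i 0"])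
    fix i \<tau> assume i: "i < N" "\<tau> vu 0 = i" and I: "?I i 0 \<tau>"
      and fr: "\<And>x. x \<notin> insert vu (writes ?b) \<Longrightarrow> \<tau> x = \<sigma> x"
    define \<tau>1 where "\<tau>1 = upd \<tau> val i 1"
    have f1: "\<tau>1 x = \<sigma> x" if "x \<notin> {vu, vv, val, vMx}" for x using that fr[of x] by (simp add: \<tau>1_def)
    have m1: "mready \<tau>1" by (rule mready_frame[OF m]) (rule f1, auto)
    have "?I i N (run (For vv vN pFill) \<tau>1)"
    proof (rule For_rule'[where I = "?I i"])
      fix j \<rho> assume j: "j < N" "\<rho> vv 0 = j" and J: "?I i j \<rho>"
        and fr2: "\<And>x. x \<notin> insert vv (writes pFill) \<Longrightarrow> \<rho> x = \<tau>1 x"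
      have f2: "\<rho> x = \<sigma> x" if "x \<notin> {vu, vv, val, vMx}" for x using that fr2[of x] f1[OF that] by simp
      have m2: "mready \<rho>" by (rule mready_frame[OF m]) (rule f2, auto)
      have u: "\<rho> vu 0 = i" using fr2[of vu] i by (simp add: \<tau>1_def)
      have G: "\<rho> vG ((u * N + v) * 2 ^ k + z) = code (zsum k (gg (u, v)) (set_decode z))" if "u < N" "v < N" for u v
        using g f2[of vG] that z by (simp add: gdone_def)
      have r: "run pFill \<rho> = upd \<rho> vMx (i * N + j) (code (?a i j))"
        using mreadyD[OF m2] j u i z f2[of vZ] G
        by (cases i j rule: linorder_cases) (simp_all add: pFill_def a0_def ed_def)
      show "?I i (Suc j) (upd (run pFill \<rho>) vv 0 (Suc j))"
        unfolding r using J i j by (auto simp: pair_index_eq less_Suc_eq)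
    qed (use I mreadyD[OF m1] in \<open>auto simp: \<tau>1_def\<close>)
    moreover have "run (For vv vN pFill) \<tau>1 val = \<tau>1 val" by (rule run_frame) simp
    then have "run (For vv vN pFill) \<tau>1 val i = 1" by (simp add: \<tau>1_def)
    ultimately have "?I (Suc i) 0 (run (For vv vN pFill) \<tau>1)" by (auto simp: less_Suc_eq)
    moreover have "run ?b \<tau> = run (For vv vN pFill) \<tau>1" using i by (simp add: \<tau>1_def)
    ultimately show "?I (Suc i) 0 (upd (run ?b \<tau>) vu 0 (Suc i))" by (simp del: run.simps)
  qed (use mreadyD[OF m] in simp_all)
  then show "matok ?a {..<N} (run pMatrix \<sigma>)" "alive {..<N} (run pMatrix \<sigma>)"
    by (simp_all add: matok_def alive_def)
qed

lemma run_pivot: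
  assumes m: "mready \<sigma>" and a: "matok a V \<sigma>" "alive V \<sigma>" and V: "V \<subseteq> {..<N}"
    and p: "\<sigma> vp 0 = p" "p \<in> V"
  shows "if \<exists>y\<in>V. a p y \<noteq> 0 then run pPivot \<sigma> vrr 0 \<in> V \<and> a p (run pPivot \<sigma> vrr 0) \<noteq> 0
    else run pPivot \<sigma> vrr 0 = N"
proof -
  let ?b = "Cond (Arr val (Vr vy) *! Mx (Vr vp) (Vr vy)) (setv vrr (Vr vy)) Nop"
  let ?P = "\<lambda>i y. y < i \<and> y \<in> V \<and> a p y \<noteq> 0"
  let ?I = "\<lambda>i \<tau>. if \<exists>y. ?P i y then \<tau> vrr 0 \<in> V \<and> a p (\<tau> vrr 0) \<noteq> 0 else \<tau> vrr 0 = N"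
  have "?I N (run pPivot \<sigma>)"
    unfolding pPivot_def run.simps(3)
  proof (rule For_rule'[where I = ?I])
    fix i \<tau> assume i: "i < N" "\<tau> vy 0 = i" and I: "?I i \<tau>"
      and fr: "\<And>x. x \<notin> insert vy (writes ?b) \<Longrightarrow> \<tau> x = run (setv vrr (Vr vN)) \<sigma> x"
    have f: "\<tau> x = \<sigma> x" if "x \<notin> {vy, vrr}" for x using fr[of x] that by simp
    have al: "\<tau> val i = of_bool (i \<in> V)" using a(2) f[of val] i by (simp add: alive_def)
    have mx: "i \<in> V \<Longrightarrow> \<tau> vMx (p * N + i) = code (a p i)" using a(1) f[of vMx] p by (simp add: matok_def)
    have vars: "\<tau> vp 0 = p" "\<tau> vN 0 = N" using f p mreadyD[OF m] by simp_all
    show "?I (Suc i) (upd (run ?b \<tau>) vy 0 (Suc i))"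
    proof (cases "i \<in> V \<and> a p i \<noteq> 0")
      case True
      then have r: "run ?b \<tau> = upd \<tau> vrr 0 i" using al mx vars i by simp
      have "\<exists>y. ?P (Suc i) y" using True by (intro exI[of _ i]) simp
      then show ?thesis unfolding r using True by simp
    next
      case False
      then have r: "run ?b \<tau> = \<tau>" using al mx vars i by auto
      have "(\<exists>y. ?P (Suc i) y) \<longleftrightarrow> (\<exists>y. ?P i y)" using False by (auto simp: less_Suc_eq)
      then show ?thesis unfolding r using I by simp
    qed
  qed (use mreadyD[OF m] in simp_all)
  moreover have "(\<exists>y. ?P N y) \<longleftrightarrow> (\<exists>y\<in>V. a p y \<noteq> 0)" using V by auto
  ultimately show ?thesis by simp
qed

lemma run_invert:
  assumes m: "mready \<sigma>" and c: "\<sigma> vpv 0 = code b" "b \<noteq> 0" "code b < fsz jj"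
  shows "run pInvert \<sigma> viv 0 = code (inverse b)"
proof -
  let ?b = "Cond (Cst 1 -! neqE (MT (Vr vpv) (Vr vtt)) (Cst 1)) (setv viv (Vr vtt)) Nop"
  let ?I = "\<lambda>i \<tau>. code (inverse b) < i \<longrightarrow> \<tau> viv 0 = code (inverse b)"
  have "?I (fsz jj) (run pInvert \<sigma>)"
    unfolding pInvert_def
  proof (rule For_rule'[where I = ?I])
    fix i \<tau> assume i: "i < fsz jj" "\<tau> vtt 0 = i" and I: "?I i \<tau>"
      and fr: "\<And>x. x \<notin> insert vtt (writes ?b) \<Longrightarrow> \<tau> x = \<sigma> x"
    have f: "\<tau> x = \<sigma> x" if "x \<notin> {vtt, viv}" for x using fr[of x] that by simp
    have mt: "mready \<tau>" by (rule mready_frame[OF m]) (rule f, auto)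
    have "code (Gf i) = i" by (simp add: Gf_inverse)
    then have T: "\<tau> vT (code b * Q + i) = code (b * Gf i)"
      using mready_T[OF mt c(3), of "Gf i"] i by simp
    have "b * Gf i = 1 \<longleftrightarrow> Gf i = inverse b"
      using c(2) by (metis inverse_unique right_inverse)
    moreover have "Gf i = inverse b \<longleftrightarrow> code (inverse b) = i" by (metis Gf_inverse UNIV_I code_inverse)
    moreover have "code (b * Gf i) = 1 \<longleftrightarrow> b * Gf i = 1" by (metis code_1 code_inject)
    ultimately have iff: "code (b * Gf i) = 1 \<longleftrightarrow> code (inverse b) = i" by simp
    have cond: "Suc 0 \<le> x - Suc 0 + (Suc 0 - x) \<longleftrightarrow> x \<noteq> 1" for x :: nat by arith
    have "run ?b \<tau> = (if code (b * Gf i) = 1 then upd \<tau> viv 0 i else \<tau>)"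
      using f[of vpv] c mreadyD(3)[OF mt] i T by (simp add: cond)
    then show "?I (Suc i) (upd (run ?b \<tau>) vtt 0 (Suc i))"
      using I iff by (auto simp: less_Suc_eq simp del: run.simps)
  qed (use mreadyD[OF m] in simp_all)
  then show ?thesis using code_inverse_less[OF c(3)] by simp
qed

lemma run_update:
  assumes m: "mready \<sigma>" and a: "matok a V \<sigma>" and g: "good a" and V: "V \<subseteq> {..<N}"
    and p: "\<sigma> vp 0 = p" "p \<in> V" and r: "\<sigma> vrr 0 = r" "r \<in> V"
    and V': "V' = V - {p, r}" "alive V' \<sigma>" and iv: "\<sigma> viv 0 = code (inverse (a p r))"
  shows "matok (schur a p r) V' (run pUpdate \<sigma>)"
proof -
  let ?s = "schur a p r"
  let ?b = "Cond (Arr val (Vr vu) *! Arr val (Vr vv))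
     (Store vMx (mxE (Vr vu) (Vr vv)) (XT (Mx (Vr vu) (Vr vv)) (MT (Vr viv)
       (XT (MT (Mx (Vr vp) (Vr vu)) (Mx (Vr vrr) (Vr vv))) (MT (Mx (Vr vp) (Vr vv)) (Mx (Vr vrr) (Vr vu))))))) Nop"
  \<comment> \<open>The invariant ranges over \<open>V\<close>, not only over \<open>V'\<close>: the
    pivot rows have to be known to keep their old entries.\<close>
  let ?I = "\<lambda>i j \<tau>. \<forall>u\<in>V. \<forall>v\<in>V. \<tau> vMx (u * N + v) =
    code (if u \<in> V' \<and> v \<in> V' \<and> (u < i \<or> u = i \<and> v < j) then ?s u v else a u v)"
  have "?I N 0 (run pUpdate \<sigma>)"
    unfolding pUpdate_def
  proof (rule For_rule'[where I = "\<lambda>i. ?I i 0"])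
    fix i \<tau> assume i: "i < N" "\<tau> vu 0 = i" and I: "?I i 0 \<tau>"
      and fr: "\<And>x. x \<notin> insert vu (writes (For vv vN ?b)) \<Longrightarrow> \<tau> x = \<sigma> x"
    have f1: "\<tau> x = \<sigma> x" if "x \<notin> {vu, vv, vMx}" for x using that fr[of x] by simp
    have m1: "mready \<tau>" by (rule mready_frame[OF m]) (rule f1, auto)
    have "?I i N (run (For vv vN ?b) \<tau>)"
    proof (rule For_rule'[where I = "?I i"])
      fix j \<rho> assume j: "j < N" "\<rho> vv 0 = j" and J: "?I i j \<rho>"
        and fr2: "\<And>x. x \<notin> insert vv (writes ?b) \<Longrightarrow> \<rho> x = \<tau> x"
      have f2: "\<rho> x = \<sigma> x" if "x \<notin> {vu, vv, vMx}" for x using that fr2[of x] f1[OF that] by simp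
      have m2: "mready \<rho>" by (rule mready_frame[OF m]) (rule f2, auto)
      have al: "\<rho> val i = of_bool (i \<in> V')" "\<rho> val j = of_bool (j \<in> V')"
        using V'(2) f2[of val] i j by (simp_all add: alive_def)
      have vars: "\<rho> vu 0 = i" "\<rho> vp 0 = p" "\<rho> vrr 0 = r" "\<rho> viv 0 = code (inverse (a p r))"
        using fr2[of vu] i f2 p r iv by simp_all
      show "?I i (Suc j) (upd (run ?b \<rho>) vv 0 (Suc j))"
      proof (cases "i \<in> V' \<and> j \<in> V'")
        case False
        then have e: "run ?b \<rho> = \<rho>" using al vars j by auto
        have "(u \<in> V' \<and> v \<in> V' \<and> (u < i \<or> u = i \<and> v < Suc j)) \<longleftrightarrow>
            (u \<in> V' \<and> v \<in> V' \<and> (u < i \<or> u = i \<and> v < j))" for u v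
          using False by (auto simp: less_Suc_eq)
        then show ?thesis unfolding e using J by simp
      next
        case True
        have iV: "i \<in> V" "j \<in> V" "p \<notin> V'" "r \<notin> V'" using True V'(1) by auto
        have M: "\<rho> vMx (i * N + j) = code (a i j)" "\<rho> vMx (p * N + i) = code (a p i)"
          "\<rho> vMx (p * N + j) = code (a p j)" "\<rho> vMx (r * N + i) = code (a r i)" "\<rho> vMx (r * N + j) = code (a r j)"
          using J iV p r by simp_all
        have c: "code (a x y) < fsz jj" for x y by (rule goodD(3)[OF g])
        have c2: "code (a x y * a x' y') < fsz jj" for x y x' y' by (intro code_mult_less c)
        have ic: "code (inverse (a p r)) < fsz jj" by (intro code_inverse_less c)
        let ?w = "a p i * a r j + a p j * a r i"
        have w: "code ?w < fsz jj" by (intro code_add_less c2)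
        have iw: "code (inverse (a p r) * ?w) < fsz jj" by (intro code_mult_less ic w)
        note T = mready_T[OF m2] and X = mready_X[OF m2]
        have e: "run ?b \<rho> = upd \<rho> vMx (i * N + j) (code (?s i j))"
          using True al vars j mreadyD(3,8)[OF m2]
          by (simp add: M T X c c2 ic w iw schur_def)
        show ?thesis unfolding e
        proof (intro ballI)
          fix u v assume uv: "u \<in> V" "v \<in> V"
          then have "v < N" using V by auto
          then have ix: "u * N + v = i * N + j \<longleftrightarrow> u = i \<and> v = j" using j by (intro pair_index_eq)
          show "upd (upd \<rho> vMx (i * N + j) (code (?s i j))) vv 0 (Suc j) vMx (u * N + v) =
            code (if u \<in> V' \<and> v \<in> V' \<and> (u < i \<or> u = i \<and> v < Suc j) then ?s u v else a u v)"
            using J uv ix True by (cases "u = i \<and> v = j") (auto simp: less_Suc_eq)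
        qed
      qed
    qed (use I mreadyD[OF m1] in simp_all)
    then have "?I (Suc i) 0 (run (For vv vN ?b) \<tau>)"
      using V by (auto simp: less_Suc_eq subset_iff)
    then show "?I (Suc i) 0 (upd (run (For vv vN ?b) \<tau>) vu 0 (Suc i))" by (simp del: run.simps)
  qed (use a mreadyD[OF m] in \<open>simp_all add: matok_def\<close>)
  then show ?thesis using V V'(1) by (auto simp: matok_def subset_iff)
qed

lemma run_step:
  assumes m: "mready \<sigma>" and a: "matok a V \<sigma>" "alive V \<sigma>" and g: "good a" and V: "V \<subseteq> {..<N}"
    and p: "\<sigma> vp 0 = p" "p \<in> V" and r: "\<sigma> vrr 0 = r" "r \<in> V" "a p r \<noteq> 0"
    and acc: "\<sigma> vacc 0 = code \<alpha>" "code \<alpha> < fsz jj"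
  shows "matok (schur a p r) (V - {p, r}) (run pStep \<sigma>)" "alive (V - {p, r}) (run pStep \<sigma>)"
    "run pStep \<sigma> vacc 0 = code (\<alpha> * a p r)"
proof -
  have pr: "p < N" "r < N" using p r V by auto
  define \<sigma>1 where "\<sigma>1 = upd (upd \<sigma> vpv 0 (code (a p r))) vacc 0 (code (\<alpha> * a p r))"
  have M: "\<sigma> vMx (p * N + r) = code (a p r)" using a(1) p r by (simp add: matok_def)
  have "\<sigma> vT (code \<alpha> * Q + code (a p r)) = code (\<alpha> * a p r)" by (rule mready_T[OF m acc(2) goodD(3)[OF g]])
  then have r1: "run (setv vpv (Mx (Vr vp) (Vr vrr)) ;; setv vacc (MT (Vr vacc) (Vr vpv))) \<sigma> = \<sigma>1"
    using mreadyD[OF m] p r acc M by (simp add: \<sigma>1_def)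
  have m1: "mready \<sigma>1" by (rule mready_frame[OF m]) (simp add: \<sigma>1_def)
  define \<sigma>2 where "\<sigma>2 = run pInvert \<sigma>1"
  have f2: "\<sigma>2 x = \<sigma>1 x" if "x \<notin> {vtt, viv}" for x
    unfolding \<sigma>2_def by (rule run_frame) (use that in simp)
  have iv: "\<sigma>2 viv 0 = code (inverse (a p r))"
    unfolding \<sigma>2_def by (rule run_invert[OF m1 _ r(3) goodD(3)[OF g]]) (simp add: \<sigma>1_def)
  define \<sigma>3 where "\<sigma>3 = upd (upd \<sigma>2 val p 0) val r 0"
  have r3: "run (Store val (Vr vp) (Cst 0) ;; Store val (Vr vrr) (Cst 0)) \<sigma>2 = \<sigma>3"
    using p r f2[of vp] f2[of vrr] by (simp add: \<sigma>3_def \<sigma>1_def)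
  have f3: "\<sigma>3 x = \<sigma> x" if "x \<notin> {vpv, vacc, vtt, viv, val}" for x
    using that f2[of x] by (simp add: \<sigma>3_def \<sigma>1_def)
  have m3: "mready \<sigma>3" by (rule mready_frame[OF m]) (rule f3, auto)
  have a3: "alive (V - {p, r}) \<sigma>3" using a(2) f2[of val] by (auto simp: alive_def \<sigma>3_def \<sigma>1_def)
  have r4: "run pStep \<sigma> = run pUpdate \<sigma>3"
    using r1 r3 by (simp add: pStep_def \<sigma>2_def)
  show "matok (schur a p r) (V - {p, r}) (run pStep \<sigma>)"
    unfolding r4
    by (rule run_update[OF m3 matok_cong[OF a(1)] g V _ p(2) _ r(2) refl a3])
      (use f3[of vMx] f3[of vp] f3[of vrr] p r iv in \<open>simp_all add: \<sigma>3_def\<close>)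
  show "alive (V - {p, r}) (run pStep \<sigma>)"
    unfolding r4 by (rule alive_cong[OF a3], rule run_frame) simp
  have "run pUpdate \<sigma>3 vacc = \<sigma>3 vacc" by (rule run_frame) simp
  then show "run pStep \<sigma> vacc 0 = code (\<alpha> * a p r)"
    unfolding r4 using f2[of vacc] by (simp add: \<sigma>3_def \<sigma>1_def)
qed

text \<open>The invariant of the elimination: \<open>h\<close> is the hafnian to be computed.\<close>

definition est :: "gf \<Rightarrow> nat \<Rightarrow> st \<Rightarrow> bool" where
  "est h p \<tau> \<longleftrightarrow> (\<exists>a V \<alpha>. matok a V \<tau> \<and> alive V \<tau> \<and> good a \<and> V \<subseteq> {p..<N} \<and>
     \<tau> vacc 0 = code \<alpha> \<and> code \<alpha> < fsz jj \<and> \<alpha> * haf a V = h)"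

lemma est_cong: "est h p \<tau> \<Longrightarrow> \<tau>' vMx = \<tau> vMx \<Longrightarrow> \<tau>' val = \<tau> val \<Longrightarrow> \<tau>' vacc = \<tau> vacc \<Longrightarrow> est h p \<tau>'"
  by (simp add: est_def matok_def alive_def)

text \<open>A round removes \<open>p\<close> from the remaining vertices, together with its partner
  if there is a pivot, so after \<open>N\<close> rounds the hafnian of the empty set is left.
  Without a pivot \<open>h = 0\<close>, and the invariant holds with accumulator 0 for whatever
  vertices remain.\<close>

lemma run_row:
  assumes m: "mready \<sigma>" and e: "est h p \<sigma>" and p: "\<sigma> vp 0 = p" "p < N"
  shows "est h (Suc p) (run pRow \<sigma>)"
proof -
  obtain a V \<alpha> where a: "matok a V \<sigma>" "alive V \<sigma>" "good a" "V \<subseteq> {p..<N}"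
     "\<sigma> vacc 0 = code \<alpha>" "code \<alpha> < fsz jj" "\<alpha> * haf a V = h"
    using e by (auto simp: est_def)
  have al: "\<sigma> val p = of_bool (p \<in> V)" using a(2) p by (simp add: alive_def)
  have finV: "finite V" "V \<subseteq> {..<N}" using a(4) by (auto intro: finite_subset)
  show ?thesis
  proof (cases "p \<in> V")
    case False
    then have "run pRow \<sigma> = \<sigma>" using al p by (simp add: pRow_def)
    moreover have "V \<subseteq> {Suc p..<N}" using a(4) False by (auto simp: Suc_le_eq le_less)
    ultimately show ?thesis using a unfolding est_def by auto
  next
    case True
    define \<sigma>1 where "\<sigma>1 = run pPivot \<sigma>"
    define r where "r = \<sigma>1 vrr 0"
    have f1: "\<sigma>1 x = \<sigma> x" if "x \<notin> {vrr, vy}" for x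
      unfolding \<sigma>1_def by (rule run_frame) (use that in simp)
    have m1: "mready \<sigma>1" by (rule mready_frame[OF m]) (rule f1, auto)
    have a1: "matok a V \<sigma>1" "alive V \<sigma>1"
      by (rule matok_cong[OF a(1)]; simp add: f1) (rule alive_cong[OF a(2)]; simp add: f1)
    have piv: "if \<exists>y\<in>V. a p y \<noteq> 0 then r \<in> V \<and> a p r \<noteq> 0 else r = N"
      using run_pivot[OF m a(1,2) finV(2) p(1) True] by (simp add: r_def \<sigma>1_def)
    have run: "run pRow \<sigma> = (if N - r \<noteq> 0 then run pStep \<sigma>1 else upd (upd \<sigma>1 vacc 0 0) val p 0)"
      using True al p f1[of vp] mreadyD(8)[OF m1] by (simp add: pRow_def \<sigma>1_def[symmetric] r_def)
    show ?thesis
    proof (cases "\<exists>y\<in>V. a p y \<noteq> 0")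
      case False
      then have "r = N" using piv by simp
      then have run': "run pRow \<sigma> = upd (upd \<sigma>1 vacc 0 0) val p 0" using run by simp
      have "haf a V = 0" using False by (intro haf_zero_row[OF finV(1) True goodD(1)[OF a(3)]]) auto
      then have h: "h = 0" using a(7) by simp
      have "matok a (V - {p}) (run pRow \<sigma>)" using a1(1) by (auto simp: run' matok_def)
      moreover have "alive (V - {p}) (run pRow \<sigma>)" using a1(2) by (auto simp: run' alive_def)
      moreover have "V - {p} \<subseteq> {Suc p..<N}" using a(4) by (auto simp: Suc_le_eq le_less)
      ultimately show ?thesis using h a(3) unfolding est_def
        by (intro exI[of _ a] exI[of _ "V - {p}"] exI[of _ 0]) (simp add: run')
    next
      case ex: True
      then have r: "r \<in> V" "a p r \<noteq> 0" using piv by auto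
      then have "r < N" using finV by auto
      then have run': "run pRow \<sigma> = run pStep \<sigma>1" using run by simp
      note st = run_step[OF m1 a1 a(3) finV(2) _ True _ r _ a(6), folded run']
      have st: "matok (schur a p r) (V - {p, r}) (run pRow \<sigma>)" "alive (V - {p, r}) (run pRow \<sigma>)"
        "run pRow \<sigma> vacc 0 = code (\<alpha> * a p r)"
        using st f1[of vp] f1[of vacc] p a(5) by (simp_all add: r_def)
      have ne: "p \<noteq> r" using r goodD(2)[OF a(3)] by auto
      have "haf a V = a p r * haf (schur a p r) (V - {p, r})"
        unfolding schur_def[abs_def]
        by (rule haf_eliminate[OF finV(1) True r(1) ne goodD(1)[OF a(3)] goodD(2)[OF a(3)] r(2)])
      then have "\<alpha> * a p r * haf (schur a p r) (V - {p, r}) = h" using a(7) by (simp add: mult.assoc)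
      moreover have "V - {p, r} \<subseteq> {Suc p..<N}" using a(4) by (auto simp: Suc_le_eq le_less)
      moreover have "code (\<alpha> * a p r) < fsz jj" by (intro code_mult_less a(6) goodD(3)[OF a(3)])
      ultimately show ?thesis using st good_schur[OF a(3)] unfolding est_def by blast
    qed
  qed
qed

lemma run_elim:
  assumes m: "mready \<sigma>" and a: "matok a {..<N} \<sigma>" "alive {..<N} \<sigma>" "good a"
  shows "run pElim \<sigma> vacc 0 = code (haf a {..<N})" "code (haf a {..<N}) < fsz jj"
proof -
  let ?h = "haf a {..<N}"
  have "est ?h N (run pElim \<sigma>)"
    unfolding pElim_def run.simps(3)
  proof (rule For_rule'[where I = "est ?h"])
    have "(1::nat) < fsz jj" using fsz_ge[of jj] by linarith
    then show "est ?h 0 (upd (run (setv vacc (Cst 1)) \<sigma>) vp 0 0)"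
      using a unfolding est_def
      by (intro exI[of _ a] exI[of _ "{..<N}"] exI[of _ 1]) (auto simp: matok_def alive_def)
  next
    fix i \<tau> assume i: "i < N" "\<tau> vp 0 = i" and I: "est ?h i \<tau>"
      and fr: "\<And>x. x \<notin> insert vp (writes pRow) \<Longrightarrow> \<tau> x = run (setv vacc (Cst 1)) \<sigma> x"
    have mt: "mready \<tau>" by (rule mready_frame[OF m]) (simp add: fr)
    show "est ?h (Suc i) (upd (run pRow \<tau>) vp 0 (Suc i))"
      by (rule est_cong[OF run_row[OF mt I i(2,1)]]) simp_all
  qed (use mreadyD[OF m] in simp_all)
  then obtain \<alpha> where "run pElim \<sigma> vacc 0 = code \<alpha>" "code \<alpha> < fsz jj" "\<alpha> = ?h"
    by (auto simp: est_def haf_empty)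
  then show "run pElim \<sigma> vacc 0 = code ?h" "code ?h < fsz jj" by auto
qed

lemma run_main:
  assumes m: "mready \<sigma>"
  shows "run pMain \<sigma> vout 0 \<noteq> 0 \<longleftrightarrow> card Lg \<le> N \<and>
    (\<Sum>M\<in>pms {..<N}. \<Sum>h\<in>covering {..<k} M. \<Prod>e\<in>M. gg e (h e)) \<noteq> 0"
proof -
  define \<sigma>1 where "\<sigma>1 = run pWeights \<sigma>"
  define \<sigma>2 where "\<sigma>2 = run pZeta \<sigma>1"
  define \<sigma>3 where "\<sigma>3 = upd \<sigma>2 vtot 0 0"
  define \<sigma>4 where "\<sigma>4 = run (For vZ vK2 pTerm) \<sigma>3"
  have m1: "mready \<sigma>1" unfolding \<sigma>1_def by (rule mready_frame[OF m], rule run_frame) auto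
  have m2: "mready \<sigma>2" unfolding \<sigma>2_def by (rule mready_frame[OF m1], rule run_frame) auto
  have m3: "mready \<sigma>3" by (rule mready_frame[OF m2]) (simp add: \<sigma>3_def)
  have m4: "mready \<sigma>4" unfolding \<sigma>4_def by (rule mready_frame[OF m3], rule run_frame) auto
  have "zst N 0 0 0 \<sigma>2"
    unfolding \<sigma>2_def using run_weights[OF m] by (intro run_zeta m1) (simp add: \<sigma>1_def)
  then have g3: "gdone \<sigma>3" by (simp add: zst_def gdone_def \<sigma>3_def)
  let ?h = "\<lambda>z. haf (a0 (set_decode z)) {..<N}"
  let ?I = "\<lambda>i \<tau>. \<tau> vtot 0 = code (\<Sum>z<i. ?h z) \<and> code (\<Sum>z<i. ?h z) < fsz jj"
  have "?I (2 ^ k) \<sigma>4"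
    unfolding \<sigma>4_def
  proof (rule For_rule'[where I = ?I])
    fix i \<tau> assume i: "i < 2 ^ k" "\<tau> vZ 0 = i" and I: "?I i \<tau>"
      and fr: "\<And>x. x \<notin> insert vZ (writes pTerm) \<Longrightarrow> \<tau> x = \<sigma>3 x"
    have mt: "mready \<tau>" by (rule mready_frame[OF m3]) (rule fr, auto)
    have gt: "gdone \<tau>" using g3 fr[of vG] by (simp add: gdone_def)
    define \<tau>1 where "\<tau>1 = run pMatrix \<tau>"
    define \<tau>2 where "\<tau>2 = run pElim \<tau>1"
    have t1: "mready \<tau>1" unfolding \<tau>1_def by (rule mready_frame[OF mt], rule run_frame) auto
    have t2: "mready \<tau>2" unfolding \<tau>2_def by (rule mready_frame[OF t1], rule run_frame) auto
    note e = run_elim[OF t1 run_matrix[OF mt gt i(2,1), folded \<tau>1_def] good_a0, folded \<tau>2_def]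
    have "\<tau>2 vtot = \<tau>1 vtot" unfolding \<tau>2_def by (rule run_frame) simp
    also have "\<dots> = \<tau> vtot" unfolding \<tau>1_def by (rule run_frame) simp
    finally have tot: "\<tau>2 vtot 0 = code (\<Sum>z<i. ?h z)" using I by simp
    have "run pTerm \<tau> = upd \<tau>2 vtot 0 (code ((\<Sum>z<i. ?h z) + ?h i))"
      using tot e mready_X[OF t2 conjunct2[OF I] e(2)] mreadyD(3)[OF t2]
      by (simp add: pTerm_def \<tau>1_def[symmetric] \<tau>2_def[symmetric])
    then show "?I (Suc i) (upd (run pTerm \<tau>) vZ 0 (Suc i))"
      using I e(2) by (simp add: code_add_less)
  qed (use mreadyD[OF m3] in \<open>simp_all add: \<sigma>3_def\<close>)
  then have tot: "\<sigma>4 vtot 0 = code (\<Sum>z<2 ^ k. ?h z)" by simp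
  have "(\<Sum>z<2 ^ k. ?h z) = (\<Sum>Z\<in>Pow {..<k}. haf (a0 Z) {..<N})"
    by (rule sum.reindex_bij_betw[OF bij_betw_set_decode])
  also have "\<dots> = (\<Sum>Z\<in>Pow {..<k}. haf (\<lambda>u v. \<Sum>S\<in>Pow Z. gg (ed u v) S) {..<N})"
    by (intro sum.cong refl haf_cong) (simp add: a0_def zsum_top)
  also have "\<dots> = (\<Sum>M\<in>pms {..<N}. \<Sum>h\<in>covering {..<k} M. \<Prod>e\<in>M. gg e (h e))"
    by (rule sieve) auto
  finally have s: "(\<Sum>z<2 ^ k. ?h z) = \<dots>" .
  have "run pMain \<sigma> = run (Cond (Vr vm -! Vr vN) (setv vout (Cst 0)) (setv vout (Vr vtot))) \<sigma>4"
    by (simp add: pMain_def \<sigma>4_def \<sigma>3_def \<sigma>2_def \<sigma>1_def)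
  then show ?thesis using mreadyD(8,10)[OF m4] tot s by (auto simp del: neq0_conv)
qed

end

subsection \<open>The sieved polynomial\<close>

lemma finite_covering: "finite U \<Longrightarrow> finite M \<Longrightarrow> finite (covering U M)"
  unfolding covering_def by (rule finite_subset[of _ "M \<rightarrow>\<^sub>E Pow U"]) (auto intro!: finite_PiE)

context vbp_run
begin

definition ix :: "nat \<times> nat \<Rightarrow> nat set \<Rightarrow> nat" where
  "ix e S = (fst e * N + snd e) * 2 ^ k + set_encode S"

definition packs :: "((nat \<times> nat) set \<times> (nat \<times> nat \<Rightarrow> nat set)) set" where
  "packs = {(M, h). M \<in> pms {..<N} \<and> h \<in> covering {..<k} M \<and> (\<forall>e\<in>M. feas e (h e))}"

text \<open>A monomial is recorded as its set of variable numbers, one for each edge together with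
  its set. The polynomial is multilinear because the edges of a matching have distinct
  numbers.\<close>

definition monomials :: "nat set set" where
  "monomials = (\<lambda>(M, h). (\<lambda>e. ix e (h e)) ` M) ` packs"

lemma ix_bounds:
  assumes "e \<in> M" "M \<in> pms {..<N}" "h \<in> covering {..<k} M"
  shows "fst e < N" "snd e < N" "set_encode (h e) < 2 ^ k" "h e \<subseteq> {..<k}" "ix e (h e) < N * N * 2 ^ k"
proof -
  show b: "fst e < N" "snd e < N" using in_pmsD[OF assms(2,1)] by auto
  have "h \<in> M \<rightarrow>\<^sub>E Pow {..<k}" using assms(3) by (simp add: covering_def)
  then show "h e \<subseteq> {..<k}" using assms(1) by (auto simp: PiE_iff)
  then show s: "set_encode (h e) < 2 ^ k" by (rule set_encode_less)
  show "ix e (h e) < N * N * 2 ^ k" unfolding ix_def using b s by (intro pair_less_prod)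
qed

lemma ix_eq:
  assumes "e \<in> M" "M \<in> pms {..<N}" "h \<in> covering {..<k} M" "e' \<in> M'" "M' \<in> pms {..<N}" "h' \<in> covering {..<k} M'"
    and "ix e (h e) = ix e' (h' e')"
  shows "e = e'" "h e = h' e'"
proof -
  note b = ix_bounds[OF assms(1-3)] and b' = ix_bounds[OF assms(4-6)]
  have *: "fst e * N + snd e = fst e' * N + snd e' \<and> set_encode (h e) = set_encode (h' e')"
    using assms(7) b(3) b'(3) unfolding ix_def by (subst (asm) pair_index_eq) auto
  then show "e = e'" using b(2) b'(2) by (auto simp: pair_index_eq prod_eq_iff)
  have "finite (h e)" "finite (h' e')" using b(4) b'(4) by (auto intro: finite_subset)
  then show "h e = h' e'" using * by (simp add: set_encode_eq)
qed

lemma inj_on_ix: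
  assumes "M \<in> pms {..<N}" "h \<in> covering {..<k} M"
  shows "inj_on (\<lambda>e. ix e (h e)) M"
  by (rule inj_onI) (rule ix_eq(1)[OF _ assms _ assms])

text \<open>A variable number encodes its edge and its set, so a monomial determines the matching
  and the assignment. Without this, equal monomials could cancel in characteristic two.\<close>

lemma inj_on_monomials: "inj_on (\<lambda>(M, h). (\<lambda>e. ix e (h e)) ` M) packs"
proof (rule inj_onI)
  fix p p' assume p: "p \<in> packs" "p' \<in> packs"
    and eq: "(case p of (M, h) \<Rightarrow> (\<lambda>e. ix e (h e)) ` M) = (case p' of (M, h) \<Rightarrow> (\<lambda>e. ix e (h e)) ` M)"
  obtain M h M' h' where [simp]: "p = (M, h)" "p' = (M', h')" by fastforce
  have m: "M \<in> pms {..<N}" "h \<in> covering {..<k} M" "M' \<in> pms {..<N}" "h' \<in> covering {..<k} M'"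
    using p by (auto simp: packs_def)
  have im: "(\<lambda>e. ix e (h e)) ` M = (\<lambda>e. ix e (h' e)) ` M'" using eq by simp
  have 1: "e \<in> M' \<and> h e = h' e" if e: "e \<in> M" for e
  proof -
    have "ix e (h e) \<in> (\<lambda>e. ix e (h' e)) ` M'" using im e by blast
    then obtain e' where e': "e' \<in> M'" "ix e (h e) = ix e' (h' e')" by blast
    from ix_eq[OF e m(1,2) e'(1) m(3,4) e'(2)] show ?thesis using e'(1) by simp
  qed
  have 2: "e \<in> M" if e: "e \<in> M'" for e
  proof -
    have "ix e (h' e) \<in> (\<lambda>e. ix e (h e)) ` M" using im e by blast
    then obtain e' where e': "e' \<in> M" "ix e (h' e) = ix e' (h e')" by blast
    from ix_eq[OF e m(3,4) e'(1) m(1,2) e'(2)] show ?thesis using e'(1) by simp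
  qed
  have MM: "M = M'" using 1 2 by blast
  have "h \<in> M \<rightarrow>\<^sub>E Pow {..<k}" "h' \<in> M \<rightarrow>\<^sub>E Pow {..<k}" using m MM by (auto simp: covering_def)
  then have "h = h'" using 1 by (intro PiE_ext) auto
  then show "p = p'" using MM by simp
qed

lemma finite_packs: "finite packs"
proof -
  have "finite (covering {..<k} M)" if "M \<in> pms {..<N}" for M
    by (rule finite_covering[OF _ finite_in_pms[OF _ that]]) simp_all
  then have "finite (SIGMA M:pms {..<N}. covering {..<k} M)"
    by (intro finite_SigmaI finite_pms) auto
  then show ?thesis by (rule finite_subset[rotated]) (auto simp: packs_def)
qed

lemma monomials_props:
  "finite monomials" "T \<in> monomials \<Longrightarrow> T \<subseteq> {..<N * N * 2 ^ k} \<and> card T = L"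
proof -
  show "finite monomials" unfolding monomials_def by (intro finite_imageI finite_packs)
  assume "T \<in> monomials"
  then obtain M h where T: "T = (\<lambda>e. ix e (h e)) ` M" and m: "M \<in> pms {..<N}" "h \<in> covering {..<k} M"
    by (auto simp: monomials_def packs_def)
  have "card M = L" using card_pms[OF m(1)] by (simp add: N_def)
  then show "T \<subseteq> {..<N * N * 2 ^ k} \<and> card T = L"
    unfolding T using card_image[OF inj_on_ix[OF m]] ix_bounds(5)[OF _ m] by auto
qed

lemma monomials_nonempty: "monomials \<noteq> {} \<longleftrightarrow>
    (\<exists>M\<in>pms {..<N}. \<exists>h\<in>covering {..<k} M. \<forall>e\<in>M. feas e (h e))"
  by (auto simp: monomials_def packs_def)

end

text \<open>Infeasible pairs have weight zero, so only genuine packings contribute; injectivity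
  turns the sum over packings into one over distinct monomials.\<close>

lemma (in vbp_main) sieved_sum:
  "(\<Sum>M\<in>pms {..<N}. \<Sum>h\<in>covering {..<k} M. \<Prod>e\<in>M. gg e (h e)) = (\<Sum>T\<in>monomials. \<Prod>v\<in>T. rnd (2 ^ jj) f v)"
proof -
  have fc: "finite (covering {..<k} M)" if "M \<in> pms {..<N}" for M
    by (rule finite_covering[OF _ finite_in_pms[OF _ that]]) simp_all
  let ?S = "SIGMA M:pms {..<N}. covering {..<k} M"
  let ?w = "\<lambda>(M, h). \<Prod>e\<in>M. gg e (h e)"
  have "(\<Sum>M\<in>pms {..<N}. \<Sum>h\<in>covering {..<k} M. \<Prod>e\<in>M. gg e (h e)) = (\<Sum>p\<in>?S. ?w p)"
    using fc by (subst sum.Sigma) (auto intro: finite_pms)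
  also have "\<dots> = (\<Sum>p\<in>packs. ?w p)"
  proof (rule sum.mono_neutral_right)
    show "finite ?S" using fc by (intro finite_SigmaI finite_pms) auto
    show "packs \<subseteq> ?S" by (auto simp: packs_def)
    show "\<forall>p\<in>?S - packs. ?w p = 0"
    proof
      fix p assume p: "p \<in> ?S - packs"
      obtain M h where [simp]: "p = (M, h)" by fastforce
      have "M \<in> pms {..<N}" "\<exists>e\<in>M. \<not> feas e (h e)" using p by (auto simp: packs_def)
      then have "finite M" "\<exists>e\<in>M. gg e (h e) = 0" using finite_in_pms by (auto simp: gg_def)
      then show "?w p = 0" by (simp add: prod_zero)
    qed
  qed
  also have "\<dots> = (\<Sum>p\<in>packs. \<Prod>v\<in>(case p of (M, h) \<Rightarrow> (\<lambda>e. ix e (h e)) ` M). rnd (2 ^ jj) f v)"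
  proof (rule sum.cong[OF refl])
    fix p assume p: "p \<in> packs"
    obtain M h where [simp]: "p = (M, h)" by fastforce
    have m: "M \<in> pms {..<N}" "h \<in> covering {..<k} M" "\<forall>e\<in>M. feas e (h e)" using p by (auto simp: packs_def)
    have "(\<Prod>v\<in>(\<lambda>e. ix e (h e)) ` M. rnd (2 ^ jj) f v) = (\<Prod>e\<in>M. rnd (2 ^ jj) f (ix e (h e)))"
      by (subst prod.reindex[OF inj_on_ix[OF m(1,2)]]) simp
    also have "\<dots> = (\<Prod>e\<in>M. gg e (h e))"
      using m(3) by (intro prod.cong) (auto simp: gg_def ix_def)
    finally show "?w p = (\<Prod>v\<in>(case p of (M, h) \<Rightarrow> (\<lambda>e. ix e (h e)) ` M). rnd (2 ^ jj) f v)" by simp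
  qed
  also have "\<dots> = (\<Sum>T\<in>monomials. \<Prod>v\<in>T. rnd (2 ^ jj) f v)"
    unfolding monomials_def by (subst sum.reindex[OF inj_on_monomials]) (simp add: comp_def)
  finally show ?thesis .
qed

section \<open>Packability, acceptance and the success probability\<close>

context vbp_run
begin

text \<open>Disjoint bins that cover all positions are the fibres of a map to bin numbers. For
  \<open>n = 0\<close> the dimensions \<open>d\<close> and \<open>vdim I\<close> may differ, but
  then all sums are empty.\<close>

lemma packable_iff_packed: "packable I \<longleftrightarrow> (\<exists>g. packed g (nbins I))"
proof
  assume "packable I"
  then obtain B where B: "disjoint_family_on B {..<nbins I}" "(\<Union>i<nbins I. B i) = {..<n}"
    "\<forall>i<nbins I. \<forall>j<vdim I. (\<Sum>v\<in>B i. items I ! v ! j) \<le> 1"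
    unfolding packable_def n_def by blast
  define g where "g x = (SOME i. i < nbins I \<and> x \<in> B i)" for x
  have g: "g x < nbins I \<and> x \<in> B (g x)" if "x < n" for x
  proof -
    have "x \<in> (\<Union>i<nbins I. B i)" using that B(2) by simp
    then have "\<exists>i. i < nbins I \<and> x \<in> B i" by auto
    then show ?thesis unfolding g_def by (rule someI_ex)
  qed
  have gB: "{x. x < n \<and> g x = i} = B i" if i: "i < nbins I" for i
  proof (intro equalityI subsetI)
    fix x assume x: "x \<in> B i"
    then have "x \<in> (\<Union>i<nbins I. B i)" using i by auto
    then have xn: "x < n" using B(2) by simp
    have "g x = i"
    proof (rule ccontr)
      assume "g x \<noteq> i"
      then have "B (g x) \<inter> B i = {}" using B(1) g[OF xn] i by (auto simp: disjoint_family_on_def)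
      then show False using x g[OF xn] by auto
    qed
    then show "x \<in> {x. x < n \<and> g x = i}" using xn by simp
  qed (use g in auto)
  have "packed g (nbins I)"
    unfolding packed_def using g gB B(3) by (auto simp: w_def d_def)
  then show "\<exists>g. packed g (nbins I)" by blast
next
  assume "\<exists>g. packed g (nbins I)"
  then obtain g where g: "\<And>x. x < n \<Longrightarrow> g x < nbins I"
    "\<And>i j. i < nbins I \<Longrightarrow> j < d \<Longrightarrow> (\<Sum>x | x < n \<and> g x = i. w x j) \<le> 1"
    by (auto simp: packed_def)
  let ?B = "\<lambda>i. {x. x < n \<and> g x = i}"
  have "(\<Sum>v\<in>?B i. items I ! v ! j) \<le> 1" if "i < nbins I" "j < vdim I" for i j
  proof (cases "n = 0")
    case True
    then show ?thesis by simp
  next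
    case False
    then show ?thesis using g(2)[of i j] that by (simp add: w_def d_def)
  qed
  moreover have "disjoint_family_on ?B {..<nbins I}" by (auto simp: disjoint_family_on_def)
  moreover have "(\<Union>i<nbins I. ?B i) = {..<n}" using g(1) by auto
  ultimately have "disjoint_family_on ?B {..<nbins I} \<and> (\<Union>i<nbins I. ?B i) = {..<n} \<and>
      (\<forall>i<nbins I. \<forall>j<vdim I. (\<Sum>v\<in>?B i. items I ! v ! j) \<le> 1)" by simp
  then show "packable I" unfolding packable_def n_def[symmetric] by (rule exI[of _ ?B])
qed

lemma packable_iff: "packable I \<longleftrightarrow> card Lg \<le> N \<and> monomials \<noteq> {}"
  unfolding packable_iff_packed monomials_nonempty packed_iff_matching N_def L_def k_def by (rule refl)

definition accepts :: "nat \<Rightarrow> (nat \<Rightarrow> bool) \<Rightarrow> bool" where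
  "accepts jj f \<longleftrightarrow> card Lg \<le> N \<and> (\<Sum>T\<in>monomials. \<Prod>v\<in>T. rnd (2 ^ jj) f v) \<noteq> 0"

text \<open>The error is one-sided: without a packing there is no monomial or there are too many
  large items, so acceptance is impossible. With a packing the degree \<open>L \<le> n\<close> meets
  a field with more than \<open>3 * n\<close> elements.\<close>

lemma accepts_prob:
  assumes "Q0 \<le> fsz jj"
  shows "measure coin_space {\<omega>. packable I \<longleftrightarrow> accepts jj ((!!) \<omega>)} \<ge> 2/3"
proof (cases "packable I")
  case False
  interpret prob_space coin_space
    unfolding coin_space_def by (intro prob_space.prob_space_stream_space prob_space_measure_pmf)
  have "\<not> accepts jj f" for f using False unfolding packable_iff accepts_def by auto
  then have "{\<omega>. packable I \<longleftrightarrow> accepts jj ((!!) \<omega>)} = space coin_space" using False by simp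
  then show ?thesis using prob_space by (simp del: space_coin_space)
next
  case True
  then have p: "card Lg \<le> N" "monomials \<noteq> {}" by (simp_all add: packable_iff)
  have "3 * L \<le> 2 ^ (2 ^ jj)" using assms L_le by (simp add: fsz_def Q0_def)
  from multilinear_nonzero_prob[OF monomials_props(1) p(2) monomials_props(2) this]
  show ?thesis using True p(1) by (simp add: accepts_def)
qed

end

subsection \<open>Tossing the coins\<close>

text \<open>The one loop that consumes coins is written directly for the machine. It uses the
  addresses and the loop scheme of compiled programs, so its effect is again a change of arrays: 52
  is the counter and \<open>vR\<close> receives the coins.\<close>

definition pToss :: com where "pToss = cfor 52 vNT (Toss (cadr vR (cvar 52)))"

lemma rel_scalar: "rel L s \<tau> \<Longrightarrow> 0 < x \<Longrightarrow> x < 64 \<Longrightarrow> s (L + Suc x) = \<tau> x 0"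
  unfolding rel_def by (metis add_0 mult_0_right)

lemma exec_toss:
  assumes r: "rel L s \<sigma>" and b: "\<forall>x. s x < M" "64 < M" and T: "\<sigma> vNT 0 = T"
  shows "\<exists>t s'. exec pToss (s, \<omega>) t (s', sdrop T \<omega>) \<and>
     t \<le> Suc T * (acb (cadr vR (cvar 52)) + asize (cadr vR (cvar 52)) + 1 + forcost 52 vNT) * (len M)\<^sup>2 \<and>
     rel L s' (\<sigma>(vR := (\<lambda>i. if i < T then of_bool (\<omega> !! i) else \<sigma> vR i), 52 := (\<sigma> 52)(0 := T))) \<and> (\<forall>x. s' x < M)"
proof -
  let ?st = "\<lambda>i. \<sigma>(vR := (\<lambda>j. if j < i then of_bool (\<omega> !! j) else \<sigma> vR j), 52 := (\<sigma> 52)(0 := i))"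
  let ?J = "\<lambda>i s w. rel L s (?st i) \<and> (\<forall>x. s x < M) \<and> w = sdrop i \<omega>"
  let ?a = "cadr vR (cvar 52)"
  let ?C = "acb ?a + asize ?a + 1"
  have "T = s (L + Suc vNT)" using rel_scalar[OF r, of vNT] T by simp
  then have TM: "T < M" using b(1) by (metis (no_types))
  have "\<exists>t s' \<omega>'. exec (cfor 52 vNT (Toss ?a)) (s, \<omega>) t (s', \<omega>') \<and>
      t \<le> Suc T * (?C + forcost 52 vNT) * (len M)\<^sup>2 \<and> ?J T s' \<omega>'"
  proof (rule exec_for[where J = ?J and L = L])
    fix i s w assume i: "i < T" and J: "?J i s w"
    have s52: "s (L + 53) = i" using rel_scalar[of L s "?st i" 52] J by simp
    have s0: "s 0 = L" using J by (simp add: rel_def)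
    have av: "aval ?a s = 64 * i + (L + Suc vR)" using s52 s0 by (simp add: cadr_def cvar_def)
    let ?s = "s(64 * i + (L + Suc vR) := of_bool (shd w))"
    have e: "exec (Toss ?a) (s, w) (acost ?a s + len (aval ?a s) + 1) (?s, stl w)"
      using exec.Toss[of ?a s w] unfolding av .
    have cst: "\<forall>n\<in>aconsts ?a. n < M" using b(2) by (simp add: cadr_def cvar_def)
    have "acost ?a s \<le> acb ?a * (len M)\<^sup>2" using J cst b(2) by (intro acost_le) auto
    moreover have "len (aval ?a s) \<le> asize ?a * len M"
      using aval_less[of s M ?a] J cst b(2) by (intro len_less_power) auto
    moreover have "asize ?a * len M \<le> asize ?a * (len M)\<^sup>2"
      by (rule mult_le_mono2[OF self_le_power]) (simp_all add: Suc_le_eq)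
    moreover note one_le_len_square[of M]
    ultimately have t: "acost ?a s + len (aval ?a s) + 1 \<le> ?C * (len M)\<^sup>2"
      unfolding distrib_right by linarith
    have w: "shd w = \<omega> !! i" "stl w = sdrop (Suc i) \<omega>" using J by simp_all
    have r1: "rel L ?s (upd (?st i) vR i (of_bool (shd w)))"
      using rel_upd[of L s "?st i" vR i] J by simp
    have "?s (L + Suc 52) = upd (?st i) vR i (of_bool (shd w)) 52 0"
      using r1 by (rule rel_scalar) simp_all
    also have "\<dots> = i" by simp
    finally have s52': "?s (L + Suc 52) = i" .
    have "rel L (?s(64 * 0 + (L + Suc 52) := Suc i)) (upd (upd (?st i) vR i (of_bool (shd w))) 52 0 (Suc i))"
      using r1 by (rule rel_upd) simp_all
    also have "upd (upd (?st i) vR i (of_bool (shd w))) 52 0 (Suc i) = ?st (Suc i)"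
      unfolding upd_def w by (intro ext) (auto simp: less_Suc_eq)
    finally have r2: "rel L (?s(L + Suc 52 := Suc i)) (?st (Suc i))" by (simp only: mult_0_right add_0)
    have bd: "\<forall>x. ?s x < M" using J b(2) by auto
    have bd2: "\<forall>x. (?s(L + Suc 52 := Suc i)) x < M" using bd i TM by auto
    have s0': "?s 0 = L" using s0 by simp
    show "\<exists>t s' w'. exec (Toss ?a) (s, w) t (s', w') \<and> t \<le> ?C * (len M)\<^sup>2 \<and> (\<forall>x. s' x < M) \<and>
        s' (L + Suc 52) = i \<and> s' 0 = L \<and> ?J (Suc i) (s'(L + Suc 52 := Suc i)) w'"
    proof (intro exI conjI)
      show "exec (Toss ?a) (s, w) (acost ?a s + len (aval ?a s) + 1) (?s, stl w)" by (rule e)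
    qed (rule t bd bd2 s52' s0' r2 w(2))+
  next
    fix i s w assume "i \<le> T" and J: "?J i s w"
    then show "s 0 = L \<and> s (L + Suc 52) = i \<and> s (L + Suc vNT) = T \<and> (\<forall>x. s x < M)"
      using rel_scalar[of L s "?st i" 52] rel_scalar[of L s "?st i" vNT] T by (simp add: rel_def)
  next
    have "rel L (s(64 * 0 + (L + Suc 52) := 0)) (upd \<sigma> 52 0 0)" using r by (rule rel_upd) simp_all
    moreover have "upd \<sigma> 52 0 0 = ?st 0" by (simp add: upd_def)
    ultimately show "?J 0 (s(L + Suc 52 := 0)) \<omega>" using b by simp
  qed (use r b TM in \<open>simp_all add: rel_def\<close>)
  then show ?thesis unfolding pToss_def by blast
qed

subsection \<open>Polynomial bounds on the running time\<close>

text \<open>The constant factor of the running time. The 2 at a loop absorbs the extra round in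
  \<open>Suc (N b)\<close>.\<close>

primrec csz :: "prog \<Rightarrow> nat" where
  "csz Nop = 1"
| "csz (Store a i e) = acost2 (cadr a (cexp i)) (cexp e)"
| "csz (Sq p p') = csz p + csz p'"
| "csz (Cond e p p') = acb (cexp e) + 1 + csz p + csz p'"
| "csz (For a b p) = 2 * (csz p + forcost a b)"

text \<open>Depths are added in sequences and conditionals, instead of taking the maximum; this only
  enlarges a constant exponent.\<close>

primrec dep :: "prog \<Rightarrow> nat" where
  "dep Nop = 0"
| "dep (Store a i e) = 0"
| "dep (Sq p p') = dep p + dep p'"
| "dep (Cond e p p') = dep p + dep p'"
| "dep (For a b p) = Suc (dep p)"

text \<open>Loops of exponential length, that is, with limit \<open>vK2\<close>, must not be nested.\<close>

primrec flat :: "prog \<Rightarrow> bool" where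
  "flat Nop = True"
| "flat (Store a i e) = True"
| "flat (Sq p p') = (flat p \<and> flat p')"
| "flat (Cond e p p') = (flat p \<and> flat p')"
| "flat (For a b p) = (flat p \<and> (b = vK2 \<longrightarrow> vK2 \<notin> limits p))"

text \<open>Every loop costs one factor \<open>P\<close>. A loop of length \<open>K\<close> costs a
  factor \<open>K\<close> as well, but \<open>flat\<close> ensures that its body contains no other
  such loop, so \<open>K\<close> occurs at most once.\<close>

lemma tb_le_power:
  assumes "1 \<le> P" "1 \<le> K" "\<And>b. b \<noteq> vK2 \<Longrightarrow> B b \<le> P" "B vK2 = K" "flat p"
  shows "tb B p \<le> csz p * P ^ dep p * (if vK2 \<in> limits p then K else 1)"
  using assms(5)
proof (induction p)
  case (Store a i e)
  then show ?case by simp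
next
  case (Sq p p')
  let ?X = "\<lambda>p. if vK2 \<in> limits p then K else 1"
  have "csz p * P ^ dep p * ?X p \<le> csz p * P ^ (dep p + dep p') * ?X (Sq p p')"
    using assms(1,2) by (intro mult_le_mono power_increasing) auto
  moreover have "csz p' * P ^ dep p' * ?X p' \<le> csz p' * P ^ (dep p + dep p') * ?X (Sq p p')"
    using assms(1,2) by (intro mult_le_mono power_increasing) auto
  moreover have "tb B p \<le> csz p * P ^ dep p * ?X p" "tb B p' \<le> csz p' * P ^ dep p' * ?X p'"
    using Sq by simp_all
  ultimately show ?case unfolding tb.simps csz.simps dep.simps distrib_right by linarith
next
  case (Cond e p p')
  let ?X = "\<lambda>p. if vK2 \<in> limits p then K else 1"
  have "csz p * P ^ dep p * ?X p \<le> csz p * P ^ (dep p + dep p') * ?X (Cond e p p')"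
    using assms(1,2) by (intro mult_le_mono power_increasing) auto
  moreover have "csz p' * P ^ dep p' * ?X p' \<le> csz p' * P ^ (dep p + dep p') * ?X (Cond e p p')"
    using assms(1,2) by (intro mult_le_mono power_increasing) auto
  moreover have "tb B p \<le> csz p * P ^ dep p * ?X p" "tb B p' \<le> csz p' * P ^ dep p' * ?X p'"
    using Cond by simp_all
  moreover have "(acb (cexp e) + 1) * 1 * 1 \<le> (acb (cexp e) + 1) * P ^ (dep p + dep p') * ?X (Cond e p p')"
    using assms(1,2) by (intro mult_le_mono) auto
  ultimately show ?case unfolding tb.simps csz.simps dep.simps distrib_right by linarith
next
  case (For a b p)
  let ?X = "if vK2 \<in> limits p then K else 1"
  have X1: "1 \<le> ?X" using assms(2) by simp
  have P1: "1 \<le> P ^ dep p" using assms(1) by simp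
  have "forcost a b * 1 * 1 \<le> forcost a b * P ^ dep p * ?X"
    using X1 P1 by (intro mult_le_mono) auto
  moreover have "tb B p \<le> csz p * P ^ dep p * ?X" using For by simp
  ultimately have body: "tb B p + forcost a b \<le> (csz p + forcost a b) * P ^ dep p * ?X"
    unfolding distrib_right by linarith
  have "Suc (B b) * ?X \<le> 2 * P * (if vK2 \<in> limits (For a b p) then K else 1)"
  proof (cases "b = vK2")
    case True
    then have "?X = 1" using For.prems by simp
    moreover have "1 * (2 * K) \<le> P * (2 * K)" using assms(1) by (rule mult_le_mono1)
    then have "Suc K \<le> 2 * P * K" using assms(2) by (simp add: ac_simps)
    ultimately show ?thesis using True assms(4) by simp
  next
    case False
    then have "Suc (B b) \<le> 2 * P" using assms(1) assms(3)[of b] by simp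
    then have "Suc (B b) * ?X \<le> 2 * P * ?X" by (rule mult_le_mono1)
    then show ?thesis using False by simp
  qed
  then have "(csz p + forcost a b) * P ^ dep p * (Suc (B b) * ?X) \<le>
      (csz p + forcost a b) * P ^ dep p * (2 * P * (if vK2 \<in> limits (For a b p) then K else 1))"
    by (rule mult_le_mono2)
  moreover have "Suc (B b) * (tb B p + forcost a b) \<le> Suc (B b) * ((csz p + forcost a b) * P ^ dep p * ?X)"
    using body by (rule mult_le_mono2)
  ultimately show ?case unfolding tb.simps csz.simps dep.simps power_Suc
    by (simp only: ac_simps)
qed auto

lemma length_le_input_size: "length xs \<le> input_size xs"
proof (induction xs)
  case (Cons a xs)
  have "1 \<le> len a" by (simp add: Suc_le_eq)
  then show ?case using Cons by (simp add: input_size_def)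
qed simp

lemma add2_le_power_len: "x + 2 \<le> 2 ^ (2 * len x)"
proof -
  have l: "2 \<le> (2::nat) ^ len x" using self_le_power[of 2 "len x"] by simp
  then have "2 * 2 ^ len x \<le> (2::nat) ^ len x * 2 ^ len x" by (intro mult_le_mono1)
  moreover have "x + 2 \<le> 2 * 2 ^ len x" using less_two_power_len[of x] l by linarith
  ultimately show ?thesis by (simp add: mult_2 power_add)
qed

lemma writes_wf: "wf_prog p \<Longrightarrow> writes p \<subseteq> {1..<64}"
  by (induction p) auto

section \<open>The complete machine program and its running time\<close>

definition pInit :: prog where "pInit = setv vL (Inp (Cst 0)) ;; setv vcap (Cst 1)"

definition packer :: com where
  "packer = Seq (cprog pInit) (Seq (cprog pCap) (Seq (cprog pSizes) (Seq (cprog pTables)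
     (Seq pToss (Seq (cprog pMain) (Assign (Const 0) (cvar 51)))))))"

definition tosscost :: nat where
  "tosscost = acb (cadr vR (cvar 52)) + asize (cadr vR (cvar 52)) + 1 + forcost 52 vNT"

definition tconst :: nat where
  "tconst = csz pInit + csz pCap + csz pSizes + csz pTables + csz pMain + 2 * tosscost + acost2 (Const 0) (cvar 51)"

text \<open>The summand 3 pays for the coin loop, whose number of rounds is \<open>2 ^ k\<close>
  times \<open>N * N * 2 ^ jj\<close>, with three polynomially bounded factors.\<close>

definition tdeg :: nat where
  "tdeg = dep pInit + dep pCap + dep pSizes + dep pTables + dep pMain + 3"

lemmas preparation_defs = pInit_def pCap_def pCapLoop_def pSquare_def pSizes_def pTables_def pRank_def pPow_def pXor_def
  pField_def pTower_def pMark_def pExt_def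
lemmas main_defs = pMain_def pWeights_def pEntry_def pDraw_def pLoad_def pCoord_def pAdd_def memE_def pZeta_def
  pFold_def pTerm_def pMatrix_def pFill_def pElim_def pRow_def pPivot_def pStep_def pInvert_def pUpdate_def

lemma wf_stages: "wf_prog pInit" "wf_prog pCap" "wf_prog pSizes" "wf_prog pTables" "wf_prog pMain"
  by (simp_all add: preparation_defs main_defs)

lemma flat_stages: "flat pInit" "flat pCap" "flat pSizes" "flat pTables" "flat pMain"
  by (simp_all add: preparation_defs main_defs)

lemma safe_stages: "safe pSizes" "safe pTables" "safe pMain"
  by (simp_all add: preparation_defs main_defs)

lemma limits_stages: "limits pInit = {}" "limits pCap = {vL}" "limits pSizes = {}" "limits pTables = {vn, vQ}"
  "limits pMain = {vN, vK2, vr, vd, vn, vks, vq}"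
  by (auto simp: preparation_defs main_defs)

lemma limits_writes: "limits pCap \<inter> writes pCap = {}" "limits pTables \<inter> writes pTables = {}"
  "limits pMain \<inter> writes pMain = {}"
  by (simp_all add: limits_stages) (simp_all add: pTables_def pMain_def)

context vbp_run
begin

abbreviation "sz \<equiv> input_size xs"
abbreviation "U \<equiv> (len (Suc CAP))\<^sup>2"

lemma sz_ge: "3 \<le> sz" "length xs \<le> sz"
  using length_le_input_size[of xs] length_xs by simp_all

text \<open>The exponent 4 is dictated by \<open>Q\<close>, the square of \<open>Q0\<close>: from
  \<open>n + 3 \<le> sz\<close> and \<open>3 \<le> sz\<close> follows
  \<open>Q0 \<le> 3 * sz \<le> sz ^ 2\<close>.\<close>

lemma P_bounds: "length xs \<le> sz ^ 4" "n \<le> sz ^ 4" "d \<le> sz ^ 4" "N \<le> sz ^ 4" "Q \<le> sz ^ 4" "1 \<le> sz ^ 4"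
proof -
  have s2: "3 * sz \<le> sz ^ 2" using sz_ge by (simp add: power2_eq_square)
  have s4: "sz ^ 4 = sz ^ 2 * sz ^ 2" by (simp add: power_add[symmetric])
  have s1: "sz \<le> sz ^ 4" by (rule self_le_power) (use sz_ge in auto)
  then show "length xs \<le> sz ^ 4" "1 \<le> sz ^ 4" using sz_ge by linarith+
  have n: "n + 3 \<le> sz" using sz_ge length_xs by linarith
  then show "n \<le> sz ^ 4" using s1 by linarith
  have q0: "Q0 \<le> sz ^ 2" using n s2 by (simp add: Q0_def)
  then show Q: "Q \<le> sz ^ 4" unfolding Q_def s4 by (rule mult_le_mono) (rule q0)
  then show "N \<le> sz ^ 4" using L_le size_bounds(8) by (simp add: N_def Q0_def)
  have "d \<le> length xs"
  proof (cases "n = 0")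
    case False
    then have "1 * d \<le> n * d" by (intro mult_le_mono1) simp
    then show ?thesis using length_xs unfolding mult_1 by linarith
  qed (simp add: d_def)
  then show "d \<le> sz ^ 4" using s1 sz_ge by linarith
qed

text \<open>A factor of \<open>C0\<close> has at most twice the length of its input number, so
  \<open>C0 \<le> 2 ^ (2 * sz)\<close>, and the 64th power gives \<open>128 * sz\<close> bits. One
  more \<open>sz\<close> covers the successor, \<open>129 \<le> 3 ^ 5 \<le> sz ^ 5\<close> removes
  the constant, and squaring \<open>sz ^ 6\<close> gives the exponent 12.\<close>

lemma U_le: "U \<le> sz ^ 12"
proof -
  have "C0 = (\<Prod>t<length xs. xs ! t + 2)" unfolding C0_def by (intro prod.cong) (simp_all add: \<iota>_nth)
  also have "\<dots> \<le> (\<Prod>t<length xs. 2 ^ (2 * len (xs ! t)))"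
    by (intro prod_mono) (simp add: add2_le_power_len del: add_2_eq_Suc add_2_eq_Suc')
  also have "\<dots> = 2 ^ (2 * sz)"
    by (simp add: power_sum[symmetric] sum_distrib_left[symmetric] input_size_def sum_list_sum_nth atLeast0LessThan)
  finally have "CAP \<le> (2 ^ (2 * sz)) ^ 64" unfolding CAP_def by (rule power_mono) simp
  also have "\<dots> = 2 ^ (128 * sz)" by (simp flip: power_mult)
  finally have c: "CAP \<le> 2 ^ (128 * sz)" .
  have "(2::nat) ^ (128 * sz) * 2 \<le> 2 ^ (128 * sz) * 2 ^ sz"
    using sz_ge self_le_power[of 2 sz] by (intro mult_le_mono2) simp
  then have "2 * 2 ^ (128 * sz) \<le> (2::nat) ^ (129 * sz)" by (simp add: power_add[symmetric])
  moreover have "(1::nat) < 2 ^ (128 * sz)" by (rule one_less_power) (use sz_ge in auto)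
  ultimately have "Suc CAP < 2 ^ (129 * sz)" using c by linarith
  then have "len (Suc CAP) \<le> 129 * sz" using sz_ge by (intro len_leI) auto
  also have "129 * sz \<le> 3 ^ 5 * sz" by simp
  also have "3 ^ 5 * sz \<le> sz ^ 5 * sz" using sz_ge by (intro mult_le_mono1 power_mono) auto
  also have "\<dots> = sz ^ 6" by (simp add: power_Suc2[symmetric] del: power_Suc)
  finally have "U \<le> (sz ^ 6)\<^sup>2" by (intro power_mono) auto
  then show ?thesis by (simp flip: power_mult)
qed

text \<open>\<open>rel\<close> says nothing about arrays from 64 on, which have no registers. They
  are kept at zero because the value bounds range over all arrays.\<close>

definition good_st :: "mem \<Rightarrow> st \<Rightarrow> bool" where
  "good_st s \<sigma> \<longleftrightarrow> rel (length xs) s \<sigma> \<and> (\<forall>x. s x < Suc CAP) \<and> \<sigma> 0 = \<iota> \<and> (\<forall>a\<ge>64. \<sigma> a = (\<lambda>_. 0))"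

lemma \<iota>_le: "\<iota> i \<le> CAP"
proof -
  have "\<iota> i \<le> C0"
  proof (cases "i = 0 \<or> length xs < i")
    case True
    then show ?thesis using C0_ge(5) by (auto simp: \<iota>_def init_mem_def)
  next
    case False
    then obtain t where t: "i = Suc t" "t < length xs" by (cases i) auto
    have "(\<Prod>t\<in>{t}. \<iota> (Suc t) + 2) \<le> C0" unfolding C0_def using t by (intro prod_subset_le) auto
    then show ?thesis using t by simp
  qed
  then show ?thesis using less_CAP[of "\<iota> i" 1] by simp
qed

lemma good_st_le: "good_st s \<sigma> \<Longrightarrow> \<sigma> a i \<le> CAP"
proof -
  assume g: "good_st s \<sigma>"
  consider "a = 0" | "0 < a" "a < 64" | "64 \<le> a" by linarith
  then show ?thesis
  proof cases
    case 1
    then show ?thesis using g \<iota>_le by (simp add: good_st_def)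
  next
    case 2
    then have "\<sigma> a i = s (64 * i + (length xs + Suc a))" using g by (simp add: good_st_def rel_def)
    then show ?thesis using g by (simp add: good_st_def less_Suc_eq_le)
  next
    case 3
    then show ?thesis using g by (simp add: good_st_def)
  qed
qed

lemma exec_stage:
  assumes g: "good_st s \<sigma>" and p: "wf_prog p" "ok (Suc CAP) p \<sigma>" "flat p"
    and l: "\<And>b. b \<in> limits p \<Longrightarrow> \<sigma> b 0 \<le> (if b = vK2 then 2 ^ k else sz ^ 4)" "limits p \<inter> writes p = {}"
  shows "\<exists>t s'. exec (cprog p) (s, \<omega>) t (s', \<omega>) \<and> good_st s' (run p \<sigma>) \<and>
    t \<le> csz p * (sz ^ 4) ^ dep p * 2 ^ k * U"
proof -
  let ?B = "\<lambda>b. if b = vK2 then 2 ^ k else sz ^ 4"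
  obtain t s' where t: "exec (cprog p) (s, \<omega>) t (s', \<omega>)" "rel (length xs) s' (run p \<sigma>)" "\<forall>x. s' x < Suc CAP"
    "t \<le> tb ?B p * U"
    using exec_cprog[of p "length xs" s \<sigma> "Suc CAP" ?B \<omega>] g p l CAP_ge unfolding good_st_def by auto
  have "tb ?B p \<le> csz p * (sz ^ 4) ^ dep p * (if vK2 \<in> limits p then 2 ^ k else 1)"
    using P_bounds(6) p(3) by (intro tb_le_power) auto
  also have "\<dots> \<le> csz p * (sz ^ 4) ^ dep p * 2 ^ k" by (intro mult_le_mono2) simp
  finally have "tb ?B p * U \<le> csz p * (sz ^ 4) ^ dep p * 2 ^ k * U" by (rule mult_le_mono1)
  with t(4) have "t \<le> csz p * (sz ^ 4) ^ dep p * 2 ^ k * U" by (rule order_trans)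
  moreover have "run p \<sigma> a = \<sigma> a" if "a = 0 \<or> 64 \<le> a" for a
    by (rule run_frame) (use writes_wf[OF p(1)] that in auto)
  ultimately show ?thesis using t g unfolding good_st_def by (intro exI[of _ t] exI[of _ s']) auto
qed

lemma exec_safe_stage:
  assumes g: "good_st s \<sigma>" and c: "\<sigma> vcap 0 = CAP" and p: "wf_prog p" "safe p" "flat p"
    and l: "\<And>b. b \<in> limits p \<Longrightarrow> \<sigma> b 0 \<le> (if b = vK2 then 2 ^ k else sz ^ 4)" "limits p \<inter> writes p = {}"
  shows "\<exists>t s'. exec (cprog p) (s, \<omega>) t (s', \<omega>) \<and> good_st s' (run p \<sigma>) \<and>
    t \<le> csz p * (sz ^ 4) ^ dep p * 2 ^ k * U"
proof -
  have "ok (Suc (\<sigma> vcap 0)) p \<sigma>"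
    using safe_ok[OF p(2,1), of \<sigma>] good_st_le[OF g] c CAP_ge by simp
  then show ?thesis using exec_stage[OF g p(1) _ p(3) l] c by simp
qed

lemma ready_frame:
  assumes "ready jj \<sigma>" "\<And>x. x < 28 \<Longrightarrow> \<tau> x = \<sigma> x"
  shows "ready jj \<tau>"
  using assms(1) config_cong[of \<sigma> \<tau>] towok_cong[of jj \<sigma> \<tau>] unfolding ready_def
  by (simp add: assms(2))

definition tbound :: nat where
  "tbound = tconst * (sz ^ 4) ^ tdeg * 2 ^ k * U"

text \<open>The preparation tosses no coins, so the level \<open>jj\<close> can be chosen before
  \<open>\<omega>\<close>. Acceptance thus becomes a single event in the coin space.\<close>

lemma exec_packer:
  "\<exists>jj. Q0 \<le> fsz jj \<and> (\<forall>\<omega>. \<exists>t s \<omega>'. exec packer (init_mem xs, \<omega>) t (s, \<omega>') \<and> t \<le> tbound \<and>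
     (s 0 \<noteq> 0 \<longleftrightarrow> accepts jj ((!!) \<omega>)))"
proof -
  define \<sigma>0 :: st where "\<sigma>0 a = (if a = 0 then \<iota> else (\<lambda>_. 0))" for a
  define \<sigma>1 where "\<sigma>1 = run pInit \<sigma>0"
  define \<sigma>2 where "\<sigma>2 = run pCap \<sigma>1"
  define \<sigma>3 where "\<sigma>3 = run pSizes \<sigma>2"
  define \<sigma>4 where "\<sigma>4 = run pTables \<sigma>3"
  have g0: "good_st (init_mem xs) \<sigma>0"
    using \<iota>_le by (auto simp: good_st_def rel_def \<sigma>0_def \<iota>_def init_mem_def less_Suc_eq_le)
  have s1: "\<sigma>1 = upd (upd \<sigma>0 vL 0 (length xs)) vcap 0 1"
    by (simp add: \<sigma>1_def pInit_def \<sigma>0_def)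
  note cap = run_cap[of \<sigma>1, folded \<sigma>2_def]
  have s1': "\<sigma>1 0 = \<iota>" "\<sigma>1 vL 0 = length xs" "\<sigma>1 vcap 0 = 1" by (simp_all add: s1 \<sigma>0_def)
  have c2: "\<sigma>2 vcap 0 = CAP" using cap(1)[OF s1'] .
  have f2: "\<sigma>2 x = \<sigma>1 x" if "x \<notin> {vi, vcap}" for x
    unfolding \<sigma>2_def by (rule run_frame) (use that in simp)
  have b2: "base \<sigma>2" using c2 f2[of 0] s1' by (simp add: base_def)
  note sizes = run_sizes[OF b2, folded \<sigma>3_def]
  have f3: "\<sigma>3 x = \<sigma>2 x" if "x \<notin> {vn, vd, vl, vN, vQ0, vQ}" for x
    unfolding \<sigma>3_def by (rule run_frame) (use that in simp)
  have b3: "base \<sigma>3" using b2 by (simp add: base_def f3)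
  have "\<sigma>3 vX = (\<lambda>_. 0)" "\<sigma>3 vT = (\<lambda>_. 0)" using f3 f2 by (simp_all add: s1 \<sigma>0_def)
  from run_tables[OF b3 sizes this] obtain jj where rd: "ready jj \<sigma>4" "\<sigma>4 vNT 0 = N * N * 2 ^ k * 2 ^ jj"
    unfolding \<sigma>4_def by blast
  have q: "Q0 \<le> fsz jj" "fsz jj \<le> Q" using rd(1) by (simp_all add: ready_def)
  let ?T = "N * N * 2 ^ k * 2 ^ jj"
  have r2: "2 ^ jj \<le> fsz jj" unfolding fsz_def by (intro power_increasing less_imp_le) simp_all
  have "\<exists>t s \<omega>'. exec packer (init_mem xs, \<omega>) t (s, \<omega>') \<and> t \<le> tbound \<and> (s 0 \<noteq> 0 \<longleftrightarrow> accepts jj ((!!) \<omega>))" for \<omega>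
  proof -
    define \<sigma>5 where "\<sigma>5 = \<sigma>4(vR := (\<lambda>i. if i < ?T then of_bool (\<omega> !! i) else \<sigma>4 vR i), 52 := (\<sigma>4 52)(0 := ?T))"
    define \<sigma>6 where "\<sigma>6 = run pMain \<sigma>5"
    \<comment> \<open>The analysis of the main stage is instantiated separately for each coin
      sequence.\<close>
    interpret vbp_main I jj "(!!) \<omega>" by unfold_locales (rule q)+
    have "ready jj \<sigma>5" by (rule ready_frame[OF rd(1)]) (simp add: \<sigma>5_def)
    then have m5: "mready \<sigma>5" unfolding mready_def by (simp add: \<sigma>5_def)
    have out: "\<sigma>6 51 0 \<noteq> 0 \<longleftrightarrow> accepts jj ((!!) \<omega>)"
      using run_main[OF m5] unfolding \<sigma>6_def accepts_def sieved_sum .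
    obtain t1 q1 where 1: "exec (cprog pInit) (init_mem xs, \<omega>) t1 (q1, \<omega>)" "good_st q1 \<sigma>1"
      "t1 \<le> csz pInit * (sz ^ 4) ^ dep pInit * 2 ^ k * U"
    proof -
      have "length xs \<le> CAP" using C0_ge(5) less_CAP[of "length xs" 1] by simp
      then have "ok (Suc CAP) pInit \<sigma>0" using CAP_ge by (simp add: pInit_def \<sigma>0_def)
      moreover have "\<sigma>0 b 0 \<le> (if b = vK2 then 2 ^ k else sz ^ 4)" if "b \<in> limits pInit" for b
        using that by (simp add: limits_stages)
      moreover have "limits pInit \<inter> writes pInit = {}" by (simp add: limits_stages)
      ultimately have "\<exists>t s'. exec (cprog pInit) (init_mem xs, \<omega>) t (s', \<omega>) \<and> good_st s' \<sigma>1 \<and>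
          t \<le> csz pInit * (sz ^ 4) ^ dep pInit * 2 ^ k * U"
        unfolding \<sigma>1_def by (intro exec_stage[OF g0 wf_stages(1) _ flat_stages(1)])
      then show ?thesis by (elim exE conjE) (rule that)
    qed
    obtain t2 q2 where 2: "exec (cprog pCap) (q1, \<omega>) t2 (q2, \<omega>)" "good_st q2 \<sigma>2"
      "t2 \<le> csz pCap * (sz ^ 4) ^ dep pCap * 2 ^ k * U"
    proof -
      have "\<sigma>1 b 0 \<le> (if b = vK2 then 2 ^ k else sz ^ 4)" if "b \<in> limits pCap" for b
        using that P_bounds(1) s1' by (simp add: limits_stages)
      moreover note cap(2)[OF s1'] limits_writes(1)
      ultimately have "\<exists>t s'. exec (cprog pCap) (q1, \<omega>) t (s', \<omega>) \<and> good_st s' \<sigma>2 \<and>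
          t \<le> csz pCap * (sz ^ 4) ^ dep pCap * 2 ^ k * U"
        unfolding \<sigma>2_def by (intro exec_stage[OF 1(2) wf_stages(2) _ flat_stages(2)])
      then show ?thesis by (elim exE conjE) (rule that)
    qed
    obtain t3 q3 where 3: "exec (cprog pSizes) (q2, \<omega>) t3 (q3, \<omega>)" "good_st q3 \<sigma>3"
      "t3 \<le> csz pSizes * (sz ^ 4) ^ dep pSizes * 2 ^ k * U"
    proof -
      have "\<sigma>2 b 0 \<le> (if b = vK2 then 2 ^ k else sz ^ 4)" if "b \<in> limits pSizes" for b
        using that by (simp add: limits_stages)
      moreover have "limits pSizes \<inter> writes pSizes = {}" by (simp add: limits_stages)
      ultimately have "\<exists>t s'. exec (cprog pSizes) (q2, \<omega>) t (s', \<omega>) \<and> good_st s' \<sigma>3 \<and>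
          t \<le> csz pSizes * (sz ^ 4) ^ dep pSizes * 2 ^ k * U"
        unfolding \<sigma>3_def by (intro exec_safe_stage[OF 2(2) c2 wf_stages(3) safe_stages(1) flat_stages(3)])
      then show ?thesis by (elim exE conjE) (rule that)
    qed
    have c3: "\<sigma>3 vcap 0 = CAP" using b3 by (simp add: base_def)
    obtain t4 q4 where 4: "exec (cprog pTables) (q3, \<omega>) t4 (q4, \<omega>)" "good_st q4 \<sigma>4"
      "t4 \<le> csz pTables * (sz ^ 4) ^ dep pTables * 2 ^ k * U"
    proof -
      have "\<sigma>3 b 0 \<le> (if b = vK2 then 2 ^ k else sz ^ 4)" if "b \<in> limits pTables" for b
        using that P_bounds sizes by (auto simp: limits_stages)
      moreover note limits_writes(2)
      ultimately have "\<exists>t s'. exec (cprog pTables) (q3, \<omega>) t (s', \<omega>) \<and> good_st s' \<sigma>4 \<and>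
          t \<le> csz pTables * (sz ^ 4) ^ dep pTables * 2 ^ k * U"
        unfolding \<sigma>4_def by (intro exec_safe_stage[OF 3(2) c3 wf_stages(4) safe_stages(2) flat_stages(4)])
      then show ?thesis by (elim exE conjE) (rule that)
    qed
    have g4: "rel (length xs) q4 \<sigma>4" "\<forall>x. q4 x < Suc CAP" "64 < Suc CAP" using 4(2) CAP_ge by (auto simp: good_st_def)
    obtain t5 q5 where 5: "exec pToss (q4, \<omega>) t5 (q5, sdrop ?T \<omega>)" "t5 \<le> Suc ?T * tosscost * U"
      "rel (length xs) q5 \<sigma>5" "\<forall>x. q5 x < Suc CAP"
      using exec_toss[OF g4 rd(2), of \<omega>, folded \<sigma>5_def tosscost_def] by (elim exE conjE) (rule that)
    have g5: "good_st q5 \<sigma>5" using 4(2) 5(3,4) by (simp add: good_st_def \<sigma>5_def)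
    note md = mreadyD[OF m5]
    obtain t6 q6 where 6: "exec (cprog pMain) (q5, sdrop ?T \<omega>) t6 (q6, sdrop ?T \<omega>)" "good_st q6 \<sigma>6"
      "t6 \<le> csz pMain * (sz ^ 4) ^ dep pMain * 2 ^ k * U"
    proof -
      have "\<sigma>5 b 0 \<le> (if b = vK2 then 2 ^ k else sz ^ 4)" if "b \<in> limits pMain" for b
      proof -
        have "fsz jj \<le> sz ^ 4" "2 ^ jj \<le> sz ^ 4" "k \<le> sz ^ 4" using q r2 P_bounds k_le_n by linarith+
        then show ?thesis using that md(4-9,11) P_bounds unfolding limits_stages by auto
      qed
      moreover note limits_writes(3)
      ultimately have "\<exists>t s'. exec (cprog pMain) (q5, sdrop ?T \<omega>) t (s', sdrop ?T \<omega>) \<and> good_st s' \<sigma>6 \<and>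
          t \<le> csz pMain * (sz ^ 4) ^ dep pMain * 2 ^ k * U"
        unfolding \<sigma>6_def by (intro exec_safe_stage[OF g5 md(2) wf_stages(5) safe_stages(3) flat_stages(5)])
      then show ?thesis by (elim exE conjE) (rule that)
    qed
    have b6: "\<And>x. q6 x < Suc CAP" "\<forall>n\<in>aconsts (Const 0) \<union> aconsts (cvar 51). n < Suc CAP" "2 \<le> Suc CAP"
      using 6(2) CAP_ge by (auto simp: good_st_def cvar_def cadr_def)
    obtain t7 where 7: "exec (Assign (Const 0) (cvar 51)) (q6, sdrop ?T \<omega>) t7
        (q6(aval (Const 0) q6 := aval (cvar 51) q6), sdrop ?T \<omega>)" "t7 \<le> acost2 (Const 0) (cvar 51) * U"
      unfolding acost2_def by (rule exec_Assign[OF b6])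
    have "rel (length xs) q6 \<sigma>6" using 6(2) by (simp add: good_st_def)
    then have v: "aval (cvar 51) q6 = \<sigma>6 51 0"
      using rel_scalar[of "length xs" q6 \<sigma>6 51] by (simp add: cvar_def cadr_def rel_def)
    let ?q = "q6(aval (Const 0) q6 := aval (cvar 51) q6)"
    let ?t = "t1 + (t2 + (t3 + (t4 + (t5 + (t6 + t7)))))"
    have ex: "exec packer (init_mem xs, \<omega>) ?t (?q, sdrop ?T \<omega>)"
      unfolding packer_def by (intro exec.Seq[OF 1(1)] exec.Seq[OF 2(1)] exec.Seq[OF 3(1)] exec.Seq[OF 4(1)]
        exec.Seq[OF 5(1)] exec.Seq[OF 6(1)] 7(1))
    have ans: "?q 0 \<noteq> 0 \<longleftrightarrow> accepts jj ((!!) \<omega>)" using v out by simp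
    let ?F = "(sz ^ 4) ^ tdeg * 2 ^ k * U"
    have st: "csz p * (sz ^ 4) ^ dep p * 2 ^ k * U \<le> csz p * ?F" if "dep p \<le> tdeg" for p
    proof -
      have "(sz ^ 4) ^ dep p * (2 ^ k * U) \<le> (sz ^ 4) ^ tdeg * (2 ^ k * U)"
        using that P_bounds(6) by (intro mult_le_mono1 power_increasing) auto
      then have "csz p * ((sz ^ 4) ^ dep p * (2 ^ k * U)) \<le> csz p * ((sz ^ 4) ^ tdeg * (2 ^ k * U))"
        by (rule mult_le_mono2)
      then show ?thesis by (simp only: ac_simps)
    qed
    have dp: "dep pInit \<le> tdeg" "dep pCap \<le> tdeg" "dep pSizes \<le> tdeg" "dep pTables \<le> tdeg" "dep pMain \<le> tdeg"
      by (simp_all add: tdeg_def)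
    have "(sz ^ 4) ^ 3 \<le> (sz ^ 4) ^ tdeg" using P_bounds(6) by (intro power_increasing) (simp_all add: tdeg_def)
    moreover have "N * N * 2 ^ jj \<le> (sz ^ 4) ^ 3"
      unfolding power3_eq_cube using P_bounds q r2 by (intro mult_le_mono) linarith+
    ultimately have "N * N * 2 ^ jj * 2 ^ k \<le> (sz ^ 4) ^ tdeg * 2 ^ k" by (intro mult_le_mono1) linarith
    moreover have "1 * 1 \<le> (sz ^ 4) ^ tdeg * 2 ^ k" using P_bounds(6) by (intro mult_le_mono) auto
    moreover have "?T = N * N * 2 ^ jj * 2 ^ k" by simp
    ultimately have "Suc ?T \<le> 2 * ((sz ^ 4) ^ tdeg * 2 ^ k)" by linarith
    then have "Suc ?T * (tosscost * U) \<le> 2 * ((sz ^ 4) ^ tdeg * 2 ^ k) * (tosscost * U)" by (rule mult_le_mono1)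
    then have t5: "t5 \<le> 2 * tosscost * ?F" using 5(2) by (simp only: ac_simps)
    have "1 * 1 * U \<le> (sz ^ 4) ^ tdeg * 2 ^ k * U" using P_bounds(6) by (intro mult_le_mono) auto
    then have "acost2 (Const 0) (cvar 51) * (1 * 1 * U) \<le> acost2 (Const 0) (cvar 51) * ?F" by (rule mult_le_mono2)
    then have "acost2 (Const 0) (cvar 51) * U \<le> acost2 (Const 0) (cvar 51) * ?F" by (simp only: mult_1)
    with 7(2) have t7: "t7 \<le> acost2 (Const 0) (cvar 51) * ?F" by (rule order_trans)
    have "?t \<le> tconst * ?F"
      unfolding tconst_def distrib_right
      using order_trans[OF 1(3) st[OF dp(1)]] order_trans[OF 2(3) st[OF dp(2)]] order_trans[OF 3(3) st[OF dp(3)]]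
        order_trans[OF 4(3) st[OF dp(4)]] order_trans[OF 6(3) st[OF dp(5)]] t5 t7
      by linarith
    then have "?t \<le> tbound" unfolding tbound_def by (simp only: ac_simps)
    with ex ans show ?thesis by blast
  qed
  then show ?thesis using q(1) by blast
qed

definition texp :: nat where "texp = tconst + 4 * tdeg + 12"

text \<open>The constant factor disappears into the exponent:
  \<open>tconst \<le> 3 ^ tconst \<le> sz ^ tconst\<close>. The 12 accounts for the bit costs, and
  the factor 4 for the bound \<open>sz ^ 4\<close> on loop limits.\<close>

lemma tbound_le: "tbound \<le> 2 ^ k * sz ^ texp"
proof -
  have "tconst \<le> 3 ^ tconst" by (rule less_imp_le) (rule less_le_trans[OF less_exp], rule power_mono, auto)
  also have "\<dots> \<le> sz ^ tconst" using sz_ge by (intro power_mono) auto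
  finally have "tconst * (sz ^ (4 * tdeg) * (2 ^ k * U)) \<le> sz ^ tconst * (sz ^ (4 * tdeg) * (2 ^ k * sz ^ 12))"
    using U_le by (intro mult_le_mono) auto
  moreover have "tbound = tconst * (sz ^ (4 * tdeg) * (2 ^ k * U))"
    unfolding tbound_def power_mult by (simp only: mult.assoc)
  moreover have "sz ^ tconst * (sz ^ (4 * tdeg) * (2 ^ k * sz ^ 12)) = 2 ^ k * sz ^ texp"
    unfolding texp_def by (simp only: power_add ac_simps)
  ultimately show ?thesis by (simp only:)
qed

end

theorem theorem3:
  shows "\<exists>(c :: com) (e :: nat).
    monte_carlo_solves c vbp_few_small encode_vbp packable
      (\<lambda>I. 2 ^ card (small I) * input_size (encode_vbp I) ^ e)"
proof -
  have "monte_carlo_solves packer vbp_few_small encode_vbp packable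
      (\<lambda>I. 2 ^ card (small I) * input_size (encode_vbp I) ^ vbp_run.texp)"
    unfolding monte_carlo_solves_def
  proof (intro allI impI)
    fix I assume "vbp_few_small I"
    then interpret vbp_run I by unfold_locales
    obtain jj where q: "Q0 \<le> fsz jj" and run: "\<And>\<omega>. \<exists>t s \<omega>'. exec packer (init_mem xs, \<omega>) t (s, \<omega>') \<and> t \<le> tbound \<and>
       (s 0 \<noteq> 0 \<longleftrightarrow> accepts jj ((!!) \<omega>))"
      using exec_packer by blast
    have "halts_within packer (encode_vbp I) \<omega> (2 ^ card (small I) * input_size (encode_vbp I) ^ texp)" for \<omega>
      using run[of \<omega>] tbound_le unfolding halts_within_def xs_def k_def by (meson order_trans)
    \<comment> \<open>\<open>answers\<close> asserts that some run exists; determinism identifies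
      every such run with the one constructed, which gives the equivalence needed to compute the
      event.\<close>
    moreover have "answers packer (encode_vbp I) \<omega> (packable I) \<longleftrightarrow> (packable I \<longleftrightarrow> accepts jj ((!!) \<omega>))" for \<omega>
    proof -
      obtain t s \<omega>' where e: "exec packer (init_mem xs, \<omega>) t (s, \<omega>')" "s 0 \<noteq> 0 \<longleftrightarrow> accepts jj ((!!) \<omega>)"
        using run[of \<omega>] by blast
      show ?thesis
        unfolding answers_def xs_def[symmetric] using e exec_deterministic[OF e(1)] by blast
    qed
    then have "{\<omega> \<in> space coin_space. answers packer (encode_vbp I) \<omega> (packable I)} =
        {\<omega>. packable I \<longleftrightarrow> accepts jj ((!!) \<omega>)}" by simp
    then have "measure coin_space {\<omega> \<in> space coin_space. answers packer (encode_vbp I) \<omega> (packable I)} \<ge> 2/3"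
      using accepts_prob[OF q] by simp
    ultimately show "(\<forall>\<omega>. halts_within packer (encode_vbp I) \<omega> (2 ^ card (small I) * input_size (encode_vbp I) ^ texp)) \<and>
        2 / 3 \<le> measure coin_space {\<omega> \<in> space coin_space. answers packer (encode_vbp I) \<omega> (packable I)}"
      by blast
  qed
  then show ?thesis by blast
qed

end
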